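(* Let $t\ge 4$ be an integer and let $n$ be an integer with $2^t-1\le n<2^{t+1}-1$. Then \[ \operatorname{zcl}(W_n)=\begin{cases} 2^t+2^{t-1}-4, & 2^t-1\le n\le 2^t+2^{t-2},\\ 2^t+2^{t-1}-3, & n=2^t+2^{t-2}+1,\\ 2^t+2^{t-1}-2, & 2^t+2^{t-2}+2\le n\le 2^t+2^{t-1},\\ 2^{t+1}+2^{t-3}-3, & n=2^t+2^{t-1}+1,\\ 2^{t+1}+2^{t-3}-2, & 2^t+2^{t-1}+2\le n\le 13\cdot 2^{t-3},\\ 2^{t+1}+2^{t-2}-2, & 13\cdot 2^{t-3}+1\le n\le 2^t+2^{t-1}+2^{t-2},\\ 3\cdot 2^t-2^{s+1}-2, & 2^{t+1}-2^{s+1}+1\le n\le 2^{t+1}-2^s,\ \text{where } 1\le s\le t-3. \end{cases} \]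
   Context: For an integer $n\ge 6$, $G_{n,3}$ is the Grassmann manifold of $3$-dimensional subspaces of $\mathbb R^n$, $\widetilde G_{n,3}$ is the Grassmann manifold of oriented $3$-dimensional subspaces of $\mathbb R^n$, and $p:\widetilde G_{n,3}\to G_{n,3}$ is the two-fold covering forgetting orientation. $W_n$ denotes the image of $p^*:H^*(G_{n,3};\mathbb Z_2)\to H^*(\widetilde G_{n,3};\mathbb Z_2)$; it is the graded subalgebra generated by the Stiefel--Whitney classes $\widetilde w_2,\widetilde w_3$ of the canonical bundle over $\widetilde G_{n,3}$. It is well known that $W_n\cong \mathbb Z_2[w_2,w_3]/I_n$ as graded algebras ($\widetilde w_i$ corresponding to the coset of $w_i$, $\deg w_i=i$), where $I_n=(g_{n-2},g_{n-1},g_n)$ and the polynomials $g_r$ are given by $g_0=1$, $g_1=0$, $g_2=w_2$, $g_{r+3}=w_2g_{r+1}+w_3g_r$ for $r\ge 0$. For a graded $\mathbb Z_2$-algebra $A$, the zero-divisor cup-length $\operatorname{zcl}(A)$ is the supremum of all integers $d$ such that there exist elements of positive degree $z_1,\dots,z_d$ in the kernel of the multiplication map $A\otimes A\to A$ with $z_1z_2\cdots z_d\neq 0$ in $A\otimes A$ (tensor product over $\mathbb Z_2$). *)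

theory Defs
  imports
    "HOL-Analysis.Determinants"
    "HOL-Homology.Homology"
    "HOL-Algebra.QuotRing"
    "HOL-Computational_Algebra.Polynomial"
    "HOL-Library.Poly_Mapping"
    "HOL-Library.Extended_Nat"
    "HOL-Library.Z2"
begin

section \<open>Graded algebras over the field with two elements\<close>

text \<open>
  A \<open>\<int>\<^sub>2\<close>-algebra is the same thing as a ring in which \<open>x \<oplus> x = \<zero>\<close>, and the additive maps between
  such rings are the \<open>\<int>\<^sub>2\<close>-linear ones; no scalar multiplication has to be recorded. The set
  \<open>grade A k\<close> is the homogeneous component of degree \<open>k\<close>.
\<close>

record 'a graded_ring = "'a ring" +
  grade :: "nat \<Rightarrow> 'a set"

definition graded_quot :: "'a graded_ring \<Rightarrow> 'a set \<Rightarrow> 'a set graded_ring" where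
  "graded_quot R I =
     ring.extend (R Quot I) (graded_ring.fields (\<lambda>k. (\<lambda>x. I +>\<^bsub>R\<^esub> x) ` grade R k))"

definition graded_iso :: "'a graded_ring \<Rightarrow> 'b graded_ring \<Rightarrow> bool" where
  "graded_iso A B \<longleftrightarrow> (\<exists>h \<in> ring_iso A B. \<forall>k. h ` grade A k = grade B k)"


section \<open>Tensor product and zero-divisor cup-length\<close>

text \<open>
  \<open>A \<otimes> B\<close> is presented as the \<open>\<int>\<^sub>2\<close>-vector space with basis \<open>A \<times> B\<close>, with the componentwise product
  of basis vectors, modulo the bilinearity relations. Compatibility with the scalars 0 and 1
  follows from biadditivity, and there are no signs in characteristic 2.
\<close>

definition tensor_free ::
    "'a graded_ring \<Rightarrow> 'b graded_ring \<Rightarrow> (('a \<times> 'b) \<Rightarrow>\<^sub>0 bit) graded_ring" where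
  "tensor_free A B =
    \<lparr> carrier = {f. Poly_Mapping.keys f \<subseteq> carrier A \<times> carrier B},
      monoid.mult = (\<lambda>f g. \<Sum>x \<in> Poly_Mapping.keys f. \<Sum>y \<in> Poly_Mapping.keys g.
                Poly_Mapping.single (fst x \<otimes>\<^bsub>A\<^esub> fst y, snd x \<otimes>\<^bsub>B\<^esub> snd y)
                  (Poly_Mapping.lookup f x * Poly_Mapping.lookup g y)),
      one = Poly_Mapping.single (\<one>\<^bsub>A\<^esub>, \<one>\<^bsub>B\<^esub>) 1,
      zero = 0,
      add = (+),
      grade = (\<lambda>k. {f. Poly_Mapping.keys f \<subseteq>
                        (\<Union>i\<le>k. grade A i \<times> grade B (k - i))}) \<rparr>"

definition tensor_relations ::
    "'a graded_ring \<Rightarrow> 'b graded_ring \<Rightarrow> (('a \<times> 'b) \<Rightarrow>\<^sub>0 bit) set" where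
  "tensor_relations A B =
    {Poly_Mapping.single (a \<oplus>\<^bsub>A\<^esub> a', b) 1 - Poly_Mapping.single (a, b) 1
       - Poly_Mapping.single (a', b) 1 | a a' b.
       a \<in> carrier A \<and> a' \<in> carrier A \<and> b \<in> carrier B} \<union>
    {Poly_Mapping.single (a, b \<oplus>\<^bsub>B\<^esub> b') 1 - Poly_Mapping.single (a, b) 1
       - Poly_Mapping.single (a, b') 1 | a b b'.
       a \<in> carrier A \<and> b \<in> carrier B \<and> b' \<in> carrier B}"

definition tensor ::
    "'a graded_ring \<Rightarrow> 'b graded_ring \<Rightarrow> (('a \<times> 'b) \<Rightarrow>\<^sub>0 bit) set graded_ring" where
  "tensor A B =
     graded_quot (tensor_free A B) (Idl\<^bsub>tensor_free A B\<^esub> (tensor_relations A B))"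

definition mult_map :: "'a graded_ring \<Rightarrow> (('a \<times> 'a) \<Rightarrow>\<^sub>0 bit) set \<Rightarrow> 'a" where
  "mult_map A X =
     the_elem ((\<lambda>f. \<Oplus>\<^bsub>A\<^esub>x \<in> Poly_Mapping.keys f. fst x \<otimes>\<^bsub>A\<^esub> snd x) ` X)"

definition positive_zero_divisors :: "'a graded_ring \<Rightarrow> (('a \<times> 'a) \<Rightarrow>\<^sub>0 bit) set set" where
  "positive_zero_divisors A =
     {z \<in> carrier (tensor A A). (\<exists>k>0. z \<in> grade (tensor A A) k) \<and> mult_map A z = \<zero>\<^bsub>A\<^esub>}"

definition zcl :: "'a graded_ring \<Rightarrow> enat" where
  "zcl A = Sup {enat (length zs) | zs. set zs \<subseteq> positive_zero_divisors A \<and>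
                  foldr (monoid.mult (tensor A A)) zs \<one>\<^bsub>tensor A A\<^esub> \<noteq> \<zero>\<^bsub>tensor A A\<^esub>}"


section \<open>Singular cohomology with coefficients in the field with two elements\<close>

text \<open>
  A total cochain assigns to each degree \<open>p\<close> a function on singular \<open>p\<close>-simplices (extended by 0
  to other arguments); only finitely many degrees are nonzero, so that the cohomology is the direct
  sum of the groups \<open>H\<^sup>p(X; \<int>\<^sub>2)\<close>.
\<close>

type_synonym 'a cochain = "nat \<Rightarrow> ((nat \<Rightarrow> real) \<Rightarrow> 'a) \<Rightarrow> bit"

definition cochains :: "'a topology \<Rightarrow> 'a cochain set" where
  "cochains X = {c. (\<forall>p \<sigma>. c p \<sigma> \<noteq> 0 \<longrightarrow> singular_simplex p X \<sigma>) \<and> finite {p. \<exists>\<sigma>. c p \<sigma> \<noteq> 0}}"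

definition coboundary :: "'a topology \<Rightarrow> 'a cochain \<Rightarrow> 'a cochain" where
  "coboundary X c = (\<lambda>p \<sigma>.
     if p > 0 \<and> singular_simplex p X \<sigma> then \<Sum>k\<le>p. c (p - 1) (singular_face p k \<sigma>) else 0)"

text \<open>The restrictions of a simplex to its first \<open>i + 1\<close> vertices, and to the \<open>j + 1\<close> vertices from
  the \<open>i\<close>-th one on.\<close>

definition front_face :: "nat \<Rightarrow> ((nat \<Rightarrow> real) \<Rightarrow> 'a) \<Rightarrow> (nat \<Rightarrow> real) \<Rightarrow> 'a" where
  "front_face i \<sigma> = restrict \<sigma> (standard_simplex i)"

definition back_face :: "nat \<Rightarrow> nat \<Rightarrow> ((nat \<Rightarrow> real) \<Rightarrow> 'a) \<Rightarrow> (nat \<Rightarrow> real) \<Rightarrow> 'a" where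
  "back_face i j \<sigma> = restrict (\<lambda>x. \<sigma> (\<lambda>m. if m < i then 0 else x (m - i))) (standard_simplex j)"

definition cup :: "'a topology \<Rightarrow> 'a cochain \<Rightarrow> 'a cochain \<Rightarrow> 'a cochain" where
  "cup X c d = (\<lambda>p \<sigma>.
     if singular_simplex p X \<sigma>
     then \<Sum>i\<le>p. c i (front_face i \<sigma>) * d (p - i) (back_face i (p - i) \<sigma>) else 0)"

definition cocycle_ring :: "'a topology \<Rightarrow> 'a cochain graded_ring" where
  "cocycle_ring X =
    \<lparr> carrier = {c \<in> cochains X. coboundary X c = (\<lambda>p \<sigma>. 0)},
      monoid.mult = cup X,
      one = (\<lambda>p \<sigma>. if p = 0 \<and> singular_simplex 0 X \<sigma> then 1 else 0),
      zero = (\<lambda>p \<sigma>. 0),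
      add = (\<lambda>c d p \<sigma>. c p \<sigma> + d p \<sigma>),
      grade = (\<lambda>k. {c \<in> cochains X. coboundary X c = (\<lambda>p \<sigma>. 0) \<and>
                                    (\<forall>p \<sigma>. c p \<sigma> \<noteq> 0 \<longrightarrow> p = k)}) \<rparr>"

definition coboundaries :: "'a topology \<Rightarrow> 'a cochain set" where
  "coboundaries X = coboundary X ` cochains X"

definition cohomology :: "'a topology \<Rightarrow> 'a cochain set graded_ring" where
  "cohomology X = graded_quot (cocycle_ring X) (coboundaries X)"

definition cochain_pullback ::
    "'a topology \<Rightarrow> ('a \<Rightarrow> 'b) \<Rightarrow> 'b cochain \<Rightarrow> 'a cochain" where
  "cochain_pullback X f c = (\<lambda>p \<sigma>. if singular_simplex p X \<sigma> then c p (simplex_map p f \<sigma>) else 0)"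

definition cohomology_map ::
    "'a topology \<Rightarrow> ('a \<Rightarrow> 'b) \<Rightarrow> 'b cochain set \<Rightarrow> 'a cochain set" where
  "cohomology_map X f Z = (\<Union>z\<in>Z. coboundaries X +>\<^bsub>cocycle_ring X\<^esub> cochain_pullback X f z)"


section \<open>Grassmann manifolds\<close>

text \<open>
  The rows of a matrix \<open>v :: real^'n^3\<close> of rank 3 form an ordered basis of a 3-dimensional subspace
  of \<open>\<real>\<^sup>n\<close> with \<open>n = CARD('n)\<close>. An orientation of a subspace is one of the two classes of its ordered
  bases, where the bases \<open>v\<close> and \<open>A ** v\<close> are equivalent iff \<open>det A > 0\<close>. Both Grassmannians carry the
  quotient topology from the open set of rank 3 matrices (the noncompact Stiefel manifold).
\<close>

definition quotient_topology :: "'a topology \<Rightarrow> ('a \<Rightarrow> 'b) \<Rightarrow> 'b topology" where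
  "quotient_topology X q =
     topology (\<lambda>U. U \<subseteq> q ` topspace X \<and> openin X {x \<in> topspace X. q x \<in> U})"

definition frames :: "(real^'n::finite^3) set" where
  "frames = {v. rank v = 3}"

definition orientation_class :: "real^'n::finite^3 \<Rightarrow> (real^'n^3) set" where
  "orientation_class v = {A ** v | A :: real^3^3. det A > 0}"

definition grassmannian :: "(real^'n::finite) set topology" where
  "grassmannian = quotient_topology (top_of_set frames) (\<lambda>v. span (rows v))"

definition oriented_grassmannian :: "((real^'n::finite) set \<times> (real^'n^3) set) topology" where
  "oriented_grassmannian =
     quotient_topology (top_of_set frames) (\<lambda>v. (span (rows v), orientation_class v))"

text \<open>The double covering forgetting the orientation is \<^const>\<open>fst\<close>; \<open>W_algebra TYPE('n)\<close> is the
  image of the homomorphism induced by it.\<close>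

definition W_algebra ::
    "'n::finite itself \<Rightarrow> ((real^'n) set \<times> (real^'n^3) set) cochain set graded_ring" where
  "W_algebra _ =
    (let H = cohomology (oriented_grassmannian :: ((real^'n) set \<times> (real^'n^3) set) topology);
         W = cohomology_map (oriented_grassmannian :: ((real^'n) set \<times> (real^'n^3) set) topology) fst
               ` carrier (cohomology (grassmannian :: (real^'n) set topology))
     in H\<lparr>carrier := W, grade := (\<lambda>k. W \<inter> grade H k)\<rparr>)"


section \<open>The presented algebra\<close>

text \<open>Classically, the algebra \<open>W\<close> over \<open>\<real>\<^sup>n\<close> is isomorphic to \<open>presented_algebra n\<close> below as a graded
  algebra, the Stiefel-Whitney classes of the canonical bundle corresponding to the cosets of the
  variables. \<open>\<int>\<^sub>2[w\<^sub>2, w\<^sub>3]\<close> is \<^typ>\<open>bit poly poly\<close>, with \<open>w\<^sub>2\<close> the inner and \<open>w\<^sub>3\<close> the outer variable.\<close>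

definition w2 :: "bit poly poly" where
  "w2 = [:[:0, 1:]:]"

definition w3 :: "bit poly poly" where
  "w3 = [:0, 1:]"

definition w_polynomials :: "bit poly poly graded_ring" where
  "w_polynomials =
    \<lparr> carrier = UNIV, monoid.mult = (*), one = 1, zero = 0, add = (+),
      grade = (\<lambda>k. {f. \<forall>i j. coeff (coeff f j) i \<noteq> 0 \<longrightarrow> 2 * i + 3 * j = k}) \<rparr>"

fun g_poly :: "nat \<Rightarrow> bit poly poly" where
  "g_poly 0 = 1"
| "g_poly (Suc 0) = 0"
| "g_poly (Suc (Suc 0)) = w2"
| "g_poly (Suc (Suc (Suc r))) = w2 * g_poly (Suc r) + w3 * g_poly r"

definition presented_algebra :: "nat \<Rightarrow> bit poly poly set graded_ring" where
  "presented_algebra n =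
     graded_quot w_polynomials (Idl\<^bsub>w_polynomials\<^esub> {g_poly (n - 2), g_poly (n - 1), g_poly n})"

end

theory Submission
  imports Defs
begin

text \<open>
  Write \<open>R = \<int>\<^sub>2[w\<^sub>2, w\<^sub>3]\<close>, \<open>a\<^sub>T = g\<^sub>q\<^sub>-\<^sub>2\<close> and \<open>b\<^sub>T = g\<^sub>q\<^sub>-\<^sub>1\<close> for \<open>q = 2\<^sup>T\<close>. The Frobenius relations
  \<open>a\<^sub>T\<^sub>+\<^sub>1 = w\<^sub>2 a\<^sub>T\<^sup>2 + b\<^sub>T\<^sup>2\<close>, \<open>b\<^sub>T\<^sub>+\<^sub>1 = w\<^sub>3 a\<^sub>T\<^sup>2\<close> show that the complete intersection \<open>R / (a\<^sub>T, b\<^sub>T)\<close> satisfies Poincare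
  duality with respect to the functional \<open>\<phi>\<^sub>T\<close> which sums the coefficients of the monomials
  \<open>w\<^sub>2\<^sup>i w\<^sub>3\<^sup>j\<close> with \<open>i = 2\<^sup>T - 1 - 3 \<cdot> 2\<^sup>k\<close> and \<open>j = 2\<^sup>k\<^sup>+\<^sup>1 - 2\<close>. For \<open>2\<^sup>t - 1 \<le> n < 2\<^sup>t\<^sup>+\<^sup>1\<close>, a linkage argument gives
  \<open>I\<^sub>n = {f. f \<in> I\<^sub>q \<and> w\<^sub>3\<^sup>m f \<in> I\<^sub>2\<^sub>q}\<close> with \<open>q = 2\<^sup>t\<close> and \<open>m = 2\<^sup>t\<^sup>+\<^sup>1 - 1 - n\<close>, so that \<open>\<phi>\<^sub>t\<close> and
  \<open>f \<mapsto> \<phi>\<^sub>t\<^sub>+\<^sub>1 (w\<^sub>3\<^sup>m f)\<close> and their multiples detect \<open>R / I\<^sub>n\<close>.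

  The kernel of the multiplication of \<open>A \<otimes> A\<close> is generated by \<open>z\<^sub>i = w\<^sub>i \<otimes> 1 + 1 \<otimes> w\<^sub>i\<close>, hence the
  cup-length is the largest \<open>a + b\<close> with \<open>z\<^sub>2\<^sup>a z\<^sub>3\<^sup>b \<noteq> 0\<close>. Pairing \<open>z\<^sub>2\<^sup>a z\<^sub>3\<^sup>b\<close> with two functionals of the above kind
  leaves at most two binomial coefficients modulo 2, belonging to the two orderings of a pair
  \<open>(k, l)\<close> for which \<open>2\<^sup>k + 2\<^sup>l\<close> is prescribed, and everything is decided by Lucas' theorem.
\<close>

section \<open>Bivariate polynomials over the field with two elements\<close>

text \<open>Nonvanishing in a quotient such as \<open>A \<otimes> A\<close> needs a witness, so its
  elements are not computed with directly: they act on bilinear forms, and every question becomes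
  one about forms built from two functionals.

  Enlarging \<open>m\<close> only multiplies the second functional by a power of \<open>w3\<close>.
  On a range of \<open>n\<close> with constant value, the upper bound is thus shown for the largest
  \<open>n\<close> (smallest \<open>m\<close>) and the lower bound for the smallest
  \<open>n\<close>. With \<open>h = 2 ^ (t - 3)\<close> one has m = 16h - 1 - n, so the right ends
  10h, 10h+1, 12h, 12h+1, 13h, 14h become m = 6h-1, 6h-2, 4h-1, 4h-2, 3h-1, 2h-1, and the last
  family gives m = 2^s - 1.

  The \<open>k\<close>-th monomial of the functional for \<open>T = t + 1\<close> survives the shift
  by \<open>w3 ^ m\<close> exactly if \<open>m + 2 \<le> 2 * 2 ^ k\<close>. Up to n = 12h at most k
  = t - 1 survives, with \<open>w2\<close> exponent 4h - 1; from n = 12h + 1 on k = t - 2 joins,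
  with exponent 10h - 1. This lifts the Frobenius bound for z2 from 2^t to 2^(t+1) and explains the
  jump from about 12h to about 17h.\<close>

lemma bit_add_self [simp]: "(a::bit) + a = 0"
  by (cases a) auto

lemma poly_bit_add_self [simp]: "(p::bit poly) + p = 0"
  by (rule poly_eqI) (simp only: coeff_add bit_add_self coeff_0)

lemma poly_poly_bit_add_self [simp]: "(p::bit poly poly) + p = 0"
  by (rule poly_eqI) (simp only: coeff_add poly_bit_add_self coeff_0)

lemma poly_poly_bit_2 [simp]: "(2::bit poly poly) = 0"
  using poly_poly_bit_add_self[of 1] by (simp only: one_add_one)

lemma poly_poly_bit_add_self' [simp]: "(p::bit poly poly) + (p + q) = q"
  by (simp flip: add.assoc)

lemma poly_poly_bit_add_eq_0_iff: "(p::bit poly poly) + q = 0 \<longleftrightarrow> p = q"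
  by (metis add.assoc add_0_right add_0_left poly_poly_bit_add_self)

lemma pCons_square:
  fixes a :: "'a::comm_ring_1"
  assumes "\<And>b::'a. b + b = 0"
  shows "(pCons a p)\<^sup>2 = pCons (a\<^sup>2) (pCons 0 (p\<^sup>2))"
proof -
  have "q + q = 0" for q :: "'a poly"
    by (rule poly_eqI) (simp only: coeff_add assms coeff_0)
  moreover have "(pCons a p)\<^sup>2 = pCons (a\<^sup>2) (pCons 0 (p\<^sup>2)) + (pCons 0 (smult a p) + pCons 0 (smult a p))"
    by (simp add: power2_eq_square)
  ultimately show ?thesis by simp
qed

lemma coeff_square:
  fixes p :: "'a::comm_ring_1 poly"
  assumes "\<And>b::'a. b + b = 0"
  shows "coeff (p\<^sup>2) k = (if even k then (coeff p (k div 2))\<^sup>2 else 0)"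
proof (induction p arbitrary: k)
  case 0
  then show ?case by simp
next
  case (pCons a p)
  show ?case
  proof (cases k)
    case (Suc k')
    then show ?thesis
      by (cases k') (auto simp: pCons_square[OF assms] pCons.IH)
  qed (simp add: pCons_square[OF assms])
qed

definition cf :: "bit poly poly \<Rightarrow> nat \<Rightarrow> nat \<Rightarrow> bit" where
  "cf f i j = coeff (coeff f j) i"

lemma cf_add [simp]: "cf (f + g) i j = cf f i j + cf g i j"
  by (simp add: cf_def)

lemma w3_mult: "w3 * f = pCons 0 f"
  by (simp add: w3_def)

lemma w2_mult: "w2 * f = smult [:0, 1:] f"
  by (simp add: w2_def)

lemma cf_w3_mult [simp]: "cf (w3 * f) i j = (case j of 0 \<Rightarrow> 0 | Suc j' \<Rightarrow> cf f i j')"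
  by (simp add: cf_def w3_mult coeff_pCons split: nat.split)

lemma cf_w2_mult [simp]: "cf (w2 * f) i j = (case i of 0 \<Rightarrow> 0 | Suc i' \<Rightarrow> cf f i' j)"
  by (simp add: cf_def w2_mult coeff_pCons split: nat.split)

lemma cf_square [simp]:
  "cf (f\<^sup>2) i j = (if even i \<and> even j then cf f (i div 2) (j div 2) else 0)"
proof -
  have "b\<^sup>2 = b" for b :: bit by (cases b) auto
  then show ?thesis
    by (auto simp: cf_def coeff_square)
qed

lemma square_add: "((p::bit poly poly) + q)\<^sup>2 = p\<^sup>2 + q\<^sup>2"
proof -
  have "(p + q)\<^sup>2 = p\<^sup>2 + q\<^sup>2 + (p * q + p * q)"
    by (simp add: power2_eq_square algebra_simps)
  then show ?thesis by simp
qed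

lemma cf_monomial: "cf (w2 ^ i * w3 ^ j) k l = of_bool (k = i \<and> l = j)"
proof (induction i arbitrary: k)
  case 0
  show ?case
  proof (induction j arbitrary: l)
    case 0
    show ?case by (simp add: cf_def coeff_pCons split: nat.split)
  next
    case (Suc j)
    then show ?case by (auto split: nat.split)
  qed
next
  case (Suc i)
  then show ?case
    by (auto simp: mult.assoc split: nat.split)
qed

text \<open>The only scalars are 1 and 0 = 1 + 1, so sums of monomials already exhaust the ring and
  no scalar case arises.\<close>

lemma poly_poly_bit_induct:
  fixes P :: "bit poly poly \<Rightarrow> bool"
  assumes add: "\<And>p q. P p \<Longrightarrow> P q \<Longrightarrow> P (p + q)" and one: "P 1"
    and w2: "\<And>p. P p \<Longrightarrow> P (w2 * p)" and w3: "\<And>p. P p \<Longrightarrow> P (w3 * p)"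
  shows "P p"
proof (induction p)
  case 0
  show ?case using add[OF one one] by simp
next
  case (pCons c p)
  have zero: "P 0" using add[OF one one] by simp
  have "P [:c:]" for c
  proof (induction c)
    case 0
    show ?case using zero by simp
  next
    case (pCons a c)
    have "[:pCons a c:] = [:[:a:]:] + w2 * [:c:]"
      by (simp add: w2_def)
    moreover have "P [:[:a:]:]"
      using one zero by (cases a) (auto simp: one_pCons)
    ultimately show ?case
      using add w2[OF pCons.IH] by simp
  qed
  moreover have "pCons c p = [:c:] + w3 * p"
    by (simp add: w3_mult)
  ultimately show ?case
    using add w3[OF pCons.IH] by simp
qed

text \<open>The ring is spanned over its squares by 1, \<open>w2\<close>, \<open>w3\<close>,
  \<open>w2 * w3\<close>, since multiplication by a variable permutes these four up to square
  factors. The inductions on \<open>T\<close> for \<open>phi\<close> descend through this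
  decomposition.\<close>

lemma square_decomposition:
  fixes f :: "bit poly poly"
  obtains f00 f10 f01 f11 where "f = f00\<^sup>2 + w2 * f10\<^sup>2 + w3 * f01\<^sup>2 + w2 * (w3 * f11\<^sup>2)"
proof -
  have "\<exists>f00 f10 f01 f11. f = f00\<^sup>2 + w2 * f10\<^sup>2 + w3 * f01\<^sup>2 + w2 * (w3 * f11\<^sup>2)"
  proof (induction f rule: poly_poly_bit_induct)
    case (1 p q)
    then obtain a b c d a1 b1 c1 d1 where
      "p = a\<^sup>2 + w2 * b\<^sup>2 + w3 * c\<^sup>2 + w2 * (w3 * d\<^sup>2)"
      "q = a1\<^sup>2 + w2 * b1\<^sup>2 + w3 * c1\<^sup>2 + w2 * (w3 * d1\<^sup>2)" by blast
    then have "p + q = (a + a1)\<^sup>2 + w2 * (b + b1)\<^sup>2 + w3 * (c + c1)\<^sup>2 + w2 * (w3 * (d + d1)\<^sup>2)"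
      unfolding square_add by (simp add: algebra_simps)
    then show ?case by blast
  next
    case 2
    have "1 = 1\<^sup>2 + w2 * 0\<^sup>2 + w3 * 0\<^sup>2 + w2 * (w3 * 0\<^sup>2)" by simp
    then show ?case by blast
  next
    case (3 p)
    then obtain a b c d where
      "p = a\<^sup>2 + w2 * b\<^sup>2 + w3 * c\<^sup>2 + w2 * (w3 * d\<^sup>2)" by blast
    then have "w2 * p = (w2 * b)\<^sup>2 + w2 * a\<^sup>2 + w3 * (w2 * d)\<^sup>2 + w2 * (w3 * c\<^sup>2)"
      by (simp add: algebra_simps power2_eq_square)
    then show ?case by blast
  next
    case (4 p)
    then obtain a b c d where
      "p = a\<^sup>2 + w2 * b\<^sup>2 + w3 * c\<^sup>2 + w2 * (w3 * d\<^sup>2)" by blast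
    then have "w3 * p = (w3 * c)\<^sup>2 + w2 * (w3 * d)\<^sup>2 + w3 * a\<^sup>2 + w2 * (w3 * b\<^sup>2)"
      by (simp add: algebra_simps power2_eq_square)
    then show ?case by blast
  qed
  then show thesis using that by blast
qed

text \<open>If G is the generating series of the \<open>g_poly r\<close>, then (1 + w2 x^2 + w3 x^3)
  G = 1, hence G = (1 + w2 x^2 + w3 x^3) G^2. In characteristic 2 the coefficient of x^(2k) in G^2
  is \<open>(g_poly k)\<^sup>2\<close>, and comparing even and odd coefficients suggests the two
  formulas.\<close>

lemma g_poly_double:
  "g_poly (2 * k + 2) = (g_poly (k + 1))\<^sup>2 + w2 * (g_poly k)\<^sup>2 \<and> g_poly (2 * k + 3) = w3 * (g_poly k)\<^sup>2"
proof (induction k rule: less_induct)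
  case (less k)
  consider "k = 0" | "k = 1" | j where "k = j + 2"
    by (metis One_nat_def add_2_eq_Suc' not0_implies_Suc)
  then show ?case
  proof cases
    case 1
    then show ?thesis by (simp add: numeral_eq_Suc)
  next
    case 2
    then show ?thesis by (simp add: numeral_eq_Suc power2_eq_square)
  next
    case (3 j)
    have 1: "g_poly (2 * j + 4) = (g_poly (j + 2))\<^sup>2 + w2 * (g_poly (j + 1))\<^sup>2"
        "g_poly (2 * j + 5) = w3 * (g_poly (j + 1))\<^sup>2" "g_poly (2 * j + 3) = w3 * (g_poly j)\<^sup>2"
      using less[of "j + 1"] less[of j] 3 by (auto simp: eval_nat_numeral)
    have 2: "g_poly (2 * j + 6) = w2 * g_poly (2 * j + 4) + w3 * g_poly (2 * j + 3)"
      "g_poly (2 * j + 7) = w2 * g_poly (2 * j + 5) + w3 * g_poly (2 * j + 4)"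
      "g_poly (j + 3) = w2 * g_poly (j + 1) + w3 * g_poly j"
      by (simp_all add: eval_nat_numeral)
    have 4: "g_poly (2 * j + 6) = (g_poly (j + 3))\<^sup>2 + w2 * (g_poly (j + 2))\<^sup>2"
      unfolding 2 1 square_add by (simp add: power2_eq_square algebra_simps)
    have 5: "g_poly (2 * j + 7) = w3 * (g_poly (j + 2))\<^sup>2"
      unfolding 2 1 by (simp add: power2_eq_square algebra_simps)
    show ?thesis using 4 5 3 by (simp add: eval_nat_numeral)
  qed
qed

definition ga :: "nat \<Rightarrow> bit poly poly" where "ga T = g_poly (2 ^ T - 2)"
definition gb :: "nat \<Rightarrow> bit poly poly" where "gb T = g_poly (2 ^ T - 1)"

lemma two_power_ge2: "T \<ge> 1 \<Longrightarrow> (2::nat) ^ T \<ge> 2"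
  by (metis power_increasing power_one_right one_le_numeral)

lemma ga_1 [simp]: "ga (Suc 0) = 1" and gb_1 [simp]: "gb (Suc 0) = 0"
  by (simp_all add: ga_def gb_def)

lemma ga_Suc: "ga (Suc T) = w2 * (ga T)\<^sup>2 + (gb T)\<^sup>2" if T: "T \<ge> 1"
proof -
  obtain k where k: "2 ^ T = k + (2::nat)" using two_power_ge2[OF T] by (metis le_add_diff_inverse2)
  show ?thesis using g_poly_double[of k] by (simp add: ga_def gb_def k add.commute)
qed

lemma gb_Suc: "gb (Suc T) = w3 * (ga T)\<^sup>2" if T: "T \<ge> 1"
proof -
  obtain k where k: "2 ^ T = k + (2::nat)" using two_power_ge2[OF T] by (metis le_add_diff_inverse2)
  show ?thesis using g_poly_double[of k] by (simp add: ga_def gb_def k numeral_3_eq_3)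
qed

text \<open>The odd doubling formula propagates \<open>g_poly 1 = 0\<close>: for k = 2^S - 3 the
  index 2k + 3 equals 2^(S+1) - 3.\<close>

lemma g_poly_eq_0: "g_poly (2 ^ (T + 2) - 3) = 0"
proof (induction T)
  case 0
  show ?case by simp
next
  case (Suc T)
  have "(2::nat) ^ (T + 2) \<ge> 2 ^ 2" by (rule power_increasing) auto
  then have "(2::nat) ^ (T + 2) \<ge> 3" by (rule order_trans[rotated]) simp
  then obtain k where k: "2 ^ (T + 2) = k + (3::nat)" by (metis le_add_diff_inverse2)
  have "2 ^ (Suc T + 2) - 3 = 2 * k + (3::nat)" using k by simp
  then show ?case using g_poly_double[of k] Suc k by (simp add: add.commute)
qed

text \<open>Both sides obey the same recurrence in \<open>j\<close>; the initial values agree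
  because \<open>g_poly (2 ^ T - 3)\<close> vanishes. It provides the coordinates of all later
  generators with respect to \<open>ga T\<close> and \<open>gb T\<close>.\<close>

lemma g_poly_shift:
  "g_poly (2 ^ T + j - 1) = ga T * g_poly (j + 1) + gb T * g_poly j" if T: "T \<ge> 2"
proof (induction j rule: less_induct)
  case (less j)
  have ge: "(2::nat) ^ T \<ge> 4" using power_increasing[OF T, of "2::nat"] by simp
  have z: "g_poly (2 ^ T - 3) = 0" using g_poly_eq_0[of "T - 2"] T
    by (metis le_add_diff_inverse2)
  obtain K where K: "2 ^ T = K + (4::nat)" using ge by (metis le_add_diff_inverse2)
  have g3: "g_poly (Suc (Suc (Suc r))) = w2 * g_poly (Suc r) + w3 * g_poly r" for r by simp
  consider "j = 0" | "j = 1" | "j = 2" | i where "j = i + 3"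
    by (metis One_nat_def Suc_1 add.commute add_Suc_right numeral_3_eq_3 One_nat_def add_0_right not0_implies_Suc)
  then show ?case
  proof cases
    case 1
    then show ?thesis using K by (simp add: ga_def gb_def)
  next
    case 2
    have "g_poly (K + 4) = w2 * g_poly (K + 2) + w3 * g_poly (K + 1)"
      using g3[of "K + 1"] by (simp add: eval_nat_numeral)
    then show ?thesis using 2 K z by (simp add: ga_def gb_def eval_nat_numeral)
  next
    case 3
    have "g_poly (K + 5) = w2 * g_poly (K + 3) + w3 * g_poly (K + 2)"
      using g3[of "K + 2"] by (simp add: eval_nat_numeral)
    then show ?thesis using 3 K by (simp add: ga_def gb_def eval_nat_numeral algebra_simps)
  next
    case (4 i)
    have "g_poly (2 ^ T + (i + 3) - 1) = w2 * g_poly (2 ^ T + (i + 1) - 1) + w3 * g_poly (2 ^ T + i - 1)"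
      using g3[of "2 ^ T + i - 1"] K by (simp add: eval_nat_numeral)
    then show ?thesis using less[of "i + 1"] less[of i] 4
      by (simp add: eval_nat_numeral algebra_simps)
  qed
qed

section \<open>The duality functional\<close>

text \<open>All monomials have weighted degree 2^(T+1) - 8 = deg \<open>ga T\<close> + deg
  \<open>gb T\<close> - 2 - 3, the socle degree of the complete intersection. For T = 2 this is the
  constant coefficient; for T = 1 the sum is empty, matching the unit ideal.\<close>

definition phi :: "nat \<Rightarrow> bit poly poly \<Rightarrow> bit" where
  "phi T f = (\<Sum>k<T - 1. cf f (2 ^ T - 1 - 3 * 2 ^ k) (2 ^ (k + 1) - 2))"

text \<open>The exponents of \<open>w3\<close> are raised by one, so that \<open>w3\<close> times a
  polynomial is sent to its value under \<open>phi\<close>. This is the form that the functional for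
  T + 1 takes on \<open>w2\<close> times a square.\<close>

definition phiy :: "nat \<Rightarrow> bit poly poly \<Rightarrow> bit" where
  "phiy T f = (\<Sum>k<T - 1. cf f (2 ^ T - 1 - 3 * 2 ^ k) (2 ^ (k + 1) - 1))"

lemma phi_add [simp]: "phi T (f + g) = phi T f + phi T g"
  by (simp only: phi_def cf_add sum.distrib)

lemma phiy_add [simp]: "phiy T (f + g) = phiy T f + phiy T g"
  by (simp only: phiy_def cf_add sum.distrib)

text \<open>Ensures that the exponents of \<open>w2\<close> in \<open>phi\<close> are genuine
  differences of natural numbers.\<close>

lemma phi_index_bound: "3 * 2 ^ k + 1 \<le> (2::nat) ^ T" if "k < T - 1"
proof -
  have "k + 2 \<le> T" using that by linarith
  then have "(2::nat) ^ (k + 2) \<le> 2 ^ T" by (rule power_increasing) simp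
  moreover have "(1::nat) \<le> 2 ^ k" by simp
  moreover have "(2::nat) ^ (k + 2) = 4 * 2 ^ k" by simp
  ultimately show ?thesis by linarith
qed

lemma phiy_w3_mult [simp]: "phiy T (w3 * f) = phi T f"
  unfolding phi_def phiy_def
proof (rule sum.cong[OF refl])
  fix k
  have "2 ^ (k + 1) - 1 = Suc (2 ^ (k + 1) - (2::nat))"
    using two_power_ge2[of "k + 1"] by linarith
  then show "cf (w3 * f) (2 ^ T - 1 - 3 * 2 ^ k) (2 ^ (k + 1) - 1) =
      cf f (2 ^ T - 1 - 3 * 2 ^ k) (2 ^ (k + 1) - 2)"
    by (simp only: cf_w3_mult nat.case)
qed

lemma sum_lessThan_Suc_first: "(\<Sum>k<T. F k) = F 0 + (\<Sum>k<T - 1. F (Suc k))" if T: "T \<ge> 1"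
  for F :: "nat \<Rightarrow> bit"
proof -
  obtain S where "T = Suc S" using T by (cases T) auto
  then show ?thesis by (simp only: sum.lessThan_Suc_shift diff_Suc_1)
qed

text \<open>For k > 0 the exponent of \<open>w2\<close> is odd, so a square is seen only by the
  monomial with k = 0.\<close>

lemma phi_square:
  assumes T: "T \<ge> 1"
  shows "phi (Suc T) (f\<^sup>2) = cf f (2 ^ T - 2) 0"
proof -
  have "cf (f\<^sup>2) (2 ^ Suc T - 1 - 3 * 2 ^ Suc k) (2 ^ (Suc k + 1) - 2) = 0" if "k < T - 1" for k
  proof -
    have "Suc k < Suc T - 1" using that by linarith
    then have "3 * 2 ^ Suc k + 1 \<le> (2::nat) ^ Suc T" by (rule phi_index_bound)
    then have "odd ((2::nat) ^ Suc T - 1 - 3 * 2 ^ Suc k)"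
      by simp
    then show ?thesis by (simp only: cf_square if_False simp_thms)
  qed
  then have "phi (Suc T) (f\<^sup>2) = cf (f\<^sup>2) (2 ^ Suc T - 1 - 3 * 2 ^ 0) (2 ^ (0 + 1) - 2)"
    unfolding phi_def diff_Suc_1 sum_lessThan_Suc_first[OF T] by simp
  also have "2 ^ Suc T - 1 - 3 * 2 ^ 0 = 2 * (2 ^ T - (2::nat))" by simp
  finally show ?thesis by simp
qed

text \<open>Here the monomial with k = 0 is the one of the wrong parity. The remaining ones, after
  removing \<open>w2\<close> and halving, are those of \<open>phiy T\<close> with index lowered by
  one.\<close>

lemma phi_w2_square:
  assumes T: "T \<ge> 1"
  shows "phi (Suc T) (w2 * f\<^sup>2) = phiy T f"
proof -
  have "cf (w2 * f\<^sup>2) (2 ^ Suc T - 1 - 3 * 2 ^ Suc k) (2 ^ (Suc k + 1) - 2)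
      = cf f (2 ^ T - 1 - 3 * 2 ^ k) (2 ^ (k + 1) - 1)" if "k < T - 1" for k
  proof -
    have "2 ^ Suc T - 1 - 3 * 2 ^ Suc k = Suc (2 * (2 ^ T - 1 - 3 * 2 ^ k :: nat))"
      using phi_index_bound[OF that] by simp
    moreover have "2 ^ (Suc k + 1) - 2 = 2 * (2 ^ (k + 1) - 1 :: nat)" by simp
    ultimately show ?thesis by (simp only: cf_w2_mult cf_square nat.case) simp
  qed
  moreover have "cf (w2 * f\<^sup>2) (2 ^ Suc T - 1 - 3 * 2 ^ 0) (2 ^ (0 + 1) - 2) = 0"
  proof -
    have "2 ^ Suc T - 1 - 3 * 2 ^ 0 = 2 * (2 ^ T - (2::nat))" by simp
    then show ?thesis by (simp split: nat.split) presburger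
  qed
  ultimately show ?thesis
    unfolding phi_def diff_Suc_1 sum_lessThan_Suc_first[OF T] phiy_def by simp
qed

text \<open>All exponents of \<open>w3\<close> occurring in \<open>phi\<close> are even.\<close>

lemma phi_w3_square [simp]: "phi T (w3 * f\<^sup>2) = 0"
  and phi_w2_w3_square [simp]: "phi T (w2 * (w3 * f\<^sup>2)) = 0"
proof -
  have "cf (w3 * f\<^sup>2) i (2 ^ (k + 1) - 2) = 0" for i k
  proof -
    have "2 ^ (k + 1) - 2 = 2 * (2 ^ k - 1 :: nat)" by simp
    then show ?thesis by (simp split: nat.split) presburger
  qed
  then show "phi T (w3 * f\<^sup>2) = 0" "phi T (w2 * (w3 * f\<^sup>2)) = 0"
    unfolding phi_def cf_w2_mult by (auto intro!: sum.neutral split: nat.split)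
qed

lemma coeff_ga_odd: "coeff (ga T) j = 0" if T: "T \<ge> 1" and j: "odd j"
proof (cases "T = 1")
  case True
  then show ?thesis using j by (cases j) (auto simp: one_pCons)
next
  case False
  then obtain S where S: "T = Suc S" "S \<ge> 1" using T by (cases T) auto
  have "cf (ga T) i j = 0" for i
    unfolding S(1) ga_Suc[OF S(2)] using j by (simp split: nat.split)
  then show ?thesis by (intro poly_eqI) (simp add: cf_def)
qed

lemma coeff_gb_0: "coeff (gb T) 0 = 0" if T: "T \<ge> 1"
proof (cases "T = 1")
  case False
  then obtain S where S: "T = Suc S" "S \<ge> 1" using T by (cases T) auto
  then show ?thesis by (simp add: gb_Suc w3_mult)
qed simp

text \<open>Modulo \<open>w3\<close> the term \<open>gb T\<close> drops out, so the exponent e of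
  \<open>w2\<close> develops by e -> 2e + 1 from 0.\<close>

lemma coeff_ga_0: "coeff (ga T) 0 = monom 1 (2 ^ (T - 1) - 1)" if "T \<ge> 1"
  using that
proof (induction T rule: dec_induct)
  case base
  then show ?case by simp
next
  case (step T)
  obtain S where S: "T = Suc S" using step by (cases T) auto
  have "coeff (ga (Suc T)) 0 = [:0, 1:] * (coeff (ga T) 0)\<^sup>2"
    using step by (simp add: ga_Suc w2_mult coeff_square coeff_gb_0 power2_eq_square mult_smult_left coeff_mult)
  also have "\<dots> = monom 1 1 * monom 1 (2 * (2 ^ S - 1))"
    using step.IH by (simp add: S monom_power monom_Suc monom_0 mult.commute)
  also have "\<dots> = monom 1 (1 + 2 * (2 ^ S - 1))" by (simp only: mult_monom mult_1)
  also have "1 + 2 * (2 ^ S - 1) = (2 ^ T - 1 :: nat)"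
  proof -
    have "(1::nat) \<le> 2 ^ S" "(2::nat) ^ T = 2 * 2 ^ S" by (simp_all add: S)
    then show ?thesis by linarith
  qed
  finally show ?case by simp
qed

lemma coeff_mult_const: "coeff (p * [:h:]) j = coeff p j * h" for h :: "bit poly"
  by simp

lemma split_const:
  fixes f :: "bit poly poly"
  obtains h g where "f = [:h:] + w3 * g"
proof
  show "f = [:coeff f 0:] + w3 * poly_shift 1 f"
    by (rule poly_eqI) (auto simp: w3_mult coeff_pCons coeff_poly_shift split: nat.split)
qed

lemma bit_poly_square_decomposition:
  fixes h :: "bit poly"
  obtains e d where "h = e\<^sup>2 + [:0, 1:] * d\<^sup>2"
proof -
  have "\<exists>e d. h = e\<^sup>2 + [:0, 1:] * d\<^sup>2"
  proof (induction h)
    case 0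
    have "0 = 0\<^sup>2 + [:0, 1:] * (0::bit poly)\<^sup>2" by simp
    then show ?case by blast
  next
    case (pCons a h)
    then obtain e d where h: "h = e\<^sup>2 + [:0, 1:] * d\<^sup>2" by blast
    have "pCons a h = (pCons a d)\<^sup>2 + [:0, 1:] * e\<^sup>2"
      unfolding pCons_square[OF bit_add_self] by (cases a) (simp_all add: h add.commute)
    then show ?case by blast
  qed
  then show thesis using that by blast
qed

lemma phiy_ga_const: "phiy T (ga T * [:h:]) = 0" if "T \<ge> 1"
  unfolding phiy_def cf_def coeff_mult_const
  using that by (intro sum.neutral) (simp add: coeff_ga_odd)

text \<open>Write h = e^2 + w2 d^2. The second part yields \<open>phiy T (ga T * [:d:])\<close>,
  which is 0 because \<open>ga T\<close> has only even powers of \<open>w3\<close> and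
  \<open>phiy\<close> reads odd ones. The first part is read modulo \<open>w3\<close>, where
  \<open>ga T\<close> is a power of \<open>w2\<close>.\<close>

lemma phi_ga_square_const:
  assumes T: "T \<ge> 1"
  shows "phi (Suc T) ((ga T)\<^sup>2 * [:h:]) = coeff h (2 ^ T - 2)"
proof -
  obtain S where S: "T = Suc S" using T by (cases T) auto
  obtain e d where h: "h = e\<^sup>2 + [:0, 1:] * d\<^sup>2" by (rule bit_poly_square_decomposition)
  have "(ga T)\<^sup>2 * [:h:] = (ga T * [:e:])\<^sup>2 + w2 * (ga T * [:d:])\<^sup>2"
    by (simp add: h power2_eq_square w2_def algebra_simps smult_add_left)
  then have "phi (Suc T) ((ga T)\<^sup>2 * [:h:]) = cf (ga T * [:e:]) (2 ^ T - 2) 0"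
    by (simp only: phi_add phi_square[OF T] phi_w2_square[OF T] phiy_ga_const[OF T] add_0_right)
  also have "\<dots> = coeff (monom 1 (2 ^ S - 1) * e) (2 ^ T - 2)"
    unfolding cf_def coeff_mult_const coeff_ga_0[OF T] by (simp add: S)
  also have "\<dots> = coeff e (2 ^ S - 1)"
  proof -
    have "2 ^ T - 2 - (2 ^ S - 1) = 2 ^ S - (1::nat)" "\<not> 2 ^ T - 2 < 2 ^ S - (1::nat)"
      using one_le_power[of "2::nat" S] by (simp_all add: S not_less)
    then show ?thesis by (simp only: coeff_monom_mult if_False mult_1)
  qed
  also have "\<dots> = coeff (e\<^sup>2) (2 ^ T - 2)"
  proof -
    have "2 ^ T - 2 = 2 * (2 ^ S - 1 :: nat)" by (simp add: S)
    moreover have "b\<^sup>2 = b" for b :: bit by (cases b) auto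
    ultimately show ?thesis by (simp add: coeff_square)
  qed
  also have "\<dots> = coeff h (2 ^ T - 2)"
  proof -
    have "2 ^ T - 2 = 2 * (2 ^ S - 1 :: nat)" by (simp add: S)
    then have "coeff ([:0, 1:] * d\<^sup>2) (2 ^ T - 2) = 0"
      by (auto simp: coeff_pCons coeff_square split: nat.split) presburger
    then show ?thesis by (simp only: h coeff_add add_0_right)
  qed
  finally show ?thesis .
qed

text \<open>After decomposing the cofactor into squares, both products for T + 1 become sums of
  squares times 1, \<open>w2\<close>, \<open>w3\<close>, \<open>w2 * w3\<close>, to which the
  evaluation rules apply and lead back to T.\<close>

theorem phi_kills:
  assumes "T \<ge> 1"
  shows "phi T (ga T * f) = 0" "phi T (gb T * f) = 0"
proof -
  have "(\<forall>f. phi T (ga T * f) = 0) \<and> (\<forall>f. phi T (gb T * f) = 0)"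
    using assms
  proof (induction T rule: dec_induct)
    case base
    show ?case by (simp add: phi_def)
  next
    case (step T)
    have T: "T \<ge> 1" using step by simp
    \<comment> \<open>The part of \<open>f\<close> free of \<open>w3\<close> is killed by parity,
      the rest by the induction hypothesis through \<open>phiy_w3_mult\<close>.\<close>
    have A: "phiy T (ga T * f) = 0" for f
    proof -
      obtain h g where f: "f = [:h:] + w3 * g" by (rule split_const)
      have "ga T * f = ga T * [:h:] + w3 * (ga T * g)" by (simp add: f algebra_simps)
      then show ?thesis using phiy_ga_const[OF T] step.IH by simp
    qed
    have P: "phi (Suc T) (ga (Suc T) * f) = 0" for f
    proof -
      obtain f00 f10 f01 f11 where f: "f = f00\<^sup>2 + w2 * f10\<^sup>2 + w3 * f01\<^sup>2 + w2 * (w3 * f11\<^sup>2)"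
        by (rule square_decomposition)
      have "ga (Suc T) * f = (gb T * f00)\<^sup>2 + w2 * (ga T * f00)\<^sup>2 + (w2 * (ga T * f10))\<^sup>2 + w2 * (gb T * f10)\<^sup>2
        + w2 * (w3 * (ga T * f01)\<^sup>2) + w3 * (gb T * f01)\<^sup>2 + w3 * (w2 * ga T * f11)\<^sup>2
        + w2 * (w3 * (gb T * f11)\<^sup>2)"
        unfolding ga_Suc[OF T] f by (simp add: power2_eq_square algebra_simps)
      then have "phi (Suc T) (ga (Suc T) * f) = cf (gb T * f00) (2 ^ T - 2) 0 + phiy T (ga T * f00)
          + cf (w2 * (ga T * f10)) (2 ^ T - 2) 0 + phiy T (gb T * f10)"
        by (simp only: phi_add phi_square[OF T] phi_w2_square[OF T] phi_w3_square phi_w2_w3_square add_0_right)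
      moreover have "cf (gb T * f00) (2 ^ T - 2) 0 = 0"
        unfolding cf_def by (simp add: coeff_mult coeff_gb_0[OF T])
      \<comment> \<open>These two contributions need not vanish separately; for T = S + 1 both equal
        the coefficient of w2^(2^S - 2) in \<open>f10\<close> modulo \<open>w3\<close>, so they
        cancel.\<close>
      moreover have "cf (w2 * (ga T * f10)) (2 ^ T - 2) 0 + phiy T (gb T * f10) = 0"
      proof (cases "T = 1")
        case True
        then show ?thesis by (simp add: phiy_def)
      next
        case False
        then obtain S where S: "T = Suc S" "S \<ge> 1" using T by (cases T) auto
        obtain h g where f10: "f10 = [:h:] + w3 * g" by (rule split_const)
        have "phiy T (gb T * f10) = phi T ((ga S)\<^sup>2 * f10)"
          unfolding S(1) gb_Suc[OF S(2)] by (simp add: mult.assoc)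
        also have "(ga S)\<^sup>2 * f10 = (ga S)\<^sup>2 * [:h:] + gb T * g"
          unfolding S(1) gb_Suc[OF S(2)] f10 by (simp add: algebra_simps)
        also have "phi T \<dots> = coeff h (2 ^ S - 2)"
          using step.IH phi_ga_square_const[OF S(2), of h] by (simp add: S(1))
        finally have 1: "phiy T (gb T * f10) = coeff h (2 ^ S - 2)" .
        have "2 ^ T - 2 = Suc (2 ^ T - (3::nat))"
          using S two_power_ge2[OF S(2)] by simp
        then have "cf (w2 * (ga T * f10)) (2 ^ T - 2) 0 = cf (ga T * f10) (2 ^ T - 3) 0"
          by (simp only: cf_w2_mult nat.case)
        also have "\<dots> = coeff (monom 1 (2 ^ S - 1) * h) (2 ^ T - 3)"
        proof -
          have "coeff (ga T * f10) 0 = coeff (ga T) 0 * h" by (simp add: coeff_mult f10 w3_mult)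
          then show ?thesis unfolding cf_def coeff_ga_0[OF T] by (simp add: S(1))
        qed
        also have "\<dots> = coeff h (2 ^ S - 2)"
        proof -
          have "2 ^ T - 3 - (2 ^ S - 1) = 2 ^ S - (2::nat)" "\<not> 2 ^ T - 3 < 2 ^ S - (1::nat)"
            using two_power_ge2[OF S(2)] by (simp_all add: S(1))
          then show ?thesis by (simp only: coeff_monom_mult if_False mult_1)
        qed
        finally show ?thesis using 1 by simp
      qed
      ultimately show ?thesis using A by (simp add: add.assoc)
    qed
    have Q: "phi (Suc T) (gb (Suc T) * f) = 0" for f
    proof -
      obtain f00 f10 f01 f11 where f: "f = f00\<^sup>2 + w2 * f10\<^sup>2 + w3 * f01\<^sup>2 + w2 * (w3 * f11\<^sup>2)"
        by (rule square_decomposition)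
      have "gb (Suc T) * f = w3 * (ga T * f00)\<^sup>2 + w2 * (w3 * (ga T * f10)\<^sup>2)
          + (w3 * (ga T * f01))\<^sup>2 + w2 * (w3 * (ga T * f11))\<^sup>2"
        unfolding gb_Suc[OF T] f by (simp add: power2_eq_square algebra_simps)
      then have "phi (Suc T) (gb (Suc T) * f) = phi T (ga T * f11)"
        by (simp only: phi_add phi_square[OF T] phi_w2_square[OF T] phi_w3_square
            phi_w2_w3_square phiy_w3_mult) simp
      then show ?thesis using step.IH by simp
    qed
    show ?case using P Q by blast
  qed
  then show "phi T (ga T * f) = 0" "phi T (gb T * f) = 0" by blast+
qed

section \<open>Nondegeneracy of the pairing on the complete intersection\<close>

definition idl :: "nat \<Rightarrow> bit poly poly set" where
  "idl T = {A * ga T + B * gb T | A B. True}"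

lemma idlI: "f = A * ga T + B * gb T \<Longrightarrow> f \<in> idl T"
  unfolding idl_def by blast

lemma idl_add: "f \<in> idl T \<Longrightarrow> g \<in> idl T \<Longrightarrow> f + g \<in> idl T"
proof -
  assume "f \<in> idl T" "g \<in> idl T"
  then obtain A B A1 B1 where "f = A * ga T + B * gb T" "g = A1 * ga T + B1 * gb T"
    unfolding idl_def by blast
  then have "f + g = (A + A1) * ga T + (B + B1) * gb T" by (simp add: algebra_simps)
  then show ?thesis by (rule idlI)
qed

lemma idl_mult: "f \<in> idl T \<Longrightarrow> c * f \<in> idl T"
proof -
  assume "f \<in> idl T"
  then obtain A B where "f = A * ga T + B * gb T" unfolding idl_def by blast
  then have "c * f = (c * A) * ga T + (c * B) * gb T" by (simp add: algebra_simps)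
  then show ?thesis by (rule idlI)
qed

lemma idl_ga: "ga T \<in> idl T" by (rule idlI[of _ 1 T 0]) simp
lemma idl_gb: "gb T \<in> idl T" by (rule idlI[of _ 0 T 1]) simp

lemma phi_idl: "f \<in> idl T \<Longrightarrow> T \<ge> 1 \<Longrightarrow> phi T f = 0"
  unfolding idl_def using phi_kills[of T] by (auto simp: mult.commute)

text \<open>Modulo \<open>w3\<close> the generator \<open>ga (Suc T)\<close> is the given power of
  \<open>w2\<close>, and \<open>w3 * (ga T)\<^sup>2\<close> is the other generator.\<close>

lemma monom_ga_square: "[:monom 1 (2 ^ T - 1):] * (ga T)\<^sup>2 \<in> idl (Suc T)" if T: "T \<ge> 1"
proof -
  obtain h g where hg: "ga (Suc T) = [:h:] + w3 * g" by (rule split_const)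
  have "h = coeff (ga (Suc T)) 0" by (simp add: hg w3_mult)
  then have h: "h = monom 1 (2 ^ T - 1)" using coeff_ga_0[of "Suc T"] by simp
  have "[:h:] = ga (Suc T) + w3 * g" by (simp add: hg add.assoc)
  then have "[:h:] * (ga T)\<^sup>2 = (ga T)\<^sup>2 * ga (Suc T) + g * gb (Suc T)"
    unfolding gb_Suc[OF T] by (simp add: algebra_simps)
  then show ?thesis unfolding h by (rule idlI)
qed

text \<open>Testing against suitable multiples of squares puts all four square components of
  \<open>f\<close> into the ideal for T. Modulo the ideal for T + 1 this leaves a polynomial in
  \<open>w2\<close> alone times \<open>(ga T)\<^sup>2\<close>, whose coefficients are then tested
  one by one.\<close>

theorem phi_separates:
  assumes "T \<ge> 1" "\<And>c. phi T (c * f) = 0"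
  shows "f \<in> idl T"
  using assms
proof (induction T arbitrary: f rule: dec_induct)
  case base
  show ?case by (rule idlI[of _ f _ 0]) simp
next
  case (step T)
  have T: "T \<ge> 1" using step by simp
  obtain f00 f10 f01 f11 where f: "f = f00\<^sup>2 + w2 * f10\<^sup>2 + w3 * f01\<^sup>2 + w2 * (w3 * f11\<^sup>2)"
    by (rule square_decomposition)
  note S = phi_add phi_square[OF T] phi_w2_square[OF T] phi_w3_square phi_w2_w3_square phiy_w3_mult
  \<comment> \<open>The multiplier is chosen so that the wanted component appears as
    \<open>w2\<close> times the square of a multiple of \<open>w3\<close>, where the functional
    returns \<open>phi T\<close>. The other components land in w3 or w2 w3 times squares, or in
    squares of multiples of \<open>w3\<close>, all of which give 0. The next three components are
    isolated in the same way.\<close>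
  have "f11 \<in> idl T"
  proof (rule step.IH)
    fix h
    have "w3 * h\<^sup>2 * f = w3 * (h * f00)\<^sup>2 + w2 * (w3 * (h * f10)\<^sup>2) + (w3 * (h * f01))\<^sup>2 + w2 * (w3 * (h * f11))\<^sup>2"
      by (simp add: f power2_eq_square algebra_simps)
    then have "phi (Suc T) (w3 * h\<^sup>2 * f) = phi T (h * f11)" by (simp only: S) simp
    then show "phi T (h * f11) = 0" using step.prems by simp
  qed
  moreover have "f01 \<in> idl T"
  proof (rule step.IH)
    fix h
    have "w2 * w3 * h\<^sup>2 * f = w2 * (w3 * (h * f00)\<^sup>2) + w3 * (w2 * (h * f10))\<^sup>2 + w2 * (w3 * (h * f01))\<^sup>2
        + (w3 * (w2 * (h * f11)))\<^sup>2"
      by (simp add: f power2_eq_square algebra_simps)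
    then have "phi (Suc T) (w2 * w3 * h\<^sup>2 * f) = phi T (h * f01)" by (simp only: S) simp
    then show "phi T (h * f01) = 0" using step.prems by simp
  qed
  moreover have "f10 \<in> idl T"
  proof (rule step.IH)
    fix h
    have "(w3 * h)\<^sup>2 * f = (w3 * (h * f00))\<^sup>2 + w2 * (w3 * (h * f10))\<^sup>2 + w3 * (w3 * h * f01)\<^sup>2
        + w2 * (w3 * (w3 * h * f11)\<^sup>2)"
      by (simp add: f power2_eq_square algebra_simps)
    then have "phi (Suc T) ((w3 * h)\<^sup>2 * f) = phi T (h * f10)" by (simp only: S) simp
    then show "phi T (h * f10) = 0" using step.prems by simp
  qed
  moreover have "f00 \<in> idl T"
  proof (rule step.IH)
    fix h
    have "w2 * (w3 * h)\<^sup>2 * f = w2 * (w3 * (h * f00))\<^sup>2 + (w3 * (w2 * (h * f10)))\<^sup>2 + w2 * (w3 * (w3 * h * f01)\<^sup>2)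
        + w3 * (w2 * w3 * h * f11)\<^sup>2"
      by (simp add: f power2_eq_square algebra_simps)
    then have "phi (Suc T) (w2 * (w3 * h)\<^sup>2 * f) = phi T (h * f00)" by (simp only: S) simp
    then show "phi T (h * f00) = 0" using step.prems by simp
  qed
  \<comment> \<open>By \<open>ga_Suc\<close>, \<open>(gb T)\<^sup>2\<close> is congruent to
    \<open>w2 * (ga T)\<^sup>2\<close>, so squares from the smaller ideal reduce to multiples of
    \<open>(ga T)\<^sup>2\<close>.\<close>
  moreover have sq: "\<exists>C u. u \<in> idl (Suc T) \<and> g\<^sup>2 = C * (ga T)\<^sup>2 + u" if g0: "g \<in> idl T" for g
  proof -
    obtain A B where g: "g = A * ga T + B * gb T" using g0 unfolding idl_def by blast
    have "g\<^sup>2 = (A\<^sup>2 + B\<^sup>2 * w2) * (ga T)\<^sup>2 + B\<^sup>2 * ga (Suc T)"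
      unfolding ga_Suc[OF T] g square_add power_mult_distrib by (simp add: algebra_simps)
    then show ?thesis using idl_mult[OF idl_ga] by blast
  qed
  moreover have w3sq: "w3 * g\<^sup>2 \<in> idl (Suc T)" if g0: "g \<in> idl T" for g
  proof -
    obtain C u where "u \<in> idl (Suc T)" "g\<^sup>2 = C * (ga T)\<^sup>2 + u" using sq[OF g0] by blast
    then have "w3 * g\<^sup>2 = C * gb (Suc T) + w3 * u" "w3 * u \<in> idl (Suc T)"
      unfolding gb_Suc[OF T] by (auto simp: algebra_simps idl_mult)
    then show ?thesis by (simp add: idl_add idl_mult idl_gb)
  qed
  ultimately obtain C u D v where
    u: "u \<in> idl (Suc T)" "f00\<^sup>2 = C * (ga T)\<^sup>2 + u" and v: "v \<in> idl (Suc T)" "f10\<^sup>2 = D * (ga T)\<^sup>2 + v"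
    and r: "w3 * f01\<^sup>2 \<in> idl (Suc T)" "w2 * (w3 * f11\<^sup>2) \<in> idl (Suc T)"
    by (metis idl_mult)
  \<comment> \<open>The part divisible by \<open>w3\<close> is absorbed because
    \<open>w3 * (ga T)\<^sup>2 = gb (Suc T)\<close>; only a polynomial in \<open>w2\<close> remains
    as cofactor.\<close>
  obtain e g where eg: "C + w2 * D = [:e:] + w3 * g" by (rule split_const)
  define y where "y = g * gb (Suc T) + (u + w2 * v + w3 * f01\<^sup>2 + w2 * (w3 * f11\<^sup>2))"
  have y: "y \<in> idl (Suc T)"
    unfolding y_def by (intro idl_add idl_mult[OF idl_gb] u r idl_mult[OF v(1)])
  have "f = (C + w2 * D) * (ga T)\<^sup>2 + (u + w2 * v + w3 * f01\<^sup>2 + w2 * (w3 * f11\<^sup>2))"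
    unfolding f u v by (simp add: algebra_simps)
  then have fy: "f = (ga T)\<^sup>2 * [:e:] + y"
    unfolding eg y_def gb_Suc[OF T] by (simp only: algebra_simps)
  \<comment> \<open>Multiplication by w2^j with j = 2^T - 2 - i moves the i-th coefficient to the
    position read by \<open>phi_ga_square_const\<close>.\<close>
  have "coeff e i = 0" if i: "i < 2 ^ T - 1" for i
  proof -
    define j where "j = 2 ^ T - 2 - i"
    have "[:monom 1 j:] * f = (ga T)\<^sup>2 * [:monom 1 j * e:] + [:monom 1 j:] * y"
      by (simp add: fy algebra_simps)
    then have "phi (Suc T) ((ga T)\<^sup>2 * [:monom 1 j * e:]) = 0"
      using step.prems[of "[:monom 1 j:]"] phi_idl[OF idl_mult[OF y], of "[:monom 1 j:]"] by simp
    moreover have "2 ^ T - 2 - j = i" "\<not> 2 ^ T - 2 < j" using i unfolding j_def by linarith+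
    ultimately show ?thesis unfolding phi_ga_square_const[OF T]
      by (simp only: coeff_monom_mult if_False mult_1)
  qed
  then have "e = monom 1 (2 ^ T - 1) * poly_shift (2 ^ T - 1) e"
    by (intro poly_eqI) (auto simp: coeff_monom_mult coeff_poly_shift)
  then obtain d where "e = monom 1 (2 ^ T - 1) * d" by blast
  then have "(ga T)\<^sup>2 * [:e:] = [:d:] * ([:monom 1 (2 ^ T - 1):] * (ga T)\<^sup>2)"
    by (simp add: algebra_simps mult_smult_left)
  then have "(ga T)\<^sup>2 * [:e:] \<in> idl (Suc T)"
    using idl_mult[OF monom_ga_square[OF T], of "[:d:]"] by (simp only:)
  then show ?case unfolding fy using y by (rule idl_add)
qed

section \<open>Linkage of the ideals\<close>

lemma w3_cancel [simp]: "w3 * f = w3 * g \<longleftrightarrow> f = g"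
  by (simp add: w3_mult)

text \<open>The quotient by \<open>w3\<close> is the domain of polynomials in
  \<open>w2\<close>.\<close>

lemma w3_dvd_mult_cancel:
  assumes "coeff f 0 \<noteq> 0" "coeff (f * g) 0 = 0"
  obtains h where "g = w3 * h"
proof -
  have "coeff g 0 = 0" using assms by (simp add: coeff_mult)
  then have "g = w3 * poly_shift 1 g"
    by (intro poly_eqI) (auto simp: w3_mult coeff_pCons coeff_poly_shift split: nat.split)
  then show thesis using that by blast
qed

text \<open>The two generators form a regular sequence: only Koszul relations exist. A relation for
  T + 1 turns into one between the squares of the generators for T. Repeated use of the induction
  hypothesis gives a common cofactor, which is divisible by \<open>w3\<close> because
  \<open>ga (Suc T)\<close> is nonzero modulo \<open>w3\<close>.\<close>

lemma ga_gb_syzygy: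
  assumes "T \<ge> 1" "ga T * u = gb T * v"
  obtains s where "u = gb T * s" "v = ga T * s"
proof -
  have "\<exists>s. u = gb T * s \<and> v = ga T * s"
    using assms
  proof (induction T arbitrary: u v rule: dec_induct)
    case base
    then show ?case by simp
  next
    case (step T)
    have T: "T \<ge> 1" using step by simp
    have "(ga T)\<^sup>2 * (w3 * v + w2 * u) = (gb T)\<^sup>2 * u"
    proof -
      have "(gb T)\<^sup>2 * u + (ga T)\<^sup>2 * (w3 * v + w2 * u) = ga (Suc T) * u + gb (Suc T) * v"
        unfolding ga_Suc[OF T] gb_Suc[OF T] by (simp add: algebra_simps)
      also have "\<dots> = 0" using step.prems by simp
      finally show ?thesis by (simp add: poly_poly_bit_add_eq_0_iff)
    qed
    then have "ga T * (ga T * (w3 * v + w2 * u)) = gb T * (gb T * u)"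
      by (simp add: power2_eq_square mult.assoc)
    then obtain s1 where s1: "ga T * (w3 * v + w2 * u) = gb T * s1" "gb T * u = ga T * s1"
      using step.IH by blast
    obtain s2 where s2: "w3 * v + w2 * u = gb T * s2" "s1 = ga T * s2"
      using step.IH[OF s1(1)] by blast
    obtain s3 where s3: "s1 = gb T * s3" "u = ga T * s3"
      using step.IH[of s1 u] s1(2) by auto
    obtain s where s: "s2 = gb T * s" "s3 = ga T * s"
      using step.IH[of s2 s3] s2(2) s3(1) by auto
    have u: "u = (ga T)\<^sup>2 * s" using s3 s by (simp add: power2_eq_square mult.assoc)
    have "w3 * v = (w3 * v + w2 * u) + w2 * u" by (simp add: add.assoc)
    also have "\<dots> = gb T * (gb T * s) + w2 * u" by (simp only: s2(1) s(1))
    also have "\<dots> = ga (Suc T) * s"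
      unfolding u ga_Suc[OF T] by (simp add: power2_eq_square algebra_simps)
    finally have v: "w3 * v = ga (Suc T) * s" .
    have "coeff (ga (Suc T) * s) 0 = 0" unfolding v[symmetric] by (simp add: w3_mult)
    moreover have "coeff (ga (Suc T)) 0 \<noteq> 0" by (simp add: coeff_ga_0)
    ultimately obtain r where r: "s = w3 * r" using w3_dvd_mult_cancel by metis
    have "v = ga (Suc T) * r"
    proof -
      have "w3 * v = w3 * (ga (Suc T) * r)" unfolding v r by (simp only: ac_simps)
      then show ?thesis by (simp only: w3_cancel)
    qed
    moreover have "u = gb (Suc T) * r"
      unfolding u r gb_Suc[OF T] by (simp only: ac_simps)
    ultimately show ?case by blast
  qed
  then show thesis using that by blast
qed

section \<open>The ideals of the presentation as sets of linear combinations\<close>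

definition Igr :: "nat \<Rightarrow> bit poly poly set" where
  "Igr n = {P * g_poly (n - 2) + Q * g_poly (n - 1) + R * g_poly n | P Q R. True}"

lemma IgrI: "f = P * g_poly (n - 2) + Q * g_poly (n - 1) + R * g_poly n \<Longrightarrow> f \<in> Igr n"
  unfolding Igr_def by blast

lemma Igr_add: "f \<in> Igr n \<Longrightarrow> g \<in> Igr n \<Longrightarrow> f + g \<in> Igr n"
proof -
  assume "f \<in> Igr n" "g \<in> Igr n"
  then obtain P Q R P1 Q1 R1 where
    "f = P * g_poly (n - 2) + Q * g_poly (n - 1) + R * g_poly n"
    "g = P1 * g_poly (n - 2) + Q1 * g_poly (n - 1) + R1 * g_poly n"
    unfolding Igr_def by blast
  then have "f + g = (P + P1) * g_poly (n - 2) + (Q + Q1) * g_poly (n - 1) + (R + R1) * g_poly n"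
    by (simp add: algebra_simps)
  then show ?thesis by (rule IgrI)
qed

lemma Igr_mult: "f \<in> Igr n \<Longrightarrow> c * f \<in> Igr n"
proof -
  assume "f \<in> Igr n"
  then obtain P Q R where "f = P * g_poly (n - 2) + Q * g_poly (n - 1) + R * g_poly n"
    unfolding Igr_def by blast
  then have "c * f = (c * P) * g_poly (n - 2) + (c * Q) * g_poly (n - 1) + (c * R) * g_poly n"
    by (simp add: algebra_simps)
  then show ?thesis by (rule IgrI)
qed

lemma Igr_generators: "g_poly (n - 2) \<in> Igr n" "g_poly (n - 1) \<in> Igr n" "g_poly n \<in> Igr n"
  by (rule IgrI[of _ 1 _ 0 0], simp, rule IgrI[of _ 0 _ 1 0], simp, rule IgrI[of _ 0 _ 0 1], simp)

lemma g_poly_3: "k \<ge> 3 \<Longrightarrow> g_poly k = w2 * g_poly (k - 2) + w3 * g_poly (k - 3)"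
  by (cases k rule: g_poly.cases) auto

lemma Igr_Suc_subset: "n \<ge> 2 \<Longrightarrow> Igr (Suc n) \<subseteq> Igr n"
proof
  fix f assume n: "n \<ge> 2" and "f \<in> Igr (Suc n)"
  then obtain P Q R where f: "f = P * g_poly (Suc n - 2) + Q * g_poly (Suc n - 1) + R * g_poly (Suc n)"
    unfolding Igr_def by blast
  moreover have "g_poly (Suc n) = w2 * g_poly (n - 1) + w3 * g_poly (n - 2)"
    using g_poly_3[of "Suc n"] n by (simp add: numeral_3_eq_3 numeral_2_eq_2)
  moreover have "Suc n - 2 = n - 1" "Suc n - 1 = n" by linarith+
  ultimately have "f = (R * w3) * g_poly (n - 2) + (P + R * w2) * g_poly (n - 1) + Q * g_poly n"
    by (simp only: algebra_simps)
  then show "f \<in> Igr n" by (rule IgrI)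
qed

lemma Igr_mono: "m \<le> n \<Longrightarrow> 2 \<le> m \<Longrightarrow> Igr n \<subseteq> Igr m"
proof (induction n rule: dec_induct)
  case (step n)
  then show ?case using Igr_Suc_subset[of n] by simp
qed simp

text \<open>Of the generators only \<open>g_poly (n - 2)\<close> is lost in passing to the next
  ideal, and the recurrence expresses its multiple by \<open>w3\<close> through the new
  generators.\<close>

lemma w3_Igr: "f \<in> Igr n \<Longrightarrow> n \<ge> 2 \<Longrightarrow> w3 * f \<in> Igr (Suc n)"
proof -
  assume "f \<in> Igr n" and n: "n \<ge> 2"
  then obtain P Q R where f: "f = P * g_poly (n - 2) + Q * g_poly (n - 1) + R * g_poly n"
    unfolding Igr_def by blast
  have "g_poly (Suc n) = w2 * g_poly (n - 1) + w3 * g_poly (n - 2)"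
    using g_poly_3[of "Suc n"] n by (simp add: numeral_3_eq_3 numeral_2_eq_2)
  then have "w3 * g_poly (n - 2) = g_poly (Suc n) + w2 * g_poly (n - 1)"
    by (simp add: add.assoc add.commute)
  moreover have "w3 * f = P * (w3 * g_poly (n - 2)) + (w3 * Q) * g_poly (n - 1) + (w3 * R) * g_poly n"
    by (simp add: f algebra_simps)
  moreover have "Suc n - 2 = n - 1" "Suc n - 1 = n" by linarith+
  ultimately have "w3 * f = (P * w2 + w3 * Q) * g_poly (Suc n - 2) + (w3 * R) * g_poly (Suc n - 1) + P * g_poly (Suc n)"
    by (simp only: algebra_simps)
  then show ?thesis by (rule IgrI)
qed

lemma w3_power_Igr: "f \<in> Igr n \<Longrightarrow> n \<ge> 2 \<Longrightarrow> w3 ^ m * f \<in> Igr (n + m)"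
proof (induction m)
  case (Suc m)
  then show ?case using w3_Igr[of "w3 ^ m * f" "n + m"] by (simp add: mult.assoc)
qed simp

text \<open>For n = 2^T - 1 the first generator is \<open>g_poly (2 ^ T - 3) = 0\<close>, so two
  generators suffice; a cycle of inclusions then covers n = 2^T as well.\<close>

lemma idl_eq_Igr:
  assumes T: "T \<ge> 2"
  shows "idl T = Igr (2 ^ T)" "idl T = Igr (2 ^ T - 1)"
proof -
  have ge: "(2::nat) ^ T \<ge> 4" using power_increasing[OF T, of "2::nat"] by simp
  have z: "g_poly (2 ^ T - 3) = 0" using g_poly_eq_0[of "T - 2"] T by (metis le_add_diff_inverse2)
  have 1: "idl T \<subseteq> Igr (2 ^ T)"
  proof
    fix f assume "f \<in> idl T"
    then obtain A B where "f = A * ga T + B * gb T" unfolding idl_def by blast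
    then show "f \<in> Igr (2 ^ T)"
      unfolding ga_def gb_def by (simp only: Igr_add Igr_mult Igr_generators)
  qed
  have "2 ^ T \<ge> (3::nat)" "2 ^ T = Suc (2 ^ T - 1 :: nat)" using ge by linarith+
  then have 2: "Igr (2 ^ T) \<subseteq> Igr (2 ^ T - 1)"
    using Igr_Suc_subset[of "2 ^ T - 1"] by simp
  have 3: "Igr (2 ^ T - 1) \<subseteq> idl T"
  proof
    fix f assume "f \<in> Igr (2 ^ T - 1)"
    then obtain P Q R where f: "f = P * g_poly (2 ^ T - 1 - 2) + Q * g_poly (2 ^ T - 1 - 1) + R * g_poly (2 ^ T - 1)"
      unfolding Igr_def by blast
    have "2 ^ T - 1 - 2 = 2 ^ T - (3::nat)" "2 ^ T - 1 - 1 = 2 ^ T - (2::nat)" by linarith+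
    then have "f = Q * ga T + R * gb T" unfolding f ga_def gb_def by (simp only: z) simp
    then show "f \<in> idl T" by (rule idlI)
  qed
  show "idl T = Igr (2 ^ T)" "idl T = Igr (2 ^ T - 1)" using 1 2 3 by blast+
qed

lemma coeff_g_poly_0: "coeff (g_poly k) 0 = (if even k then monom 1 (k div 2) else 0)"
proof (induction k rule: g_poly.induct)
  case 1
  then show ?case by (simp add: monom_0 one_pCons)
next
  case 3
  then show ?case by (simp add: w2_def monom_Suc monom_0 one_pCons numeral_2_eq_2)
next
  case (4 r)
  then show ?case by (simp add: w2_mult w3_mult monom_Suc)
qed simp

text \<open>In terms of the coordinates with respect to \<open>ga T\<close> and \<open>gb T\<close>,
  the generators of the ideals become the vectors \<open>(g\<^sub>j\<^sub>+\<^sub>1, g\<^sub>j)\<close>, and two consecutive ones stay linearly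
  independent modulo \<open>w3\<close>.\<close>

lemma Igr_colon_w3:
  assumes T: "T \<ge> 2" and j: "Suc j \<le> 2 ^ T - 2"
    and f: "f \<in> idl T" and wf: "w3 * f \<in> Igr (2 ^ T + j + 2)"
  shows "f \<in> Igr (2 ^ T + j + 1)"
proof -
  obtain A B where AB: "f = A * ga T + B * gb T" using f unfolding idl_def by blast
  obtain P Q R where PQR: "w3 * f = P * g_poly (2 ^ T + j) + Q * g_poly (2 ^ T + j + 1) + R * g_poly (2 ^ T + j + 2)"
    using wf unfolding Igr_def by auto
  have g: "g_poly (2 ^ T + i) = ga T * g_poly (i + 2) + gb T * g_poly (i + 1)" for i
    using g_poly_shift[OF T, of "i + 1"] by (simp add: numeral_2_eq_2)
  have g': "g_poly (2 ^ T + j - 1) = ga T * g_poly (j + 1) + gb T * g_poly j"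
    by (rule g_poly_shift[OF T])
  define U where "U = P * g_poly (j + 2) + Q * g_poly (j + 3) + R * g_poly (j + 4)"
  define V where "V = P * g_poly (j + 1) + Q * g_poly (j + 2) + R * g_poly (j + 3)"
  have G: "g_poly (2 ^ T + j) = ga T * g_poly (j + 2) + gb T * g_poly (j + 1)"
    "g_poly (2 ^ T + j + 1) = ga T * g_poly (j + 3) + gb T * g_poly (j + 2)"
    "g_poly (2 ^ T + j + 2) = ga T * g_poly (j + 4) + gb T * g_poly (j + 3)"
  proof -
    have e: "j + 1 + 2 = j + 3" "j + 1 + 1 = j + 2" "j + 2 + 2 = j + 4" "j + 2 + 1 = j + 3" by simp_all
    show "g_poly (2 ^ T + j) = ga T * g_poly (j + 2) + gb T * g_poly (j + 1)"
      by (rule g)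
    show "g_poly (2 ^ T + j + 1) = ga T * g_poly (j + 3) + gb T * g_poly (j + 2)"
      using g[of "j + 1"] unfolding e by (simp only: add.assoc)
    show "g_poly (2 ^ T + j + 2) = ga T * g_poly (j + 4) + gb T * g_poly (j + 3)"
      using g[of "j + 2"] unfolding e by (simp only: add.assoc)
  qed
  have "w3 * f = ga T * U + gb T * V"
    unfolding PQR G U_def V_def by (simp only: algebra_simps)
  moreover have "w3 * f = ga T * (w3 * A) + gb T * (w3 * B)"
    unfolding AB by (simp only: algebra_simps)
  moreover have "ga T * (w3 * A + U) + gb T * (w3 * B + V) =
      (ga T * (w3 * A) + gb T * (w3 * B)) + (ga T * U + gb T * V)"
    by (simp only: algebra_simps)
  ultimately have "ga T * (w3 * A + U) + gb T * (w3 * B + V) = 0"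
    by (metis poly_poly_bit_add_self)
  then have "ga T * (w3 * A + U) = gb T * (w3 * B + V)"
    by (simp add: poly_poly_bit_add_eq_0_iff)
  then obtain s where s: "w3 * A + U = gb T * s" "w3 * B + V = ga T * s"
    using T ga_gb_syzygy[of T] by auto
  \<comment> \<open>The recurrence keeps all later vectors of consecutive \<open>g_poly\<close>
    values in the span of the first three.\<close>
  have span: "\<exists>P Q R. g_poly (j + 2 + d) = P * g_poly (j + 2) + Q * g_poly (j + 3) + R * g_poly (j + 4) \<and>
      g_poly (j + 1 + d) = P * g_poly (j + 1) + Q * g_poly (j + 2) + R * g_poly (j + 3)" for d
  proof (induction d rule: g_poly.induct)
    case 1
    show ?case by (rule exI[of _ 1], rule exI[of _ 0], rule exI[of _ 0]) simp
  next
    case 2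
    show ?case by (rule exI[of _ 0], rule exI[of _ 1], rule exI[of _ 0]) (simp add: numeral_3_eq_3)
  next
    case 3
    show ?case by (rule exI[of _ 0], rule exI[of _ 0], rule exI[of _ 1]) (simp add: numeral_3_eq_3 eval_nat_numeral)
  next
    case (4 d)
    then obtain P Q R P1 Q1 R1 where
      1: "g_poly (j + 2 + d) = P * g_poly (j + 2) + Q * g_poly (j + 3) + R * g_poly (j + 4)"
      "g_poly (j + 1 + d) = P * g_poly (j + 1) + Q * g_poly (j + 2) + R * g_poly (j + 3)"
      and 2: "g_poly (j + 2 + Suc d) = P1 * g_poly (j + 2) + Q1 * g_poly (j + 3) + R1 * g_poly (j + 4)"
      "g_poly (j + 1 + Suc d) = P1 * g_poly (j + 1) + Q1 * g_poly (j + 2) + R1 * g_poly (j + 3)"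
      by blast
    have 3: "g_poly (j + 2 + Suc (Suc (Suc d))) = w2 * g_poly (j + 2 + Suc d) + w3 * g_poly (j + 2 + d)"
      "g_poly (j + 1 + Suc (Suc (Suc d))) = w2 * g_poly (j + 1 + Suc d) + w3 * g_poly (j + 1 + d)"
      by simp_all
    show ?case
    proof (intro exI conjI)
      show "g_poly (j + 2 + Suc (Suc (Suc d))) = (w2 * P1 + w3 * P) * g_poly (j + 2)
          + (w2 * Q1 + w3 * Q) * g_poly (j + 3) + (w2 * R1 + w3 * R) * g_poly (j + 4)"
        unfolding 3(1) 2(1) 1(1) by (simp only: algebra_simps)
      show "g_poly (j + 1 + Suc (Suc (Suc d))) = (w2 * P1 + w3 * P) * g_poly (j + 1)
          + (w2 * Q1 + w3 * Q) * g_poly (j + 2) + (w2 * R1 + w3 * R) * g_poly (j + 3)"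
        unfolding 3(2) 2(2) 1(2) by (simp only: algebra_simps)
    qed
  qed
  have k1: "j + 2 + (2 ^ T - 3 - j) = 2 ^ T - (1::nat)" "j + 1 + (2 ^ T - 3 - j) = 2 ^ T - (2::nat)"
    using j by linarith+
  \<comment> \<open>For d = 2^T - 3 - j the vector is (\<open>gb T\<close>, \<open>ga T\<close>),
    the Koszul relation itself. Hence the ambiguity \<open>s\<close> of the coordinates can be
    absorbed into \<open>P\<close>, \<open>Q\<close>, \<open>R\<close>.\<close>
  obtain P0 Q0 R0 where v: "gb T = P0 * g_poly (j + 2) + Q0 * g_poly (j + 3) + R0 * g_poly (j + 4)"
      "ga T = P0 * g_poly (j + 1) + Q0 * g_poly (j + 2) + R0 * g_poly (j + 3)"
    using span[of "2 ^ T - 3 - j"] unfolding ga_def gb_def k1 by blast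
  \<comment> \<open>The third vector is eliminated by the recurrence: it is \<open>w2\<close> times
    the first plus a multiple of \<open>w3\<close>.\<close>
  define P1 where "P1 = P + s * P0 + w2 * (R + s * R0)"
  define Q1 where "Q1 = Q + s * Q0"
  define R1 where "R1 = R + s * R0"
  have rec: "g_poly (j + 4) = w2 * g_poly (j + 2) + w3 * g_poly (j + 1)"
    "g_poly (j + 3) = w2 * g_poly (j + 1) + w3 * g_poly j"
    using g_poly_3[of "j + 4"] g_poly_3[of "j + 3"] by (simp_all add: numeral_eq_Suc)
  have "w3 * A = (w3 * A + U) + U" by (simp add: add.assoc)
  also have "\<dots> = gb T * s + U" by (simp only: s(1))
  also have "\<dots> = P1 * g_poly (j + 2) + Q1 * g_poly (j + 3) + w3 * (R1 * g_poly (j + 1))"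
    unfolding U_def P1_def Q1_def R1_def v(1) rec(1) by (simp add: algebra_simps)
  finally have A: "w3 * A = P1 * g_poly (j + 2) + Q1 * g_poly (j + 3) + w3 * (R1 * g_poly (j + 1))" .
  have "w3 * B = (w3 * B + V) + V" by (simp add: add.assoc)
  also have "\<dots> = ga T * s + V" by (simp only: s(2))
  also have "\<dots> = P1 * g_poly (j + 1) + Q1 * g_poly (j + 2) + w3 * (R1 * g_poly j)"
    unfolding V_def P1_def Q1_def R1_def v(2) rec(2) by (simp add: algebra_simps)
  finally have B: "w3 * B = P1 * g_poly (j + 1) + Q1 * g_poly (j + 2) + w3 * (R1 * g_poly j)" .
  have A0: "coeff P1 0 * coeff (g_poly (j + 2)) 0 + coeff Q1 0 * coeff (g_poly (j + 3)) 0 = 0"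
    using arg_cong[OF A, of "\<lambda>p. coeff p 0"] by (simp only: w3_mult coeff_add coeff_pCons_0 coeff_mult atMost_0) simp
  have B0: "coeff P1 0 * coeff (g_poly (j + 1)) 0 + coeff Q1 0 * coeff (g_poly (j + 2)) 0 = 0"
    using arg_cong[OF B, of "\<lambda>p. coeff p 0"] by (simp only: w3_mult coeff_add coeff_pCons_0 coeff_mult atMost_0) simp
  \<comment> \<open>Modulo \<open>w3\<close> every second \<open>g_poly\<close> vanishes and the
    others are powers of \<open>w2\<close>, so this system is diagonal for even \<open>j\<close> and
    antidiagonal for odd \<open>j\<close>.\<close>
  have "coeff P1 0 = 0 \<and> coeff Q1 0 = 0"
    using A0 B0 by (cases "even j") (auto simp: coeff_g_poly_0 monom_eq_0_iff)
  moreover have "p = w3 * poly_shift 1 p" if "coeff p 0 = 0" for p :: "bit poly poly"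
    using that by (intro poly_eqI) (auto simp: w3_mult coeff_pCons coeff_poly_shift split: nat.split)
  ultimately obtain P2 Q2 where PQ: "P1 = w3 * P2" "Q1 = w3 * Q2" by blast
  have "w3 * A = w3 * (P2 * g_poly (j + 2) + Q2 * g_poly (j + 3) + R1 * g_poly (j + 1))"
    unfolding A PQ by (simp only: algebra_simps)
  then have A': "A = P2 * g_poly (j + 2) + Q2 * g_poly (j + 3) + R1 * g_poly (j + 1)"
    by (simp only: w3_cancel)
  have "w3 * B = w3 * (P2 * g_poly (j + 1) + Q2 * g_poly (j + 2) + R1 * g_poly j)"
    unfolding B PQ by (simp only: algebra_simps)
  then have B': "B = P2 * g_poly (j + 1) + Q2 * g_poly (j + 2) + R1 * g_poly j"
    by (simp only: w3_cancel)
  have "f = R1 * (ga T * g_poly (j + 1) + gb T * g_poly j) + P2 * (ga T * g_poly (j + 2) + gb T * g_poly (j + 1))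
      + Q2 * (ga T * g_poly (j + 3) + gb T * g_poly (j + 2))"
    unfolding AB A' B' by (simp only: algebra_simps)
  then have "f = R1 * g_poly (2 ^ T + j - 1) + P2 * g_poly (2 ^ T + j) + Q2 * g_poly (2 ^ T + (j + 1))"
    unfolding g g' by (simp add: numeral_eq_Suc)
  then have "f = R1 * g_poly (2 ^ T + j + 1 - 2) + P2 * g_poly (2 ^ T + j + 1 - 1) + Q2 * g_poly (2 ^ T + j + 1)"
    by (simp add: numeral_2_eq_2)
  then show ?thesis by (rule IgrI)
qed

text \<open>At n + m = 2^(T+1) - 1 the presented ideal is \<open>idl (T + 1)\<close>. From there the
  factors \<open>w3\<close> are stripped one at a time, each step lowering the index by one.\<close>

theorem Igr_linkage:
  assumes T: "T \<ge> 2" and n: "2 ^ T - 1 \<le> n" "n + m = 2 ^ (T + 1) - 1"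
    and f: "f \<in> idl T" and wf: "w3 ^ m * f \<in> idl (T + 1)"
  shows "f \<in> Igr n"
proof -
  have ge: "(2::nat) ^ T \<ge> 4" using power_increasing[OF T, of "2::nat"] by simp
  have pw: "(2::nat) ^ (T + 1) = 2 * 2 ^ T" by simp
  show ?thesis
  proof (cases "n \<le> 2 ^ T")
    case True
    then have "n = 2 ^ T \<or> n = 2 ^ T - 1" using n by linarith
    then show ?thesis using idl_eq_Igr[OF T] f by metis
  next
    case False
    have wf': "w3 ^ m * f \<in> Igr (n + m)"
      using wf idl_eq_Igr(2)[of "T + 1"] T n(2) by simp
    have "w3 ^ k * f \<in> Igr (n + k)" if "k \<le> m" for k
      using that
    proof (induction k rule: inc_induct)
      case base
      show ?case by (rule wf')
    next
      case (step k)
      define j where "j = n + k - 2 ^ T - 1"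
      have nk: "n + k = 2 ^ T + j + 1" using False unfolding j_def by linarith
      have "n + k < 2 * 2 ^ T - 1" using step n(2) ge unfolding pw by linarith
      then have j: "Suc j \<le> 2 ^ T - 2" using nk ge by linarith
      have "w3 * (w3 ^ k * f) \<in> Igr (2 ^ T + j + 2)"
        using step.IH nk by (simp add: mult.assoc)
      then show ?case
        unfolding nk by (rule Igr_colon_w3[OF T j idl_mult[OF f]])
    qed
    from this[of 0] show ?thesis by simp
  qed
qed

corollary Igr_iff_phi:
  assumes T: "T \<ge> 2" and n: "2 ^ T - 1 \<le> n" "n + m = 2 ^ (T + 1) - 1"
  shows "f \<in> Igr n \<longleftrightarrow> (\<forall>c. phi T (c * f) = 0) \<and> (\<forall>c. phi (T + 1) (w3 ^ m * (c * f)) = 0)"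
proof
  assume f: "f \<in> Igr n"
  have ge: "(2::nat) ^ T \<ge> 4" using power_increasing[OF T, of "2::nat"] by simp
  have "f \<in> idl T"
    using f Igr_mono[of "2 ^ T - 1" n] n(1) ge idl_eq_Igr(2)[OF T] by (auto simp: subset_iff)
  moreover have "w3 ^ m * f \<in> idl (T + 1)"
    using w3_power_Igr[OF f, of m] n ge idl_eq_Igr(2)[of "T + 1"] T by simp
  ultimately show "(\<forall>c. phi T (c * f) = 0) \<and> (\<forall>c. phi (T + 1) (w3 ^ m * (c * f)) = 0)"
    using T idl_mult phi_idl by (metis One_nat_def Suc_1 Suc_eq_plus1 le_SucI mult.left_commute Suc_leD le_add2)
next
  assume *: "(\<forall>c. phi T (c * f) = 0) \<and> (\<forall>c. phi (T + 1) (w3 ^ m * (c * f)) = 0)"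
  have "f \<in> idl T" using * T by (intro phi_separates) auto
  moreover have "w3 ^ m * f \<in> idl (T + 1)"
    using * by (intro phi_separates) (auto simp: mult.left_commute)
  ultimately show "f \<in> Igr n" by (rule Igr_linkage[OF T n])
qed

section \<open>Bilinear forms as test objects for tensors\<close>

declare add_bit_eq_xor [simp del] mult_bit_eq_and [simp del]

lemma bit_add_left_self [simp]: "(a::bit) + (a + b) = b"
  by (simp flip: add.assoc)

lemma bit_add_eq_0_iff: "(a::bit) + b = 0 \<longleftrightarrow> a = b"
  by (metis add.left_neutral add.right_neutral bit_add_left_self bit_add_self)

text \<open>Linear extension of a map from basis vectors. A plain sum over the support suffices
  since nonzero coefficients are 1; additivity holds when the values satisfy x + x = 0.\<close>

definition lin :: "('k \<Rightarrow> 'b::comm_monoid_add) \<Rightarrow> ('k \<Rightarrow>\<^sub>0 bit) \<Rightarrow> 'b" where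
  "lin h F = (\<Sum>x\<in>Poly_Mapping.keys F. h x)"

abbreviation sgl :: "'k \<Rightarrow> ('k \<Rightarrow>\<^sub>0 bit)" where
  "sgl x \<equiv> Poly_Mapping.single x 1"

lemma poly_mapping_bit_add_self [simp]: "(F :: 'k \<Rightarrow>\<^sub>0 bit) + F = 0"
  by (rule poly_mapping_eqI) (simp add: lookup_add)

lemma poly_mapping_bit_add_left_self [simp]: "(F :: 'k \<Rightarrow>\<^sub>0 bit) + (F + G) = G"
  by (simp flip: add.assoc)

lemma poly_mapping_bit_diff: "(F :: 'k \<Rightarrow>\<^sub>0 bit) - G = F + G"
  by (rule poly_mapping_eqI) (simp add: lookup_add lookup_minus)

lemma lin_superset:
  assumes "finite S" "Poly_Mapping.keys F \<subseteq> S"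
  shows "lin h F = (\<Sum>x\<in>S. if Poly_Mapping.lookup F x = 1 then h x else 0)"
proof -
  have "(\<Sum>x\<in>S. if Poly_Mapping.lookup F x = 1 then h x else 0)
      = (\<Sum>x\<in>Poly_Mapping.keys F. if Poly_Mapping.lookup F x = 1 then h x else 0)"
    using assms by (intro sum.mono_neutral_right) (auto simp: in_keys_iff)
  also have "\<dots> = lin h F"
    unfolding lin_def by (intro sum.cong) (auto simp: in_keys_iff)
  finally show ?thesis ..
qed

lemma lin_0 [simp]: "lin h 0 = 0"
  by (simp add: lin_def)

lemma lin_sgl [simp]: "lin h (sgl x) = h x"
  by (simp add: lin_def)

lemma lin_add:
  assumes "\<And>x. h x + h x = 0"
  shows "lin h (F + G) = lin h F + lin h G"
proof -
  let ?S = "Poly_Mapping.keys F \<union> Poly_Mapping.keys G"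
  have "lin h F + lin h G = (\<Sum>x\<in>?S. (if Poly_Mapping.lookup F x = 1 then h x else 0) +
      (if Poly_Mapping.lookup G x = 1 then h x else 0))"
    by (simp add: lin_superset[of ?S] sum.distrib)
  also have "\<dots> = (\<Sum>x\<in>?S. if Poly_Mapping.lookup (F + G) x = 1 then h x else 0)"
    by (intro sum.cong refl) (auto simp: lookup_add assms)
  also have "\<dots> = lin h (F + G)"
    by (rule lin_superset[symmetric]) (auto simp: in_keys_iff lookup_add)
  finally show ?thesis ..
qed

lemma lin_sum:
  assumes "\<And>x. h x + h x = 0"
  shows "lin h (\<Sum>i\<in>S. F i) = (\<Sum>i\<in>S. lin h (F i))"
  by (induction S rule: infinite_finite_induct) (simp_all add: lin_add assms)

lemma lin_lin:
  assumes "\<And>x. h x + h x = 0"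
  shows "lin h (lin f F) = lin (\<lambda>x. lin h (f x)) F"
  unfolding lin_def[of f] lin_def[of "\<lambda>x. lin h (f x)"] by (rule lin_sum[OF assms])

lemma lin_self: "lin sgl F = F"
proof (rule poly_mapping_eqI)
  fix k
  have "Poly_Mapping.lookup (lin sgl F) k = (\<Sum>x\<in>Poly_Mapping.keys F. if x = k then 1 else 0)"
    by (simp add: lin_def lookup_sum lookup_single when_def)
  then show "Poly_Mapping.lookup (lin sgl F) k = Poly_Mapping.lookup F k"
    by (cases "Poly_Mapping.lookup F k") (simp_all add: in_keys_iff)
qed

lemma lin_fun_add: "lin (\<lambda>x. f x + g x) F = lin f F + lin g F"
  by (simp add: lin_def sum.distrib)

lemma lin_cong: "(\<And>x. x \<in> Poly_Mapping.keys F \<Longrightarrow> f x = g x) \<Longrightarrow> lin f F = lin g F"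
  by (simp add: lin_def)

lemma keys_lin:
  assumes "\<And>x. x \<in> Poly_Mapping.keys F \<Longrightarrow> Poly_Mapping.keys (f x) \<subseteq> C"
  shows "Poly_Mapping.keys (lin f F) \<subseteq> C"
  unfolding lin_def using keys_sum[of f "Poly_Mapping.keys F"] assms by blast

lemma tensor_free_mult:
  "F \<otimes>\<^bsub>tensor_free A B\<^esub> G =
     lin (\<lambda>x. lin (\<lambda>y. sgl (fst x \<otimes>\<^bsub>A\<^esub> fst y, snd x \<otimes>\<^bsub>B\<^esub> snd y)) G) F"
  unfolding tensor_free_def lin_def
  by (auto intro!: sum.cong simp: in_keys_iff)

lemma tensor_free_simps:
  "carrier (tensor_free A B) = {f. Poly_Mapping.keys f \<subseteq> carrier A \<times> carrier B}"
  "\<one>\<^bsub>tensor_free A B\<^esub> = sgl (\<one>\<^bsub>A\<^esub>, \<one>\<^bsub>B\<^esub>)"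
  "\<zero>\<^bsub>tensor_free A B\<^esub> = 0"
  "F \<oplus>\<^bsub>tensor_free A B\<^esub> G = F + G"
  "grade (tensor_free A B) k = {f. Poly_Mapping.keys f \<subseteq> (\<Union>i\<le>k. grade A i \<times> grade B (k - i))}"
  by (simp_all add: tensor_free_def)

lemma graded_quot_simps:
  "carrier (graded_quot R I) = a_rcosets\<^bsub>R\<^esub> I"
  "monoid.mult (graded_quot R I) = rcoset_mult R I"
  "\<one>\<^bsub>graded_quot R I\<^esub> = I +>\<^bsub>R\<^esub> \<one>\<^bsub>R\<^esub>"
  "\<zero>\<^bsub>graded_quot R I\<^esub> = I"
  "add (graded_quot R I) = set_add R"
  "grade (graded_quot R I) k = (\<lambda>x. I +>\<^bsub>R\<^esub> x) ` grade R k"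
  by (simp_all add: graded_quot_def FactRing_def ring.defs graded_ring.defs)

definition bhom :: "nat \<Rightarrow> bit poly poly set" where
  "bhom k = {f. \<forall>i j. cf f i j \<noteq> 0 \<longrightarrow> 2 * i + 3 * j = k}"

section \<open>Operators on bilinear forms\<close>

type_synonym bform = "bit poly poly \<Rightarrow> bit poly poly \<Rightarrow> bit"

definition biadd :: "bform \<Rightarrow> bool" where
  "biadd B \<longleftrightarrow> (\<forall>p p' q. B (p + p') q = B p q + B p' q) \<and> (\<forall>p q q'. B p (q + q') = B p q + B p q')"

lemma biadd_left: "biadd B \<Longrightarrow> B (p + p') q = B p q + B p' q"
  and biadd_right: "biadd B \<Longrightarrow> B p (q + q') = B p q + B p q'"
  unfolding biadd_def by blast+

lemma biadd_0:
  assumes "biadd B"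
  shows "B 0 q = 0" "B p 0 = 0"
  using biadd_left[OF assms, of 0 0 q] biadd_right[OF assms, of p 0 0]
  by (simp_all only: add_0_left bit_add_self)

lemma biadd_sum:
  assumes "biadd B"
  shows "B p (\<Sum>i\<in>S. f i) = (\<Sum>i\<in>S. B p (f i))"
  by (induction S rule: infinite_finite_induct) (simp_all add: biadd_0[OF assms] biadd_right[OF assms])

text \<open>The elements of \<open>A \<otimes> A\<close> act on bilinear forms by precomposition. The operator \<open>Dop r\<close> is the action of
  \<open>r \<otimes> 1 + 1 \<otimes> r\<close>, and \<open>killed d\<close> means annihilated by the \<open>d\<close>-th power of the ideal of zero divisors.\<close>

definition Dop :: "bit poly poly \<Rightarrow> bform \<Rightarrow> bform" where
  "Dop u B = (\<lambda>p q. B (u * p) q + B p (u * q))"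

definition pre :: "bit poly poly \<Rightarrow> bit poly poly \<Rightarrow> bform \<Rightarrow> bform" where
  "pre r s B = (\<lambda>p q. B (r * p) (s * q))"

lemma biaddI:
  "(\<And>p p' q. B (p + p') q = B p q + B p' q) \<Longrightarrow> (\<And>p q q'. B p (q + q') = B p q + B p q') \<Longrightarrow> biadd B"
  unfolding biadd_def by blast

lemma biadd_pre: "biadd B \<Longrightarrow> biadd (pre r s B)"
  by (rule biaddI) (simp_all only: biadd_left biadd_right pre_def distrib_left)

lemma biadd_plus: "biadd B \<Longrightarrow> biadd C \<Longrightarrow> biadd (\<lambda>p q. B p q + C p q)"
  by (rule biaddI) (simp_all only: biadd_left biadd_right ac_simps)

lemma Dop_pre: "Dop u B = (\<lambda>p q. pre u 1 B p q + pre 1 u B p q)"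
  by (simp add: Dop_def pre_def)

lemma biadd_Dop: "biadd B \<Longrightarrow> biadd (Dop u B)"
  unfolding Dop_pre by (intro biadd_plus biadd_pre)

lemma biadd_Dop_pow: "biadd B \<Longrightarrow> biadd ((Dop u ^^ a) B)"
  by (induction a) (simp_all add: biadd_Dop)

lemma Dop_commute: "Dop u (Dop v B) = Dop v (Dop u B)"
  by (simp add: Dop_def fun_eq_iff ac_simps)

lemma Dop_pow_commute: "(Dop u ^^ a) (Dop v B) = Dop v ((Dop u ^^ a) B)"
  by (induction a) (simp_all add: Dop_commute[of u v])

lemma Dop_pow_pre: "(Dop u ^^ a) (pre r s B) = pre r s ((Dop u ^^ a) B)"
  by (induction a) (simp_all add: Dop_def pre_def fun_eq_iff ac_simps)

lemma Dop_pow_add: "(Dop u ^^ a) (\<lambda>p q. B p q + C p q) = (\<lambda>p q. (Dop u ^^ a) B p q + (Dop u ^^ a) C p q)"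
  by (induction a) (simp_all add: Dop_def fun_eq_iff ac_simps)

lemma Dop_pow_zero: "(Dop u ^^ a) (\<lambda>p q. 0) = (\<lambda>p q. 0)"
  by (induction a) (simp_all add: Dop_def fun_eq_iff)

lemma Dop_pow_flip: "(Dop u ^^ a) (\<lambda>p q. B q p) = (\<lambda>p q. (Dop u ^^ a) B q p)"
  by (induction a) (simp_all add: Dop_def fun_eq_iff ac_simps)

definition DD :: "nat \<Rightarrow> nat \<Rightarrow> bform \<Rightarrow> bform" where
  "DD a b B = (Dop w2 ^^ a) ((Dop w3 ^^ b) B)"

definition killed :: "nat \<Rightarrow> bform \<Rightarrow> bool" where
  "killed d B \<longleftrightarrow> (\<forall>a b. a + b \<ge> d \<longrightarrow> DD a b B = (\<lambda>p q. 0))"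

lemma killed_mono: "killed d B \<Longrightarrow> d \<le> d' \<Longrightarrow> killed d' B"
  by (simp add: killed_def)

lemma killed_pre: "killed d B \<Longrightarrow> killed d (pre r s B)"
  by (simp add: killed_def DD_def Dop_pow_pre) (simp add: pre_def)

lemma killed_zero: "killed d (\<lambda>p q. 0)"
  by (simp add: killed_def DD_def Dop_pow_zero)

lemma killed_add: "killed d B \<Longrightarrow> killed d C \<Longrightarrow> killed d (\<lambda>p q. B p q + C p q)"
  by (simp add: killed_def DD_def Dop_pow_add)

lemma killed_flip: "killed d B \<Longrightarrow> killed d (\<lambda>p q. B q p)"
proof -
  have "DD a b (\<lambda>p q. B q p) = (\<lambda>p q. DD a b B q p)" for a b
    unfolding DD_def Dop_pow_flip[where u = w3 and a = b and B = B] by (rule Dop_pow_flip)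
  then show "killed d B \<Longrightarrow> killed d (\<lambda>p q. B q p)"
    unfolding killed_def by metis
qed

lemma killed_lin:
  "(\<And>x. killed d (H x)) \<Longrightarrow> killed d (\<lambda>p q. lin (\<lambda>x. H x p q) F)"
proof -
  assume H: "\<And>x. killed d (H x)"
  have "killed d (\<lambda>p q. \<Sum>x\<in>S. H x p q)" for S
    by (induction S rule: infinite_finite_induct) (simp_all add: killed_zero killed_add H)
  then show ?thesis unfolding lin_def .
qed

lemma killed_Dop_w2: "killed (Suc d) B \<Longrightarrow> killed d (Dop w2 B)"
  unfolding killed_def
proof (intro allI impI)
  fix a b assume *: "\<forall>a b. Suc d \<le> a + b \<longrightarrow> DD a b B = (\<lambda>p q. 0)" and "d \<le> a + b"
  then have "DD (Suc a) b B = (\<lambda>p q. 0)" by simp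
  then show "DD a b (Dop w2 B) = (\<lambda>p q. 0)"
    by (simp add: DD_def Dop_pow_commute)
qed

lemma killed_Dop_w3: "killed (Suc d) B \<Longrightarrow> killed d (Dop w3 B)"
  unfolding killed_def
proof (intro allI impI)
  fix a b assume *: "\<forall>a b. Suc d \<le> a + b \<longrightarrow> DD a b B = (\<lambda>p q. 0)" and "d \<le> a + b"
  then have "DD a (Suc b) B = (\<lambda>p q. 0)" by simp
  then show "DD a b (Dop w3 B) = (\<lambda>p q. 0)"
    by (simp add: DD_def Dop_pow_commute)
qed

lemma Dop_add: "biadd B \<Longrightarrow> Dop (r + s) B = (\<lambda>p q. Dop r B p q + Dop s B p q)"
  by (intro ext) (simp only: Dop_def biadd_left biadd_right distrib_right add_ac)

lemma Dop_one: "Dop 1 B = (\<lambda>p q. 0)"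
  by (simp add: Dop_def)

text \<open>The Leibniz rule rs \<otimes> 1 + 1 \<otimes> rs = (r \<otimes> 1 + 1 \<otimes> r)(s
  \<otimes> 1) + (1 \<otimes> r)(s \<otimes> 1 + 1 \<otimes> s).\<close>

lemma Dop_mult: "Dop (r * s) B = (\<lambda>p q. pre s 1 (Dop r B) p q + pre 1 r (Dop s B) p q)"
  by (simp add: Dop_def pre_def fun_eq_iff ac_simps)

text \<open>By the Leibniz rule every r \<otimes> 1 + 1 \<otimes> r is a combination of those for
  \<open>w2\<close> and \<open>w3\<close>, and each of these uses up one power.\<close>

lemma killed_Dop:
  assumes "biadd B" "killed (Suc d) B"
  shows "killed d (Dop r B)"
proof (induction r rule: poly_poly_bit_induct)
  case (1 p q)
  then show ?case by (simp add: Dop_add[OF assms(1)] killed_add)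
next
  case 2
  then show ?case by (simp add: Dop_one killed_zero)
next
  case (3 p)
  then show ?case unfolding Dop_mult
    by (intro killed_add killed_pre killed_Dop_w2 assms)
next
  case (4 p)
  then show ?case unfolding Dop_mult
    by (intro killed_add killed_pre killed_Dop_w3 assms)
qed

text \<open>A variable in the left argument can be moved to the right one at the cost of an
  additional factor \<open>Dop\<close>, which only increases a + b. Hence the left argument may be
  taken to be 1.\<close>

lemma killedI:
  assumes B: "biadd B" and z: "\<And>a b c e. a + b \<ge> d \<Longrightarrow> DD a b B 1 (w2 ^ c * w3 ^ e) = 0"
  shows "killed d B"
proof -
  have bi: "biadd (DD a b B)" for a b unfolding DD_def by (intro biadd_Dop_pow B)
  have base: "\<forall>c e. DD a b B 1 (w2 ^ c * w3 ^ e * q) = 0" if ab: "a + b \<ge> d" for a b q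
  proof (induction q rule: poly_poly_bit_induct)
    case (1 p q)
    then show ?case by (simp add: distrib_left biadd_right[OF bi])
  next
    case 2
    then show ?case using z[OF ab] by simp
  next
    case (3 p)
    show ?case
    proof (intro allI)
      fix c e
      have "w2 ^ c * w3 ^ e * (w2 * p) = w2 ^ Suc c * w3 ^ e * p" by (simp add: ac_simps)
      then show "DD a b B 1 (w2 ^ c * w3 ^ e * (w2 * p)) = 0" using 3 by metis
    qed
  next
    case (4 p)
    show ?case
    proof (intro allI)
      fix c e
      have "w2 ^ c * w3 ^ e * (w3 * p) = w2 ^ c * w3 ^ Suc e * p" by (simp add: ac_simps)
      then show "DD a b B 1 (w2 ^ c * w3 ^ e * (w3 * p)) = 0" using 4 by metis
    qed
  qed
  have "\<forall>a b q. a + b \<ge> d \<longrightarrow> DD a b B p q = 0" for p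
  proof (induction p rule: poly_poly_bit_induct)
    case (1 p q)
    then show ?case by (simp add: biadd_left[OF bi])
  next
    case 2
    show ?case using base[of _ _ ] by (metis mult_1 power_0)
  next
    case (3 p)
    have "DD a b B (w2 * p) q = DD (Suc a) b B p q + DD a b B p (w2 * q)" for a b q
      by (simp add: DD_def Dop_def add.assoc)
    then show ?case using 3 by simp
  next
    case (4 p)
    have "DD a (Suc b) B = Dop w3 (DD a b B)" for a b
      by (simp add: DD_def Dop_pow_commute)
    then have "DD a b B (w3 * p) q = DD a (Suc b) B p q + DD a b B p (w3 * q)" for a b q
      by (simp add: Dop_def add.assoc)
    then show ?case using 4 by simp
  qed
  then show ?thesis by (auto simp: killed_def fun_eq_iff)
qed

section \<open>The tensor square of a presented algebra\<close>

text \<open>Fixing a surjection \<open>pr\<close> of the polynomial ring onto \<open>A\<close>, rather than a quotient, makes the results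
  applicable to any algebra that is merely isomorphic to the presented one.\<close>

locale presented =
  fixes A :: "'a graded_ring" (structure)
    and pr :: "bit poly poly \<Rightarrow> 'a"
    and L :: "(bit poly poly \<Rightarrow> bit) set"
  assumes carrier_eq: "carrier A = range pr"
    and pr_add: "pr (p + q) = pr p \<oplus> pr q"
    and pr_mult: "pr (p * q) = pr p \<otimes> pr q"
    and pr_one: "pr 1 = \<one>"
    and pr_zero: "pr 0 = \<zero>"
    and grade_eq: "grade A k = pr ` bhom k"
    and L_add: "l \<in> L \<Longrightarrow> l (p + q) = l p + l q"
    and L_ker: "pr p = \<zero> \<longleftrightarrow> (\<forall>l\<in>L. l p = 0)"
begin

lemma pr_closed [simp]: "pr p \<in> carrier A"
  by (simp add: carrier_eq)

lemma pr_eq_iff: "pr p = pr q \<longleftrightarrow> pr (p + q) = \<zero>"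
proof
  assume "pr p = pr q"
  then have "pr (p + q) = pr (q + q)" by (simp only: pr_add)
  then show "pr (p + q) = \<zero>" by (simp add: pr_zero)
next
  assume "pr (p + q) = \<zero>"
  then have "pr (p + q + q) = pr (0 + q)" by (simp only: pr_add[of _ q] pr_zero)
  then show "pr p = pr q" by (simp add: add.assoc)
qed

text \<open>An arbitrary choice of preimages, with no compatibility with the operations; forms that
  factor through \<open>pr\<close> do not see the choice.\<close>

definition rep :: "'a \<Rightarrow> bit poly poly" where
  "rep a = (SOME p. pr p = a)"

lemma pr_rep [simp]: "a \<in> carrier A \<Longrightarrow> pr (rep a) = a"
  unfolding rep_def carrier_eq by (rule someI_ex) blast

lemma pr_mult_zero: "pr p = \<zero> \<Longrightarrow> pr (q * p) = \<zero>"
proof -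
  assume "pr p = \<zero>"
  then have "pr (q * p) = pr q \<otimes> pr 0" by (simp add: pr_mult pr_zero)
  also have "\<dots> = pr (q * 0)" by (simp only: pr_mult)
  also have "\<dots> = \<zero>" by (simp add: pr_zero)
  finally show ?thesis .
qed

lemma A_ring_laws:
  assumes "a \<in> carrier A" "b \<in> carrier A" "c \<in> carrier A"
  shows "a \<oplus> b \<in> carrier A" "a \<otimes> b \<in> carrier A"
    "a \<oplus> b \<oplus> c = a \<oplus> (b \<oplus> c)" "a \<oplus> b = b \<oplus> a" "\<zero> \<oplus> a = a"
    "a \<otimes> b \<otimes> c = a \<otimes> (b \<otimes> c)" "\<one> \<otimes> a = a" "a \<otimes> \<one> = a"
    "\<one> \<in> carrier A" "\<zero> \<in> carrier A"
proof -
  obtain p q r where [simp]: "a = pr p" "b = pr q" "c = pr r"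
    using assms by (auto simp: carrier_eq)
  show "a \<oplus> b \<in> carrier A" "a \<otimes> b \<in> carrier A"
    "a \<oplus> b \<oplus> c = a \<oplus> (b \<oplus> c)" "a \<oplus> b = b \<oplus> a" "\<zero> \<oplus> a = a"
    "a \<otimes> b \<otimes> c = a \<otimes> (b \<otimes> c)" "\<one> \<otimes> a = a" "a \<otimes> \<one> = a"
    "\<one> \<in> carrier A" "\<zero> \<in> carrier A"
    by (simp_all flip: pr_add pr_mult pr_one pr_zero add: ac_simps)
qed

lemma one_closed [simp]: "\<one> \<in> carrier A" and zero_closed [simp]: "\<zero> \<in> carrier A"
  by (simp_all flip: pr_one pr_zero)

section \<open>The free ring on pairs and the ideal of bilinearity relations\<close>

abbreviation TF where "TF \<equiv> tensor_free A A"
abbreviation K where "K \<equiv> Idl\<^bsub>TF\<^esub> (tensor_relations A A)"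

lemma carrier_TF: "F \<in> carrier TF \<longleftrightarrow> Poly_Mapping.keys F \<subseteq> carrier A \<times> carrier A"
  by (simp add: tensor_free_simps)

lemma TF_add_closed: "F \<in> carrier TF \<Longrightarrow> G \<in> carrier TF \<Longrightarrow> F + G \<in> carrier TF"
  unfolding carrier_TF using keys_add[of F G] by blast

lemma TF_zero_closed: "0 \<in> carrier TF"
  by (simp add: carrier_TF)

lemma TF_sgl_closed: "a \<in> carrier A \<Longrightarrow> b \<in> carrier A \<Longrightarrow> sgl (a, b) \<in> carrier TF"
  by (simp add: carrier_TF)

lemma TF_mult_closed: "F \<in> carrier TF \<Longrightarrow> G \<in> carrier TF \<Longrightarrow> F \<otimes>\<^bsub>TF\<^esub> G \<in> carrier TF"
  unfolding carrier_TF tensor_free_mult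
  by (intro keys_lin) (auto intro!: A_ring_laws)

lemma TF_assoc:
  assumes "F \<in> carrier TF" "G \<in> carrier TF" "H \<in> carrier TF"
  shows "F \<otimes>\<^bsub>TF\<^esub> G \<otimes>\<^bsub>TF\<^esub> H = F \<otimes>\<^bsub>TF\<^esub> (G \<otimes>\<^bsub>TF\<^esub> H)"
proof -
  have "F \<otimes>\<^bsub>TF\<^esub> G \<otimes>\<^bsub>TF\<^esub> H =
    lin (\<lambda>x. lin (\<lambda>y. lin (\<lambda>z. sgl (fst x \<otimes> fst y \<otimes> fst z, snd x \<otimes> snd y \<otimes> snd z)) H) G) F"
    unfolding tensor_free_mult by (simp add: lin_lin)
  also have "\<dots> = lin (\<lambda>x. lin (\<lambda>y. lin (\<lambda>z. sgl (fst x \<otimes> (fst y \<otimes> fst z), snd x \<otimes> (snd y \<otimes> snd z))) H) G) F"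
    using assms unfolding carrier_TF by (intro lin_cong) (auto simp: A_ring_laws dest!: subsetD)
  also have "\<dots> = F \<otimes>\<^bsub>TF\<^esub> (G \<otimes>\<^bsub>TF\<^esub> H)"
    unfolding tensor_free_mult by (simp add: lin_lin)
  finally show ?thesis .
qed

lemma ring_TF: "ring TF"
proof (rule ringI)
  show "abelian_group TF"
  proof (rule abelian_groupI)
    fix F assume "F \<in> carrier TF"
    then show "\<exists>G\<in>carrier TF. G \<oplus>\<^bsub>TF\<^esub> F = \<zero>\<^bsub>TF\<^esub>"
      by (intro bexI[of _ F]) (simp_all add: tensor_free_simps)
  qed (simp_all only: tensor_free_simps(3,4) TF_add_closed TF_zero_closed add_ac add_0_left add_0_right)
  show "Group.monoid TF"
  proof (rule Group.monoidI)
    fix F assume F: "F \<in> carrier TF"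
    have "\<one>\<^bsub>TF\<^esub> \<otimes>\<^bsub>TF\<^esub> F = lin sgl F"
      unfolding tensor_free_mult tensor_free_simps lin_sgl
      using F unfolding carrier_TF by (intro lin_cong) (auto simp: A_ring_laws dest!: subsetD)
    then show "\<one>\<^bsub>TF\<^esub> \<otimes>\<^bsub>TF\<^esub> F = F" by (simp add: lin_self)
    have "F \<otimes>\<^bsub>TF\<^esub> \<one>\<^bsub>TF\<^esub> = lin sgl F"
      unfolding tensor_free_mult tensor_free_simps lin_sgl
      using F unfolding carrier_TF by (intro lin_cong) (auto simp: A_ring_laws dest!: subsetD)
    then show "F \<otimes>\<^bsub>TF\<^esub> \<one>\<^bsub>TF\<^esub> = F" by (simp add: lin_self)
  qed (auto simp: TF_assoc TF_mult_closed tensor_free_simps(2) TF_sgl_closed)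
  fix F G H assume "F \<in> carrier TF" "G \<in> carrier TF" "H \<in> carrier TF"
  show "(F \<oplus>\<^bsub>TF\<^esub> G) \<otimes>\<^bsub>TF\<^esub> H = F \<otimes>\<^bsub>TF\<^esub> H \<oplus>\<^bsub>TF\<^esub> G \<otimes>\<^bsub>TF\<^esub> H"
    unfolding tensor_free_mult tensor_free_simps by (simp add: lin_add)
  show "H \<otimes>\<^bsub>TF\<^esub> (F \<oplus>\<^bsub>TF\<^esub> G) = H \<otimes>\<^bsub>TF\<^esub> F \<oplus>\<^bsub>TF\<^esub> H \<otimes>\<^bsub>TF\<^esub> G"
    unfolding tensor_free_mult tensor_free_simps by (simp add: lin_add lin_fun_add)
qed

text \<open>These are the bilinear forms on \<open>A\<close>, that is, the linear dual of the tensor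
  square, pulled back to polynomials.\<close>

definition bforms :: "bform set" where
  "bforms = {B. biadd B \<and> (\<forall>p q. pr p = \<zero> \<longrightarrow> B p q = 0) \<and> (\<forall>p q. pr q = \<zero> \<longrightarrow> B p q = 0)}"

definition act :: "('a \<times> 'a \<Rightarrow>\<^sub>0 bit) \<Rightarrow> bform \<Rightarrow> bform" where
  "act F B = (\<lambda>p q. lin (\<lambda>x. B (rep (fst x) * p) (rep (snd x) * q)) F)"

lemma bforms_cong:
  assumes "B \<in> bforms" "pr p = pr p'" "pr q = pr q'"
  shows "B p q = B p' q'"
proof -
  have B: "biadd B" using assms by (simp add: bforms_def)
  have "B (p + p') q = 0" "B p' (q + q') = 0"
    using assms unfolding pr_eq_iff[of p] pr_eq_iff[of q] bforms_def by blast+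
  then show ?thesis
    by (simp add: biadd_left[OF B] biadd_right[OF B] bit_add_eq_0_iff)
qed

lemma act_add: "act (F + G) B = (\<lambda>p q. act F B p q + act G B p q)"
  unfolding act_def by (simp add: lin_add)

lemma act_bforms: "B \<in> bforms \<Longrightarrow> act F B \<in> bforms"
proof -
  assume B: "B \<in> bforms"
  then have bi: "biadd B" and z: "\<And>p q. pr p = \<zero> \<Longrightarrow> B p q = 0" "\<And>p q. pr q = \<zero> \<Longrightarrow> B p q = 0"
    unfolding bforms_def by blast+
  have "biadd (act F B)"
    unfolding act_def
    by (rule biaddI) (simp_all only: distrib_left biadd_left[OF bi] biadd_right[OF bi] lin_fun_add)
  moreover have "act F B p q = 0" if "pr p = \<zero>" for p q
    unfolding act_def lin_def by (intro sum.neutral ballI z(1) pr_mult_zero that)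
  moreover have "act F B p q = 0" if "pr q = \<zero>" for p q
    unfolding act_def lin_def by (intro sum.neutral ballI z(2) pr_mult_zero that)
  ultimately show ?thesis unfolding bforms_def by blast
qed

lemma act_mult:
  assumes "F \<in> carrier TF" "G \<in> carrier TF" "B \<in> bforms"
  shows "act (F \<otimes>\<^bsub>TF\<^esub> G) B = act F (act G B)"
proof (intro ext)
  fix p q
  have "act (F \<otimes>\<^bsub>TF\<^esub> G) B p q =
      lin (\<lambda>x. lin (\<lambda>y. B (rep (fst x \<otimes> fst y) * p) (rep (snd x \<otimes> snd y) * q)) G) F"
    unfolding act_def tensor_free_mult by (simp add: lin_lin)
  also have "\<dots> = lin (\<lambda>x. lin (\<lambda>y. B (rep (fst y) * (rep (fst x) * p)) (rep (snd y) * (rep (snd x) * q))) G) F"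
  proof (intro lin_cong bforms_cong[OF assms(3)])
    fix x y assume "x \<in> Poly_Mapping.keys F" "y \<in> Poly_Mapping.keys G"
    then have x: "fst x \<in> carrier A" "snd x \<in> carrier A" "fst y \<in> carrier A" "snd y \<in> carrier A"
      using assms(1,2) unfolding carrier_TF by (auto dest!: subsetD)
    have *: "pr (rep (a \<otimes> b) * p) = pr (rep b * (rep a * p))"
      if "a \<in> carrier A" "b \<in> carrier A" for a b p
    proof -
      have "pr (rep b * (rep a * p)) = pr (rep a * rep b * p)" by (simp only: ac_simps)
      also have "\<dots> = pr (rep a) \<otimes> pr (rep b) \<otimes> pr p" by (simp only: pr_mult)
      also have "\<dots> = pr (rep (a \<otimes> b) * p)"
        using that by (simp add: pr_mult[of _ p] A_ring_laws)
      finally show ?thesis ..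
    qed
    show "pr (rep (fst x \<otimes> fst y) * p) = pr (rep (fst y) * (rep (fst x) * p))"
      "pr (rep (snd x \<otimes> snd y) * q) = pr (rep (snd y) * (rep (snd x) * q))"
      using * x by blast+
  qed
  finally show "act (F \<otimes>\<^bsub>TF\<^esub> G) B p q = act F (act G B) p q"
    unfolding act_def .
qed

lemma act_sgl_pr: "B \<in> bforms \<Longrightarrow> act (sgl (pr r, pr s)) B = pre r s B"
  unfolding act_def pre_def lin_sgl
  by (intro ext bforms_cong) (simp_all add: pr_mult)

lemma act_one: "B \<in> bforms \<Longrightarrow> act \<one>\<^bsub>TF\<^esub> B = B"
  using act_sgl_pr[of B 1 1] by (simp add: tensor_free_simps pr_one pre_def)

text \<open>\<open>K\<close> is given by generators, which makes nonmembership hard to show. This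
  ideal contains the relations and is tested by forms, so \<open>K \<subseteq> null\<close> supplies
  the nonvanishing statements.\<close>

definition null :: "('a \<times> 'a \<Rightarrow>\<^sub>0 bit) set" where
  "null = {F \<in> carrier TF. \<forall>B\<in>bforms. act F B = (\<lambda>p q. 0)}"

lemma act_zero_form: "act F (\<lambda>p q. 0) = (\<lambda>p q. 0)"
  by (simp add: act_def lin_def)

lemma ideal_null: "ideal null TF"
proof (rule idealI)
  show "ring TF" by (rule ring_TF)
  have "inv\<^bsub>add_monoid TF\<^esub> F = F" if F: "F \<in> carrier TF" for F
  proof -
    interpret ring TF by (rule ring_TF)
    show ?thesis using F minus_equality[of F F] by (simp add: tensor_free_simps a_inv_def)
  qed
  moreover have "F + G \<in> null" if "F \<in> null" "G \<in> null" for F G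
    using that unfolding null_def by (simp add: act_add TF_add_closed)
  moreover have "0 \<in> null"
    unfolding null_def by (simp add: TF_zero_closed act_def)
  moreover have "null \<subseteq> carrier TF" unfolding null_def by blast
  ultimately show "subgroup null (add_monoid TF)"
    by (intro subgroup.intro) (auto simp: tensor_free_simps(3,4))
  fix F G assume "F \<in> null" "G \<in> carrier TF"
  then show "G \<otimes>\<^bsub>TF\<^esub> F \<in> null" "F \<otimes>\<^bsub>TF\<^esub> G \<in> null"
    by (auto simp: null_def act_mult TF_mult_closed act_bforms act_zero_form)
qed

lemma relations_carrier: "tensor_relations A A \<subseteq> carrier TF"
  unfolding tensor_relations_def poly_mapping_bit_diff
  by (auto intro!: TF_add_closed TF_sgl_closed A_ring_laws)

lemma relations_null: "tensor_relations A A \<subseteq> null"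
proof
  fix F assume F: "F \<in> tensor_relations A A"
  have "act F B = (\<lambda>p q. 0)" if B: "B \<in> bforms" for B
  proof -
    have bi: "biadd B" using B by (simp add: bforms_def)
    from F consider a a' b where "a \<in> carrier A" "a' \<in> carrier A" "b \<in> carrier A"
        "F = sgl (a \<oplus> a', b) + sgl (a, b) + sgl (a', b)"
      | a b b' where "a \<in> carrier A" "b \<in> carrier A" "b' \<in> carrier A"
        "F = sgl (a, b \<oplus> b') + sgl (a, b) + sgl (a, b')"
      unfolding tensor_relations_def poly_mapping_bit_diff by blast
    then show ?thesis
    proof cases
      case 1
      obtain r r' s where "a = pr r" "a' = pr r'" "b = pr s"
        using 1 by (auto simp: carrier_eq)
      then have "F = sgl (pr (r + r'), pr s) + sgl (pr r, pr s) + sgl (pr r', pr s)"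
        using 1 by (simp add: pr_add)
      then show ?thesis
        by (simp only: act_add act_sgl_pr[OF B] pre_def distrib_right biadd_left[OF bi] add_ac
            bit_add_left_self bit_add_self)
    next
      case 2
      obtain r s s' where "a = pr r" "b = pr s" "b' = pr s'"
        using 2 by (auto simp: carrier_eq)
      then have "F = sgl (pr r, pr (s + s')) + sgl (pr r, pr s) + sgl (pr r, pr s')"
        using 2 by (simp add: pr_add)
      then show ?thesis
        by (simp only: act_add act_sgl_pr[OF B] pre_def distrib_right biadd_right[OF bi] add_ac
            bit_add_left_self bit_add_self)
    qed
  qed
  then show "F \<in> null" using F relations_carrier by (auto simp: null_def)
qed

lemma K_ideal: "ideal K TF"
  by (rule ring.genideal_ideal[OF ring_TF relations_carrier])

lemma K_null: "K \<subseteq> null"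
  by (rule ring.genideal_minimal[OF ring_TF ideal_null relations_null])

lemma K_add: "F \<in> K \<Longrightarrow> G \<in> K \<Longrightarrow> F + G \<in> K"
  using additive_subgroup.a_closed[OF ideal.axioms(1)[OF K_ideal], of F G] by (simp add: tensor_free_simps)

lemma K_rel_left: "sgl (pr (r + r'), pr s) + (sgl (pr r, pr s) + sgl (pr r', pr s)) \<in> K"
  and K_rel_right: "sgl (pr r, pr (s + s')) + (sgl (pr r, pr s) + sgl (pr r, pr s')) \<in> K"
proof -
  have "sgl (pr r \<oplus> pr r', pr s) - sgl (pr r, pr s) - sgl (pr r', pr s) \<in> tensor_relations A A"
    unfolding tensor_relations_def
    by (rule UnI1, rule CollectI, rule exI[of _ "pr r"], rule exI[of _ "pr r'"], rule exI[of _ "pr s"]) simp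
  moreover have "sgl (pr r, pr s \<oplus> pr s') - sgl (pr r, pr s) - sgl (pr r, pr s') \<in> tensor_relations A A"
    unfolding tensor_relations_def
    by (rule UnI2, rule CollectI, rule exI[of _ "pr r"], rule exI[of _ "pr s"], rule exI[of _ "pr s'"]) simp
  ultimately have "sgl (pr r \<oplus> pr r', pr s) - sgl (pr r, pr s) - sgl (pr r', pr s) \<in> K"
    "sgl (pr r, pr s \<oplus> pr s') - sgl (pr r, pr s) - sgl (pr r, pr s') \<in> K"
    using ring.genideal_self[OF ring_TF relations_carrier] by blast+
  then show "sgl (pr (r + r'), pr s) + (sgl (pr r, pr s) + sgl (pr r', pr s)) \<in> K"
    "sgl (pr r, pr (s + s')) + (sgl (pr r, pr s) + sgl (pr r, pr s')) \<in> K"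
    by (simp_all add: poly_mapping_bit_diff pr_add add.assoc)
qed

lemma K_zero_left: "pr r = \<zero> \<Longrightarrow> sgl (pr r, pr s) \<in> K"
  and K_zero_right: "pr s = \<zero> \<Longrightarrow> sgl (pr r, pr s) \<in> K"
proof -
  have "sgl (pr 0, pr s) \<in> K" for s using K_rel_left[of 0 0 s] by simp
  then show "pr r = \<zero> \<Longrightarrow> sgl (pr r, pr s) \<in> K" by (simp add: pr_zero)
  have "sgl (pr r, pr 0) \<in> K" for r using K_rel_right[of r 0 0] by simp
  then show "pr s = \<zero> \<Longrightarrow> sgl (pr r, pr s) \<in> K" by (simp add: pr_zero)
qed

lemma L_zero: "l \<in> L \<Longrightarrow> l 0 = 0"
  using L_add[of l 0 0] by simp

lemma sum_list_K: "(\<And>x. x \<in> set xs \<Longrightarrow> f x \<in> K) \<Longrightarrow> sum_list (map f xs) \<in> K"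
proof (induction xs)
  case Nil
  have "\<zero>\<^bsub>TF\<^esub> \<in> K" by (rule additive_subgroup.zero_closed[OF ideal.axioms(1)[OF K_ideal]])
  then show ?case by (simp add: tensor_free_simps)
qed (simp add: K_add)

lemma K_sum_right:
  "sgl (pr r, pr (sum_list (map f xs))) + sum_list (map (\<lambda>x. sgl (pr r, pr (f x))) xs) \<in> K"
proof (induction xs)
  case Nil
  show ?case using K_zero_right[of 0 r] by (simp add: pr_zero)
next
  case (Cons x xs)
  have "sgl (pr r, pr (f x + sum_list (map f xs))) +
      (sgl (pr r, pr (f x)) + sgl (pr r, pr (sum_list (map f xs)))) +
      (sgl (pr r, pr (sum_list (map f xs))) + sum_list (map (\<lambda>x. sgl (pr r, pr (f x))) xs)) \<in> K"
    by (rule K_add[OF K_rel_right Cons.IH])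
  then show ?case by (simp add: add.assoc)
qed

text \<open>If the first factor of the leading term is not zero,
  some functional expresses the second factor through the other ones, and the number of
  terms drops.\<close>

lemma tensor_separation:
  "(\<And>l m. l \<in> L \<Longrightarrow> m \<in> L \<Longrightarrow> (\<Sum>(p, q)\<leftarrow>xs. l p * m q) = 0) \<Longrightarrow>
    (\<Sum>(p, q)\<leftarrow>xs. sgl (pr p, pr q)) \<in> K"
proof (induction "length xs" arbitrary: xs)
  case 0
  then show ?case using sum_list_K[of "[]"] by simp
next
  case (Suc n)
  obtain p q ys where xs: "xs = (p, q) # ys" "length ys = n"
    using Suc(2) by (cases xs) auto
  show ?case
  proof (cases "pr p = \<zero>")
    case True
    then have lp: "l p = 0" if "l \<in> L" for l using L_ker that by blast
    then have "(\<Sum>(p, q)\<leftarrow>ys. l p * m q) = 0" if "l \<in> L" "m \<in> L" for l m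
      using Suc.prems[OF that] lp[OF that(1)] by (simp add: xs)
    then have "(\<Sum>(p, q)\<leftarrow>ys. sgl (pr p, pr q)) \<in> K" using Suc.hyps(1)[of ys] xs by blast
    then show ?thesis using K_add[OF K_zero_left[OF True]] by (simp add: xs)
  next
    case False
    then obtain l where l: "l \<in> L" "l p \<noteq> 0" unfolding L_ker by blast
    then have lp: "l p = 1" by simp
    \<comment> \<open>With l p = 1, each p' with l p' = 1 is replaced by p' + p. This rewrites the
      sum of the p' \<otimes> q' as p \<otimes> (q plus the sum of the \<open>c x\<close>) plus the
      sum of the \<open>d x \<otimes> snd x\<close>, and the hypothesis for \<open>l\<close> makes
      the first summand zero.\<close>
    define c where "c x = (if l (fst x) = 1 then snd x else 0)" for x :: "bit poly poly \<times> bit poly poly"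
    define d where "d x = (if l (fst x) = 1 then fst x + p else fst x)" for x :: "bit poly poly \<times> bit poly poly"
    have sum_m: "m (sum_list (map c zs)) = (\<Sum>(p, q)\<leftarrow>zs. l p * m q)" if "m \<in> L" for m zs
      by (induction zs) (auto simp: L_zero[OF that] L_add[OF that] c_def)
    have q: "pr (q + sum_list (map c ys)) = \<zero>"
      unfolding L_ker
    proof
      fix m assume m: "m \<in> L"
      show "m (q + sum_list (map c ys)) = 0"
        using Suc.prems[OF l(1) m] lp by (simp add: xs L_add[OF m] sum_m[OF m])
    qed
    have "(\<Sum>(p', q')\<leftarrow>map (\<lambda>x. (d x, snd x)) ys. l' p' * m q') = 0" if lm: "l' \<in> L" "m \<in> L" for l' m
    proof -
      have "(\<Sum>(p', q')\<leftarrow>map (\<lambda>x. (d x, snd x)) zs. l' p' * m q') =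
          (\<Sum>(p', q')\<leftarrow>zs. l' p' * m q') + l' p * m (sum_list (map c zs))" for zs
        by (induction zs) (auto simp: d_def c_def L_add[OF lm(1)] L_add[OF lm(2)] L_zero[OF lm(2)] algebra_simps)
      moreover have "m (sum_list (map c ys)) = m q"
        using q lm(2) unfolding L_ker L_add[OF lm(2), symmetric]
        by (metis L_add[OF lm(2)] bit_add_eq_0_iff)
      ultimately show ?thesis
        using Suc.prems[OF lm] by (simp add: xs add.commute)
    qed
    then have 1: "(\<Sum>(p', q')\<leftarrow>map (\<lambda>x. (d x, snd x)) ys. sgl (pr p', pr q')) \<in> K"
      using Suc.hyps(1)[of "map (\<lambda>x. (d x, snd x)) ys"] xs(2) by simp
    have 2: "(\<Sum>(p', q')\<leftarrow>zs. sgl (pr p', pr q')) + (\<Sum>(p', q')\<leftarrow>map (\<lambda>x. (d x, snd x)) zs. sgl (pr p', pr q'))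
        + sum_list (map (\<lambda>x. sgl (pr p, pr (c x))) zs) \<in> K" for zs
    proof (induction zs)
      case Nil
      then show ?case using sum_list_K[of "[]"] by simp
    next
      case (Cons x zs)
      have "sgl (pr (fst x), pr (snd x)) + sgl (pr (d x), pr (snd x)) + sgl (pr p, pr (c x)) \<in> K"
      proof (cases "l (fst x) = 1")
        case True
        then show ?thesis using K_rel_left[of "fst x" p "snd x"] by (simp add: c_def d_def ac_simps)
      next
        case False
        then show ?thesis using K_zero_right[of 0 p] by (simp add: c_def d_def pr_zero)
      qed
      note rel = this
      have eq: "(a + b + c) + (S + S1 + P) = (a + S) + (b + S1) + (c + P)"
        for a b c S S1 P :: "'a \<times> 'a \<Rightarrow>\<^sub>0 bit"
        by (simp only: add_ac)
      note K_add[OF rel Cons.IH, unfolded eq]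
      then show ?case by (simp add: case_prod_unfold)
    qed
    have q': "pr (sum_list (map c ys)) = pr q" using q by (simp add: pr_eq_iff add.commute)
    have 3: "sgl (pr p, pr q) + sum_list (map (\<lambda>x. sgl (pr p, pr (c x))) ys) \<in> K"
      using K_sum_right[of p c ys] unfolding q' .
    have "S1 + (S + S1 + P) + (h + P) = h + S" for S S1 P h :: "'a \<times> 'a \<Rightarrow>\<^sub>0 bit"
      by (simp add: add_ac)
    with K_add[OF K_add[OF 1 2[of ys]] 3] show ?thesis
      by (simp add: xs)
  qed
qed

text \<open>Products of functionals from \<open>L\<close> are forms, so they vanish on
  \<open>K\<close>; conversely they suffice by the separation lemma applied to representatives of
  the support.\<close>

lemma in_K_iff:
  assumes F: "F \<in> carrier TF"
  shows "F \<in> K \<longleftrightarrow> (\<forall>l\<in>L. \<forall>m\<in>L. act F (\<lambda>p q. l p * m q) 1 1 = 0)"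
proof
  assume "F \<in> K"
  then have "F \<in> null" using K_null by blast
  then have null: "act F B = (\<lambda>p q. 0)" if "B \<in> bforms" for B
    using that unfolding null_def by blast
  have "(\<lambda>p q. l p * m q) \<in> bforms" if lm: "l \<in> L" "m \<in> L" for l m
  proof -
    have "biadd (\<lambda>p q. l p * m q)"
      by (rule biaddI) (simp_all only: L_add[OF lm(1)] L_add[OF lm(2)] distrib_left distrib_right)
    moreover have "l p = 0" "m p = 0" if "pr p = \<zero>" for p
      using that lm L_ker by blast+
    ultimately show ?thesis unfolding bforms_def by simp
  qed
  note bf = this
  show "\<forall>l\<in>L. \<forall>m\<in>L. act F (\<lambda>p q. l p * m q) 1 1 = 0"
  proof (intro ballI)
    fix l m assume lm: "l \<in> L" "m \<in> L"
    show "act F (\<lambda>p q. l p * m q) 1 1 = 0"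
      by (rule fun_cong[OF fun_cong[OF null[OF bf[OF lm]]]])
  qed
next
  assume *: "\<forall>l\<in>L. \<forall>m\<in>L. act F (\<lambda>p q. l p * m q) 1 1 = 0"
  obtain xs where xs: "set xs = Poly_Mapping.keys F" "distinct xs"
    by (rule exE[OF finite_distinct_list[OF finite_keys[of F]]]) blast
  define ys where "ys = map (\<lambda>x. (rep (fst x), rep (snd x))) xs"
  have "(\<Sum>(p, q)\<leftarrow>ys. l p * m q) = 0" if "l \<in> L" "m \<in> L" for l m
  proof -
    have "(\<Sum>(p, q)\<leftarrow>ys. l p * m q) = (\<Sum>x\<in>set xs. l (rep (fst x)) * m (rep (snd x)))"
      using xs(2) by (simp add: ys_def sum_list_distinct_conv_sum_set comp_def)
    then show ?thesis using * that unfolding act_def lin_def by (simp add: xs)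
  qed
  then have "(\<Sum>(p, q)\<leftarrow>ys. sgl (pr p, pr q)) \<in> K" by (rule tensor_separation)
  also have "(\<Sum>(p, q)\<leftarrow>ys. sgl (pr p, pr q)) = (\<Sum>x\<in>set xs. sgl (pr (rep (fst x)), pr (rep (snd x))))"
    using xs(2) by (simp add: ys_def sum_list_distinct_conv_sum_set comp_def)
  also have "\<dots> = lin sgl F"
    unfolding lin_def xs(1) using F unfolding carrier_TF by (intro sum.cong) (auto dest!: subsetD)
  finally show "F \<in> K" by (simp add: lin_self)
qed

end

section \<open>Zero-divisor cup-length\<close>

lemma w2_bhom: "w2 \<in> bhom 2" and w3_bhom: "w3 \<in> bhom 3" and one_bhom: "1 \<in> bhom 0"
  using cf_monomial[of 1 0] cf_monomial[of 0 1] cf_monomial[of 0 0]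
  by (auto simp: bhom_def of_bool_def split: if_splits)

context presented
begin

abbreviation cls where "cls F \<equiv> K +>\<^bsub>TF\<^esub> F"

lemma carrier_tensor: "z \<in> carrier (tensor A A) \<longleftrightarrow> (\<exists>F\<in>carrier TF. z = cls F)"
  unfolding tensor_def graded_quot_simps A_RCOSETS_def' by blast

lemma cls_mult:
  "F \<in> carrier TF \<Longrightarrow> G \<in> carrier TF \<Longrightarrow> cls F \<otimes>\<^bsub>tensor A A\<^esub> cls G = cls (F \<otimes>\<^bsub>TF\<^esub> G)"
  unfolding tensor_def graded_quot_simps by (rule ideal.rcoset_mult_add[OF K_ideal])

lemma cls_eq_zero_iff:
  assumes "F \<in> carrier TF"
  shows "cls F = \<zero>\<^bsub>tensor A A\<^esub> \<longleftrightarrow> F \<in> K"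
proof -
  interpret KI: ideal K TF by (rule K_ideal)
  show ?thesis
    unfolding tensor_def graded_quot_simps
    using KI.rcos_const_imp_mem[OF assms] KI.a_rcos_const by blast
qed

lemma cls_elements: "cls F = (\<lambda>k. k + F) ` K"
  unfolding a_r_coset_def' by (auto simp: tensor_free_simps)

text \<open>A lift of the multiplication map to polynomials, determined only up to the kernel of
  \<open>pr\<close>.\<close>

definition mu :: "('a \<times> 'a \<Rightarrow>\<^sub>0 bit) \<Rightarrow> bit poly poly" where
  "mu F = lin (\<lambda>x. rep (fst x) * rep (snd x)) F"

lemma mu_add: "mu (F + G) = mu F + mu G"
  unfolding mu_def by (simp add: lin_add)

lemma mu_pr_sgl: "pr (mu (sgl (pr r, pr s))) = pr (r * s)"
  by (simp add: mu_def pr_mult)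

lemma finsum_keys:
  assumes "F \<in> carrier TF"
  shows "(\<Oplus>x\<in>Poly_Mapping.keys F. fst x \<otimes> snd x) = pr (mu F)"
proof -
  interpret abelian_monoid A
    by (rule abelian_monoidI; (rule zero_closed | (rule A_ring_laws; assumption)))
  have "(\<Oplus>x\<in>S. fst x \<otimes> snd x) = pr (\<Sum>x\<in>S. rep (fst x) * rep (snd x))"
    if "finite S" "S \<subseteq> carrier A \<times> carrier A" for S
    using that
  proof (induction S)
    case empty
    then show ?case by (simp add: pr_zero)
  next
    case (insert x S)
    then have x: "fst x \<in> carrier A" "snd x \<in> carrier A" by auto
    have "(\<lambda>x. fst x \<otimes> snd x) \<in> S \<rightarrow> carrier A"
      using insert.prems by (auto intro!: A_ring_laws)
    then have "(\<Oplus>x\<in>insert x S. fst x \<otimes> snd x) = fst x \<otimes> snd x \<oplus> (\<Oplus>x\<in>S. fst x \<otimes> snd x)"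
      using insert.hyps x A_ring_laws(2) by (intro finsum_insert) auto
    then show ?case
      using insert x by (simp add: pr_add pr_mult)
  qed
  then show ?thesis using assms unfolding carrier_TF mu_def lin_def by simp
qed

lemma L_lin: "l \<in> L \<Longrightarrow> l (lin f F) = lin (\<lambda>x. l (f x)) F"
proof -
  assume l: "l \<in> L"
  have "l (\<Sum>x\<in>S. f x) = (\<Sum>x\<in>S. l (f x))" for S
    by (induction S rule: infinite_finite_induct) (simp_all add: L_zero[OF l] L_add[OF l])
  then show ?thesis by (simp add: lin_def)
qed

lemma mu_K: "F \<in> K \<Longrightarrow> pr (mu F) = \<zero>"
  unfolding L_ker
proof
  fix l assume F: "F \<in> K" and l: "l \<in> L"
  define B :: bform where "B = (\<lambda>p q. l (p * q))"
  have "biadd B"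
    unfolding B_def by (rule biaddI) (simp_all only: distrib_left distrib_right L_add[OF l])
  moreover have "B p q = 0" if "pr p = \<zero> \<or> pr q = \<zero>" for p q
  proof -
    have "pr (p * q) = \<zero>"
      using that pr_mult_zero[of q p] pr_mult_zero[of p q] by (auto simp: mult.commute)
    then show ?thesis using l L_ker unfolding B_def by blast
  qed
  ultimately have "B \<in> bforms" unfolding bforms_def by blast
  then have "act F B = (\<lambda>p q. 0)" using F K_null unfolding null_def by blast
  from fun_cong[OF fun_cong[OF this, of 1], of 1] show "l (mu F) = 0"
    by (simp add: act_def B_def mu_def L_lin[OF l])
qed

lemma mult_map_cls:
  assumes F: "F \<in> carrier TF"
  shows "mult_map A (cls F) = pr (mu F)"
proof -
  interpret KI: ideal K TF by (rule K_ideal)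
  have "(\<Oplus>x\<in>Poly_Mapping.keys (k + F). fst x \<otimes> snd x) = pr (mu F)" if k: "k \<in> K" for k
  proof -
    have "k + F \<in> carrier TF" using TF_add_closed[OF KI.a_Hcarr[OF k] F] .
    moreover have "pr (mu (k + F)) = pr (mu F)"
      unfolding pr_eq_iff[of "mu (k + F)"] using mu_K[OF k] by (simp add: mu_add add.assoc)
    ultimately show ?thesis by (simp add: finsum_keys)
  qed
  moreover have "0 \<in> K" using additive_subgroup.zero_closed[OF ideal.axioms(1)[OF K_ideal]] by (simp add: tensor_free_simps)
  ultimately have "(\<lambda>f. \<Oplus>x\<in>Poly_Mapping.keys f. fst x \<otimes> snd x) ` cls F = {pr (mu F)}"
    unfolding cls_elements image_image by (auto intro: image_eqI[of _ _ 0])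
  then show ?thesis unfolding mult_map_def by simp
qed

text \<open>Each r \<otimes> s is (r \<otimes> 1 + 1 \<otimes> r)(1 \<otimes> s) + 1 \<otimes> rs.
  The last summands add up to 1 \<otimes> \<open>mu F\<close>, which acts as zero, and the first
  ones lower the level by \<open>killed_Dop\<close>.\<close>

lemma killed_act:
  assumes mu0: "pr (mu F) = \<zero>" and B: "B \<in> bforms" and k: "killed (Suc d) B"
  shows "killed d (act F B)"
proof -
  have bi: "biadd B" using B by (simp add: bforms_def)
  define C where "C x = pre 1 (rep (snd x)) (Dop (rep (fst x)) B)" for x
  have "killed d (C x)" for x
    unfolding C_def by (intro killed_pre killed_Dop bi k)
  then have "killed d (\<lambda>p q. lin (\<lambda>x. C x p q) F)" by (rule killed_lin)
  moreover have "act F B = (\<lambda>p q. lin (\<lambda>x. C x p q) F)"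
  proof (intro ext)
    fix p q
    have "pr (mu F * q) = \<zero>" using pr_mult_zero[OF mu0, of q] by (simp add: mult.commute)
    then have "B p (mu F * q) = 0" using B unfolding bforms_def by blast
    moreover have "B p (mu F * q) = lin (\<lambda>x. B p (rep (fst x) * rep (snd x) * q)) F"
      unfolding mu_def lin_def sum_distrib_right by (rule biadd_sum[OF bi])
    moreover have "lin (\<lambda>x. C x p q) F = act F B p q + lin (\<lambda>x. B p (rep (fst x) * rep (snd x) * q)) F"
      unfolding act_def lin_fun_add[symmetric] C_def pre_def Dop_def
      by (simp only: mult_1 mult.assoc)
    ultimately show "act F B p q = lin (\<lambda>x. C x p q) F" by simp
  qed
  ultimately show ?thesis by simp
qed

lemma foldr_TF_closed:
  "set Fs \<subseteq> carrier TF \<Longrightarrow> foldr (monoid.mult TF) Fs \<one>\<^bsub>TF\<^esub> \<in> carrier TF"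
  by (induction Fs) (auto simp: TF_mult_closed tensor_free_simps(2) TF_sgl_closed)

lemma foldr_cls:
  "set Fs \<subseteq> carrier TF \<Longrightarrow>
    foldr (monoid.mult (tensor A A)) (map cls Fs) \<one>\<^bsub>tensor A A\<^esub> = cls (foldr (monoid.mult TF) Fs \<one>\<^bsub>TF\<^esub>)"
proof (induction Fs)
  case Nil
  then show ?case by (simp add: tensor_def graded_quot_simps)
next
  case (Cons F Fs)
  then show ?case by (simp add: cls_mult foldr_TF_closed)
qed

lemma act_foldr:
  assumes "set Fs \<subseteq> carrier TF" "B \<in> bforms"
  shows "act (foldr (monoid.mult TF) Fs \<one>\<^bsub>TF\<^esub>) B = foldr act Fs B"
    and "foldr act Fs B \<in> bforms"
proof -
  have "foldr act Fs B \<in> bforms" for Fs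
    by (induction Fs) (simp_all add: assms(2) act_bforms)
  then show "foldr act Fs B \<in> bforms" .
  show "act (foldr (monoid.mult TF) Fs \<one>\<^bsub>TF\<^esub>) B = foldr act Fs B"
    using assms(1) by (induction Fs) (simp_all add: act_one act_mult foldr_TF_closed assms(2))
qed

lemma killed_foldr:
  assumes "\<And>F. F \<in> set Fs \<Longrightarrow> pr (mu F) = \<zero>" "set Fs \<subseteq> carrier TF" "B \<in> bforms" "killed (length Fs + e) B"
  shows "killed e (foldr act Fs B)"
  using assms
proof (induction Fs arbitrary: e)
  case (Cons F Fs)
  have "killed (Suc e) (foldr act Fs B)"
    using Cons.prems by (intro Cons.IH) auto
  then show ?case
    using Cons.prems by (simp add: killed_act act_foldr(2))
qed simp

lemma tensor_form: "l \<in> L \<Longrightarrow> m \<in> L \<Longrightarrow> (\<lambda>p q. l p * m q) \<in> bforms"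
proof -
  assume lm: "l \<in> L" "m \<in> L"
  have "biadd (\<lambda>p q. l p * m q)"
    by (rule biaddI) (simp_all only: L_add[OF lm(1)] L_add[OF lm(2)] distrib_left distrib_right)
  moreover have "l p = 0" "m p = 0" if "pr p = \<zero>" for p
    using that lm L_ker by blast+
  ultimately show ?thesis unfolding bforms_def by simp
qed

text \<open>Each zero divisor lowers the level by one, so d + 1 of them turn every product of two
  functionals into the zero form, and \<open>in_K_iff\<close> applies.\<close>

lemma zcl_le:
  assumes k: "\<And>l m. l \<in> L \<Longrightarrow> m \<in> L \<Longrightarrow> killed (Suc d) (\<lambda>p q. l p * m q)"
  shows "zcl A \<le> enat d"
  unfolding zcl_def
proof (rule Sup_least)
  fix x assume "x \<in> {enat (length zs) | zs. set zs \<subseteq> positive_zero_divisors A \<and>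
      foldr (monoid.mult (tensor A A)) zs \<one>\<^bsub>tensor A A\<^esub> \<noteq> \<zero>\<^bsub>tensor A A\<^esub>}"
  then obtain zs where zs: "x = enat (length zs)" "set zs \<subseteq> positive_zero_divisors A"
    "foldr (monoid.mult (tensor A A)) zs \<one>\<^bsub>tensor A A\<^esub> \<noteq> \<zero>\<^bsub>tensor A A\<^esub>" by blast
  have "\<exists>F\<in>carrier TF. z = cls F \<and> pr (mu F) = \<zero>" if "z \<in> set zs" for z
  proof -
    have z: "z \<in> carrier (tensor A A)" "mult_map A z = \<zero>"
      using zs(2) that unfolding positive_zero_divisors_def by auto
    then obtain F where "F \<in> carrier TF" "z = cls F" unfolding carrier_tensor by blast
    then show ?thesis using z(2) mult_map_cls by auto
  qed
  then obtain f where f: "\<And>z. z \<in> set zs \<Longrightarrow> f z \<in> carrier TF \<and> z = cls (f z) \<and> pr (mu (f z)) = \<zero>"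
    by metis
  define Fs where "Fs = map f zs"
  have Fs: "set Fs \<subseteq> carrier TF" "\<And>F. F \<in> set Fs \<Longrightarrow> pr (mu F) = \<zero>" "map cls Fs = zs"
    using f by (auto simp: Fs_def intro!: map_idI)
  let ?P = "foldr (monoid.mult TF) Fs \<one>\<^bsub>TF\<^esub>"
  have "length zs \<le> d"
  proof (rule ccontr)
    assume "\<not> length zs \<le> d"
    then have len: "Suc d \<le> length Fs + 0" by (simp add: Fs_def)
    have "act ?P (\<lambda>p q. l p * m q) 1 1 = 0" if lm: "l \<in> L" "m \<in> L" for l m
    proof -
      have "killed 0 (foldr act Fs (\<lambda>p q. l p * m q))"
        by (rule killed_foldr[OF Fs(2) Fs(1) tensor_form[OF lm] killed_mono[OF k[OF lm] len]])
      then have "DD 0 0 (foldr act Fs (\<lambda>p q. l p * m q)) = (\<lambda>p q. 0)"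
        unfolding killed_def by blast
      then have "foldr act Fs (\<lambda>p q. l p * m q) = (\<lambda>p q. 0)"
        by (simp only: DD_def funpow_0)
      then show ?thesis
        unfolding act_foldr(1)[OF Fs(1) tensor_form[OF lm]] by (rule fun_cong[OF fun_cong])
    qed
    then have "?P \<in> K" unfolding in_K_iff[OF foldr_TF_closed[OF Fs(1)]] by blast
    then have "cls ?P = \<zero>\<^bsub>tensor A A\<^esub>"
      unfolding cls_eq_zero_iff[OF foldr_TF_closed[OF Fs(1)]] .
    then show False using zs(3) foldr_cls[OF Fs(1)] Fs(3) by simp
  qed
  then show "x \<le> enat d" by (simp add: zs(1))
qed

definition zgen :: "bit poly poly \<Rightarrow> ('a \<times> 'a \<Rightarrow>\<^sub>0 bit)" where
  "zgen u = sgl (pr u, pr 1) + sgl (pr 1, pr u)"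

lemma zgen_carrier: "zgen u \<in> carrier TF"
  unfolding zgen_def by (intro TF_add_closed TF_sgl_closed pr_closed)

lemma act_zgen: "B \<in> bforms \<Longrightarrow> act (zgen u) B = Dop u B"
  unfolding zgen_def by (simp add: act_add act_sgl_pr pre_def Dop_def)

lemma zgen_positive:
  assumes "u \<in> bhom k" "k > 0"
  shows "cls (zgen u) \<in> positive_zero_divisors A"
proof -
  have "pr (mu (zgen u)) = pr (mu (sgl (pr u, pr 1))) \<oplus> pr (mu (sgl (pr 1, pr u)))"
    unfolding zgen_def mu_add pr_add ..
  also have "\<dots> = pr (u + u)" unfolding mu_pr_sgl by (simp only: mult_1 mult_1_right pr_add)
  finally have "mult_map A (cls (zgen u)) = \<zero>"
    by (simp add: mult_map_cls zgen_carrier pr_zero)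
  moreover have "zgen u \<in> grade TF k"
  proof -
    have g: "pr u \<in> grade A k" "pr 1 \<in> grade A 0"
      using assms one_bhom by (auto simp: grade_eq)
    have "Poly_Mapping.keys (zgen u) \<subseteq> {(pr u, pr 1), (pr 1, pr u)}"
      unfolding zgen_def by (rule order_trans[OF keys_add]) simp
    also have "\<dots> \<subseteq> (\<Union>i\<le>k. grade A i \<times> grade A (k - i))"
      using g by (auto intro: bexI[of _ k] bexI[of _ 0])
    finally show ?thesis by (simp add: tensor_free_simps)
  qed
  then have "cls (zgen u) \<in> grade (tensor A A) k"
    unfolding tensor_def graded_quot_simps by blast
  moreover have "cls (zgen u) \<in> carrier (tensor A A)"
    unfolding carrier_tensor using zgen_carrier by blast
  ultimately show ?thesis
    unfolding positive_zero_divisors_def using assms(2) by blast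
qed

lemma foldr_act_zgen:
  assumes "B \<in> bforms"
  shows "foldr act (replicate a (zgen u)) B = (Dop u ^^ a) B" and "(Dop u ^^ a) B \<in> bforms"
proof -
  have "foldr act (replicate a (zgen u)) B = (Dop u ^^ a) B \<and> (Dop u ^^ a) B \<in> bforms"
  proof (induction a)
    case (Suc a)
    then show ?case using act_zgen act_bforms by (metis foldr.simps(2) comp_apply replicate_Suc funpow.simps(2))
  qed (simp add: assms)
  then show "foldr act (replicate a (zgen u)) B = (Dop u ^^ a) B" "(Dop u ^^ a) B \<in> bforms" by auto
qed

lemma zcl_ge:
  assumes B: "B \<in> bforms" and nz: "DD a b B p q \<noteq> 0"
  shows "enat (a + b) \<le> zcl A"
proof -
  define Fs where "Fs = replicate a (zgen w2) @ replicate b (zgen w3)"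
  have Fs: "set Fs \<subseteq> carrier TF" using zgen_carrier by (auto simp: Fs_def)
  let ?P = "foldr (monoid.mult TF) Fs \<one>\<^bsub>TF\<^esub>"
  have "foldr act Fs B = DD a b B"
    unfolding Fs_def DD_def foldr_append foldr_act_zgen(1)[OF B]
    by (rule foldr_act_zgen(1)[OF foldr_act_zgen(2)[OF B]])
  then have "act ?P B p q \<noteq> 0" using nz act_foldr(1)[OF Fs B] by simp
  then have "?P \<notin> null" using B unfolding null_def by (auto simp: fun_eq_iff)
  then have "?P \<notin> K" using K_null by blast
  then have "cls ?P \<noteq> \<zero>\<^bsub>tensor A A\<^esub>"
    by (simp add: cls_eq_zero_iff foldr_TF_closed[OF Fs])
  then have "foldr (monoid.mult (tensor A A)) (map cls Fs) \<one>\<^bsub>tensor A A\<^esub> \<noteq> \<zero>\<^bsub>tensor A A\<^esub>"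
    by (simp add: foldr_cls[OF Fs])
  moreover have "set (map cls Fs) \<subseteq> positive_zero_divisors A"
    unfolding Fs_def using zgen_positive[OF w2_bhom] zgen_positive[OF w3_bhom] by auto
  moreover have "length (map cls Fs) = a + b" by (simp add: Fs_def)
  ultimately show ?thesis
    unfolding zcl_def by (intro Sup_upper) (metis (mono_tags, lifting) mem_Collect_eq)
qed

end

section \<open>Pairings and binomial coefficients modulo 2\<close>

lemma binomial_parity_double:
  "(even ((2 * m) choose (2 * j)) \<longleftrightarrow> even (m choose j)) \<and> even ((2 * m) choose (2 * j + 1)) \<and>
   (even ((2 * m + 1) choose (2 * j)) \<longleftrightarrow> even (m choose j)) \<and>
   (even ((2 * m + 1) choose (2 * j + 1)) \<longleftrightarrow> even (m choose j))"
proof (induction m arbitrary: j)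
  case 0
  show ?case by (cases j) auto
next
  case (Suc m)
  note IH = Suc.IH
  have A: "even ((2 * m + 2) choose (2 * i)) \<longleftrightarrow> even (Suc m choose i)" for i
  proof (cases i)
    case (Suc i')
    have "(2 * m + 2) choose (2 * i) = ((2 * m + 1) choose (2 * i' + 1)) + ((2 * m + 1) choose (2 * i))"
      by (simp add: Suc)
    then show ?thesis using IH[of i'] IH[of i] by (simp add: Suc)
  qed simp
  have B: "even ((2 * m + 2) choose (2 * i + 1))" for i
  proof -
    have "(2 * m + 2) choose (2 * i + 1) = ((2 * m + 1) choose (2 * i)) + ((2 * m + 1) choose (2 * i + 1))"
      by simp
    then show ?thesis using IH[of i] by simp
  qed
  have C: "even ((2 * m + 3) choose (2 * j)) \<longleftrightarrow> even (Suc m choose j)"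
  proof (cases j)
    case (Suc i)
    have "(2 * m + 3) choose (2 * j) = ((2 * m + 2) choose (2 * i + 1)) + ((2 * m + 2) choose (2 * j))"
      by (simp add: Suc numeral_3_eq_3)
    then show ?thesis using A[of j] B[of i] by (simp only: even_add simp_thms)
  qed simp
  have "(2 * m + 3) choose (2 * j + 1) = ((2 * m + 2) choose (2 * j)) + ((2 * m + 2) choose (2 * j + 1))"
    by (simp add: numeral_3_eq_3)
  then have D: "even ((2 * m + 3) choose (2 * j + 1)) \<longleftrightarrow> even (Suc m choose j)"
    using A[of j] B[of j] by (simp only: even_add simp_thms)
  have "2 * Suc m = 2 * m + 2" "2 * Suc m + 1 = 2 * m + 3" by simp_all
  then show ?case using A[of j] B[of j] C D by (simp only: simp_thms)
qed

lemma odd_binomial_div_mod_2: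
  "odd (n choose k) \<longleftrightarrow> odd ((n mod 2) choose (k mod 2)) \<and> odd ((n div 2) choose (k div 2))"
proof -
  note P = binomial_parity_double[of "n div 2" "k div 2"]
  have n: "n = 2 * (n div 2) \<or> n = 2 * (n div 2) + 1" and k: "k = 2 * (k div 2) \<or> k = 2 * (k div 2) + 1"
    by presburger+
  consider "n mod 2 = 0" "k mod 2 = 0" | "n mod 2 = 0" "k mod 2 = 1" | "n mod 2 = 1" "k mod 2 = 0"
    | "n mod 2 = 1" "k mod 2 = 1" by (metis mod2_eq_if)
  then show ?thesis
  proof cases
    case 1
    then have "n = 2 * (n div 2)" "k = 2 * (k div 2)" by presburger+
    then show ?thesis using P 1 by (metis binomial_n_0 odd_one)
  next
    case 2
    then have "n = 2 * (n div 2)" "k = 2 * (k div 2) + 1" by presburger+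
    then have "even (n choose k)" using P by metis
    then show ?thesis using 2 by simp
  next
    case 3
    then have "n = 2 * (n div 2) + 1" "k = 2 * (k div 2)" by presburger+
    then show ?thesis using P 3 by (metis binomial_n_0 odd_one)
  next
    case 4
    then have "n = 2 * (n div 2) + 1" "k = 2 * (k div 2) + 1" by presburger+
    then have "odd (n choose k) \<longleftrightarrow> odd ((n div 2) choose (k div 2))" using P by metis
    then show ?thesis using 4 by simp
  qed
qed

text \<open>Lucas' theorem for the block of the last \<open>e\<close> binary digits and the block of
  the others.\<close>

lemma odd_binomial_div_mod:
  "odd (n choose k) \<longleftrightarrow> odd ((n mod 2 ^ e) choose (k mod 2 ^ e)) \<and> odd ((n div 2 ^ e) choose (k div 2 ^ e))"
proof (induction e arbitrary: n k)
  case (Suc e)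
  have "n mod 2 ^ Suc e mod 2 = n mod 2" "n mod 2 ^ Suc e div 2 = n div 2 mod 2 ^ e"
    "n div 2 ^ Suc e = n div 2 div 2 ^ e" for n :: nat
    by (simp_all add: mod_mod_cancel div_mult2_eq mod_mult2_eq)
  then show ?case
    using odd_binomial_div_mod_2[of n k] odd_binomial_div_mod_2[of "n mod 2 ^ Suc e" "k mod 2 ^ Suc e"]
      Suc.IH[of "n div 2" "k div 2"] by metis
qed simp

text \<open>Digitwise domination on the last \<open>e\<close> digits implies this inequality, the
  form in which the upper bounds exclude odd coefficients.\<close>

lemma odd_binomial_mod_le: "odd (n choose k) \<Longrightarrow> k mod 2 ^ e \<le> n mod 2 ^ e"
  using odd_binomial_div_mod[of n k e] by (metis binomial_eq_0 even_zero not_le)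

text \<open>All binary digits of 2^e - 1 are ones, so every k < 2^e is dominated.\<close>

lemma odd_binomial_full: "k < 2 ^ e \<Longrightarrow> odd ((2 ^ e - 1) choose k)"
proof (induction e arbitrary: k)
  case (Suc e)
  have "(1::nat) \<le> 2 ^ e" by simp
  moreover have "(2::nat) ^ Suc e = 2 * 2 ^ e" by simp
  ultimately have "2 ^ Suc e - 1 = 2 * (2 ^ e - 1) + (1::nat)" by linarith
  moreover have "k div 2 < 2 ^ e" using Suc.prems by simp
  ultimately have "(2 ^ Suc e - 1) mod 2 = (1::nat)" "(2 ^ Suc e - 1) div 2 = 2 ^ e - (1::nat)"
    by presburger+
  moreover have "k mod 2 = 0 \<or> k mod 2 = 1" by presburger
  ultimately show ?case
    unfolding odd_binomial_div_mod_2[of "2 ^ Suc e - 1" k]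
    using Suc.IH[of "k div 2"] \<open>k div 2 < 2 ^ e\<close> by auto
qed simp

lemma of_nat_bit: "(of_nat n :: bit) = of_bool (odd n)"
  by (induction n) (auto simp: of_bool_def)

section \<open>Expansion of products of zero divisors\<close>

lemma pascal_sum:
  fixes F :: "nat \<Rightarrow> 'b::comm_semiring_1"
  shows "(\<Sum>i\<le>Suc a. of_nat (Suc a choose i) * F i) =
    (\<Sum>i\<le>a. of_nat (a choose i) * F (Suc i)) + (\<Sum>i\<le>a. of_nat (a choose i) * F i)"
proof -
  have "(\<Sum>i\<le>Suc a. of_nat (Suc a choose i) * F i) =
      F 0 + (\<Sum>i\<le>a. of_nat (a choose i) * F (Suc i) + of_nat (a choose Suc i) * F (Suc i))"
    by (subst sum.atMost_Suc_shift) (simp add: algebra_simps)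
  also have "\<dots> = (\<Sum>i\<le>a. of_nat (a choose i) * F (Suc i)) + (F 0 + (\<Sum>i\<le>a. of_nat (a choose Suc i) * F (Suc i)))"
    by (simp add: sum.distrib ac_simps)
  also have "F 0 + (\<Sum>i\<le>a. of_nat (a choose Suc i) * F (Suc i)) = (\<Sum>i\<le>Suc a. of_nat (a choose i) * F i)"
    by (subst sum.atMost_Suc_shift) simp
  also have "\<dots> = (\<Sum>i\<le>a. of_nat (a choose i) * F i)" by (simp add: binomial_eq_0)
  finally show ?thesis .
qed

lemma Dop_pow_eq:
  "(Dop u ^^ a) B p q = (\<Sum>i\<le>a. of_nat (a choose i) * B (u ^ i * p) (u ^ (a - i) * q))"
proof (induction a arbitrary: p q)
  case (Suc a)
  have "(Dop u ^^ Suc a) B p q = (\<Sum>i\<le>a. of_nat (a choose i) * B (u ^ i * (u * p)) (u ^ (a - i) * q))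
      + (\<Sum>i\<le>a. of_nat (a choose i) * B (u ^ i * p) (u ^ (a - i) * (u * q)))"
    by (simp add: Dop_def Suc)
  also have "(\<Sum>i\<le>a. of_nat (a choose i) * B (u ^ i * (u * p)) (u ^ (a - i) * q)) =
      (\<Sum>i\<le>a. of_nat (a choose i) * B (u ^ Suc i * p) (u ^ (Suc a - Suc i) * q))"
    by (simp only: power_Suc2 mult.assoc diff_Suc_Suc)
  also have "(\<Sum>i\<le>a. of_nat (a choose i) * B (u ^ i * p) (u ^ (a - i) * (u * q))) =
      (\<Sum>i\<le>a. of_nat (a choose i) * B (u ^ i * p) (u ^ (Suc a - i) * q))"
    by (intro sum.cong refl) (simp only: atMost_iff Suc_diff_le power_Suc2 mult.assoc)
  finally show ?case
    unfolding pascal_sum[of a "\<lambda>i. B (u ^ i * p) (u ^ (Suc a - i) * q)"] .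
qed simp

lemma DD_eq:
  "DD a b B p q = (\<Sum>i\<le>a. \<Sum>j\<le>b. of_nat (a choose i) * of_nat (b choose j) *
     B (w2 ^ i * w3 ^ j * p) (w2 ^ (a - i) * w3 ^ (b - j) * q))"
  unfolding DD_def Dop_pow_eq by (simp add: sum_distrib_left mult.assoc mult.left_commute)

text \<open>Frobenius: the 2^k-th power of u \<otimes> 1 + 1 \<otimes> u is u^(2^k) \<otimes> 1 + 1
  \<otimes> u^(2^k).\<close>

lemma Dop_pow_two_power:
  assumes "biadd B"
  shows "(Dop u ^^ (2 ^ k)) B = Dop (u ^ 2 ^ k) B"
  using assms
proof (induction k arbitrary: B)
  case (Suc k)
  have "(Dop u ^^ (2 ^ Suc k)) B = (Dop u ^^ (2 ^ k)) ((Dop u ^^ (2 ^ k)) B)"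
    by (simp add: mult_2 funpow_add)
  also have "\<dots> = Dop (u ^ 2 ^ k) (Dop (u ^ 2 ^ k) B)"
    using Suc by (simp add: biadd_Dop)
  also have "\<dots> = Dop (u ^ 2 ^ Suc k) B"
    by (intro ext) (simp add: Dop_def power_add mult_2 ac_simps)
  finally show ?case .
qed simp

lemma Dop_pow_vanish:
  assumes B: "biadd B" and z: "Dop (u ^ 2 ^ k) B = (\<lambda>p q. 0)" and a: "2 ^ k \<le> a"
  shows "(Dop u ^^ a) B = (\<lambda>p q. 0)"
proof -
  have "(Dop u ^^ a) B = (Dop u ^^ (a - 2 ^ k)) ((Dop u ^^ (2 ^ k)) B)"
    using funpow_add[of "a - 2 ^ k" "2 ^ k" "Dop u"] a by simp
  then show ?thesis by (simp add: Dop_pow_two_power[OF B] z Dop_pow_zero)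
qed

definition phm :: "nat \<Rightarrow> nat \<Rightarrow> bit poly poly \<Rightarrow> bit" where
  "phm T m p = phi T (w3 ^ m * p)"

definition pform :: "nat \<Rightarrow> nat \<Rightarrow> nat \<Rightarrow> nat \<Rightarrow> bform" where
  "pform T m T' m' = (\<lambda>p q. phm T m p * phm T' m' q)"

lemma phm_add: "phm T m (p + q) = phm T m p + phm T m q"
  by (simp add: phm_def distrib_left)

lemma biadd_pform: "biadd (pform T m T' m')"
  unfolding pform_def by (rule biaddI) (simp_all only: phm_add distrib_left distrib_right)

lemma phm_shift: "phm T (m + d) p = phm T m (w3 ^ d * p)"
  by (simp add: phm_def power_add mult.assoc)

lemma phi_monomial:
  "phi T (w2 ^ i * w3 ^ j) = (\<Sum>k<T - 1. of_bool (i = 2 ^ T - 1 - 3 * 2 ^ k \<and> j = 2 ^ (k + 1) - 2))"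
  unfolding phi_def cf_monomial by (intro sum.cong refl) (auto simp: of_bool_def)

lemma phm_monomial:
  "phm T m (w2 ^ i * w3 ^ j) = (\<Sum>k<T - 1. of_bool (i = 2 ^ T - 1 - 3 * 2 ^ k) * of_bool (j + m = 2 ^ (k + 1) - 2))"
proof -
  have "w3 ^ m * (w2 ^ i * w3 ^ j) = w2 ^ i * w3 ^ (j + m)" by (simp add: power_add ac_simps)
  then show ?thesis unfolding phm_def by (simp only: phi_monomial of_bool_conj)
qed

lemma delta_binomial_w2:
  "(\<Sum>i\<le>a. of_nat (a choose i) * (of_bool (i = I) * of_bool (a - i + c = I'))) =
    (of_bool (a + c = I + I' \<and> odd (a choose I)) :: bit)"
proof -
  have "(\<Sum>i\<le>a. of_nat (a choose i) * (of_bool (i = I) * of_bool (a - i + c = I'))) =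
      (\<Sum>i\<le>a. if i = I then of_nat (a choose I) * of_bool (a - I + c = I') else (0::bit))"
    by (intro sum.cong) auto
  also have "\<dots> = (if I \<le> a then of_nat (a choose I) * of_bool (a - I + c = I') else 0)"
    by (subst sum.delta) auto
  also have "\<dots> = of_bool (a + c = I + I' \<and> odd (a choose I))"
    by (auto simp: of_nat_bit of_bool_def not_le binomial_eq_0)
  finally show ?thesis .
qed

lemma delta_binomial_w3:
  "(\<Sum>j\<le>b. of_nat (b choose j) * (of_bool (j + m = J) * of_bool (b - j + e + m' = J'))) =
    (of_bool (m \<le> J \<and> b + e + m + m' = J + J' \<and> odd (b choose (J - m))) :: bit)"
proof (cases "m \<le> J")
  case True
  have "(\<Sum>j\<le>b. of_nat (b choose j) * (of_bool (j + m = J) * of_bool (b - j + e + m' = J'))) =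
      (\<Sum>j\<le>b. if j = J - m then of_nat (b choose (J - m)) * of_bool (b - (J - m) + e + m' = J') else (0::bit))"
    using True by (intro sum.cong) auto
  also have "\<dots> = (if J - m \<le> b then of_nat (b choose (J - m)) * of_bool (b - (J - m) + e + m' = J') else 0)"
    by (subst sum.delta) auto
  also have "\<dots> = of_bool (b + e + m + m' = J + J' \<and> odd (b choose (J - m)))"
    using True by (auto simp: of_nat_bit of_bool_def not_le binomial_eq_0)
  finally show ?thesis using True by simp
next
  case False
  then show ?thesis by (auto intro!: sum.neutral)
qed

text \<open>The \<open>k\<close>-th monomial of the first and the \<open>l\<close>-th monomial of the second functional meet in the expansion of
  \<open>z\<^sub>2\<^sup>a z\<^sub>3\<^sup>b (1 \<otimes> w\<^sub>2\<^sup>c w\<^sub>3\<^sup>e)\<close>, with an odd coefficient. The two equations compare the exponents of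
  \<open>w\<^sub>2\<close> and \<open>w\<^sub>3\<close>, with all subtractions moved to the other side.\<close>

definition tm :: "nat \<Rightarrow> nat \<Rightarrow> nat \<Rightarrow> nat \<Rightarrow> nat \<Rightarrow> nat \<Rightarrow> nat \<Rightarrow> nat \<Rightarrow> nat \<Rightarrow> nat \<Rightarrow> bool" where
  "tm T m T' m' a b c e k l \<longleftrightarrow>
     a + c + 3 * 2 ^ k + 3 * 2 ^ l + 2 = 2 ^ T + 2 ^ T' \<and>
     b + e + m + m' + 4 = 2 * 2 ^ k + 2 * 2 ^ l \<and>
     m + 2 \<le> 2 * 2 ^ k \<and> odd (a choose (2 ^ T - 1 - 3 * 2 ^ k)) \<and> odd (b choose (2 * 2 ^ k - 2 - m))"

text \<open>The odd binomial gives b \<ge> 2 * 2^k - 2 - m, and the equation for \<open>w3\<close>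
  then leaves the room for m'. Thus both functionals satisfy the same truncation condition.\<close>

lemma tm_snd: "tm T m T' m' a b c e k l \<Longrightarrow> m' + 2 \<le> 2 * 2 ^ l"
proof -
  assume *: "tm T m T' m' a b c e k l"
  then have "\<not> b < 2 * 2 ^ k - 2 - m"
    unfolding tm_def using binomial_eq_0[of b "2 * 2 ^ k - 2 - m"] by (metis even_zero)
  then show ?thesis using * unfolding tm_def by linarith
qed

text \<open>For fixed \<open>k\<close> and \<open>l\<close> the double sum over the binomial
  expansion factors into a \<open>w2\<close> part and a \<open>w3\<close> part, and in each at most
  one index hits the prescribed exponent.\<close>

theorem DD_pform:
  "DD a b (pform T m T' m') 1 (w2 ^ c * w3 ^ e) =
     (\<Sum>k<T - 1. \<Sum>l<T' - 1. of_bool (tm T m T' m' a b c e k l))"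
proof -
  define I :: "nat \<Rightarrow> nat" where "I k = 2 ^ T - 1 - 3 * 2 ^ k" for k
  define I' :: "nat \<Rightarrow> nat" where "I' k = 2 ^ T' - 1 - 3 * 2 ^ k" for k
  define J :: "nat \<Rightarrow> nat" where "J k = 2 ^ (k + 1) - 2" for k
  define X where "X k l i = (of_nat (a choose i) * (of_bool (i = I k) * of_bool (a - i + c = I' l)) :: bit)" for k l i
  define Y where "Y k l j = (of_nat (b choose j) * (of_bool (j + m = J k) * of_bool (b - j + e + m' = J l)) :: bit)" for k l j
  have t: "of_nat (a choose i) * of_nat (b choose j) *
      pform T m T' m' (w2 ^ i * w3 ^ j * 1) (w2 ^ (a - i) * w3 ^ (b - j) * (w2 ^ c * w3 ^ e))
      = (\<Sum>k<T - 1. \<Sum>l<T' - 1. X k l i * Y k l j)" for i j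
  proof -
    have *: "w2 ^ (a - i) * w3 ^ (b - j) * (w2 ^ c * w3 ^ e) = w2 ^ (a - i + c) * w3 ^ (b - j + e)"
      by (simp add: power_add ac_simps)
    have "of_nat (a choose i) * of_nat (b choose j) * pform T m T' m' (w2 ^ i * w3 ^ j * 1)
        (w2 ^ (a - i) * w3 ^ (b - j) * (w2 ^ c * w3 ^ e)) =
      of_nat (a choose i) * of_nat (b choose j) *
        ((\<Sum>k<T - 1. of_bool (i = I k) * of_bool (j + m = J k)) *
         (\<Sum>l<T' - 1. of_bool (a - i + c = I' l) * of_bool (b - j + e + m' = J l)))"
      unfolding * pform_def mult_1_right phm_monomial I_def I'_def J_def ..
    also have "\<dots> = (\<Sum>k<T - 1. \<Sum>l<T' - 1. X k l i * Y k l j)"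
      unfolding sum_product[of "\<lambda>k. of_bool (i = I k) * of_bool (j + m = J k)"]
      unfolding sum_distrib_left X_def Y_def
      by (intro sum.cong refl) (simp only: mult.assoc mult.commute mult.left_commute)
    finally show ?thesis .
  qed
  have "DD a b (pform T m T' m') 1 (w2 ^ c * w3 ^ e) = (\<Sum>i\<le>a. \<Sum>j\<le>b. \<Sum>k<T - 1. \<Sum>l<T' - 1. X k l i * Y k l j)"
    unfolding DD_eq t ..
  also have "\<dots> = (\<Sum>i\<le>a. \<Sum>k<T - 1. \<Sum>j\<le>b. \<Sum>l<T' - 1. X k l i * Y k l j)"
    by (intro sum.cong refl sum.swap)
  also have "\<dots> = (\<Sum>k<T - 1. \<Sum>i\<le>a. \<Sum>j\<le>b. \<Sum>l<T' - 1. X k l i * Y k l j)"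
    by (rule sum.swap)
  also have "\<dots> = (\<Sum>k<T - 1. \<Sum>i\<le>a. \<Sum>l<T' - 1. \<Sum>j\<le>b. X k l i * Y k l j)"
    by (intro sum.cong refl sum.swap)
  also have "\<dots> = (\<Sum>k<T - 1. \<Sum>l<T' - 1. \<Sum>i\<le>a. \<Sum>j\<le>b. X k l i * Y k l j)"
    by (intro sum.cong refl sum.swap)
  also have "\<dots> = (\<Sum>k<T - 1. \<Sum>l<T' - 1. of_bool (tm T m T' m' a b c e k l))"
  proof (intro sum.cong refl)
    fix k l assume k: "k \<in> {..<T - 1}" and l: "l \<in> {..<T' - 1}"
    have b: "3 * 2 ^ k + 1 \<le> (2::nat) ^ T" "3 * 2 ^ l + 1 \<le> (2::nat) ^ T'"
      using k l phi_index_bound by auto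
    have p: "(1::nat) \<le> 2 ^ k" "(1::nat) \<le> 2 ^ l" by simp_all
    have "(\<Sum>i\<le>a. \<Sum>j\<le>b. X k l i * Y k l j) = (\<Sum>i\<le>a. X k l i) * (\<Sum>j\<le>b. Y k l j)"
      by (simp only: sum_product)
    also have "\<dots> = of_bool ((a + c = I k + I' l \<and> odd (a choose I k)) \<and>
        (m \<le> J k \<and> b + e + m + m' = J k + J l \<and> odd (b choose (J k - m))))"
      unfolding X_def Y_def delta_binomial_w2 delta_binomial_w3 of_bool_conj ..
    also have "(a + c = I k + I' l \<and> odd (a choose I k)) \<and>
        (m \<le> J k \<and> b + e + m + m' = J k + J l \<and> odd (b choose (J k - m))) \<longleftrightarrow> tm T m T' m' a b c e k l"
    proof -
      have "a + c = I k + I' l \<longleftrightarrow> a + c + 3 * 2 ^ k + 3 * 2 ^ l + 2 = 2 ^ T + 2 ^ T'"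
        unfolding I_def I'_def using b by linarith
      moreover have J: "J k = 2 * 2 ^ k - 2" "J l = 2 * 2 ^ l - 2" by (simp_all add: J_def)
      moreover have "m \<le> 2 * 2 ^ k - 2 \<longleftrightarrow> m + 2 \<le> 2 * 2 ^ k" using p by linarith
      moreover have "b + e + m + m' = (2 * 2 ^ k - 2) + (2 * 2 ^ l - 2) \<longleftrightarrow> b + e + m + m' + 4 = 2 * 2 ^ k + 2 * 2 ^ l"
        using p by linarith
      ultimately show ?thesis unfolding tm_def J I_def by blast
    qed
    finally show "(\<Sum>i\<le>a. \<Sum>j\<le>b. X k l i * Y k l j) = of_bool (tm T m T' m' a b c e k l)" .
  qed
  finally show ?thesis .
qed

section \<open>Frobenius bounds for the exponents\<close>

lemma cf_w2_power: "i < n \<Longrightarrow> cf (w2 ^ n * f) i j = 0"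
proof (induction n arbitrary: i)
  case (Suc n)
  then show ?case by (simp add: mult.assoc split: nat.split)
qed simp

lemma cf_w3_power: "cf (w3 ^ n * f) i j = (if j < n then 0 else cf f i (j - n))"
proof (induction n arbitrary: j)
  case (Suc n)
  then show ?case by (auto simp: mult.assoc split: nat.split)
qed simp

lemma phm_w2_vanish:
  assumes "\<And>k. k < T - 1 \<Longrightarrow> m + 2 \<le> 2 * 2 ^ k \<Longrightarrow> 2 ^ T - 1 - 3 * 2 ^ k < n"
  shows "phm T m (w2 ^ n * p) = 0"
  unfolding phm_def phi_def cf_w3_power
proof (intro sum.neutral ballI)
  fix k assume "k \<in> {..<T - 1}"
  then have "m + 2 \<le> 2 * 2 ^ k \<Longrightarrow> 2 ^ T - 1 - 3 * 2 ^ k < n" using assms by simp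
  moreover have "\<not> m + 2 \<le> 2 * 2 ^ k \<Longrightarrow> 2 ^ (k + 1) - 2 < m"
  proof -
    have "(2::nat) ^ (k + 1) = 2 * 2 ^ k" "(1::nat) \<le> 2 ^ k" by simp_all
    then show "\<not> m + 2 \<le> 2 * 2 ^ k \<Longrightarrow> 2 ^ (k + 1) - 2 < m" by linarith
  qed
  ultimately show "(if 2 ^ (k + 1) - 2 < m then 0 else cf (w2 ^ n * p) (2 ^ T - 1 - 3 * 2 ^ k) (2 ^ (k + 1) - 2 - m)) = 0"
    using cf_w2_power by (metis (full_types))
qed

lemma phm_w3_vanish:
  assumes "2 ^ (T - 1) < n + m + 2"
  shows "phm T m (w3 ^ n * p) = 0"
proof -
  have "phm T m (w3 ^ n * p) = phi T (w3 ^ (m + n) * p)"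
    by (simp add: phm_def power_add mult.assoc)
  also have "\<dots> = 0"
    unfolding phi_def cf_w3_power
  proof (intro sum.neutral ballI)
    fix k assume "k \<in> {..<T - 1}"
    then have "k + 1 \<le> T - 1" by simp
    then have "(2::nat) ^ (k + 1) \<le> 2 ^ (T - 1)" by (rule power_increasing) simp
    moreover have "(2::nat) \<le> 2 ^ (k + 1)" by simp
    ultimately have "2 ^ (k + 1) - 2 < m + n" using assms by linarith
    then show "(if 2 ^ (k + 1) - 2 < m + n then 0 else cf p (2 ^ T - 1 - 3 * 2 ^ k) (2 ^ (k + 1) - 2 - (m + n))) = 0"
      by simp
  qed
  finally show ?thesis .
qed

text \<open>If both functionals vanish on multiples of w2^(2^X) and w3^(2^Y), the Frobenius formula
  kills all a \<ge> 2^X and b \<ge> 2^Y, so a finite box of exponents remains to be checked.\<close>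

theorem killed_pform:
  assumes w2: "\<And>k. k < T - 1 \<Longrightarrow> m + 2 \<le> 2 * 2 ^ k \<Longrightarrow> 2 ^ T - 1 - 3 * 2 ^ k < (2::nat) ^ X"
    "\<And>k. k < T' - 1 \<Longrightarrow> m' + 2 \<le> 2 * 2 ^ k \<Longrightarrow> 2 ^ T' - 1 - 3 * 2 ^ k < (2::nat) ^ X"
    and w3: "2 ^ (T - 1) < 2 ^ Y + m + 2" "2 ^ (T' - 1) < 2 ^ Y + m' + 2"
    and z: "\<And>a b c e. a + b \<ge> d \<Longrightarrow> a < 2 ^ X \<Longrightarrow> b < 2 ^ Y \<Longrightarrow>
      (\<Sum>k<T - 1. \<Sum>l<T' - 1. of_bool (tm T m T' m' a b c e k l)) = (0::bit)"
  shows "killed d (pform T m T' m')"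
proof (rule killedI[OF biadd_pform])
  fix a b c e assume ab: "d \<le> a + b"
  have D2: "Dop (w2 ^ 2 ^ X) (pform T m T' m') = (\<lambda>p q. 0)"
    by (intro ext) (simp add: Dop_def pform_def phm_w2_vanish[OF w2(1)] phm_w2_vanish[OF w2(2)])
  have D3: "Dop (w3 ^ 2 ^ Y) (pform T m T' m') = (\<lambda>p q. 0)"
    by (intro ext) (simp add: Dop_def pform_def phm_w3_vanish[OF w3(1)] phm_w3_vanish[OF w3(2)])
  consider "a \<ge> 2 ^ X" | "b \<ge> 2 ^ Y" | "a < 2 ^ X" "b < 2 ^ Y" by linarith
  then show "DD a b (pform T m T' m') 1 (w2 ^ c * w3 ^ e) = 0"
  proof cases
    case 1
    have "DD a b (pform T m T' m') = (Dop w3 ^^ b) ((Dop w2 ^^ a) (pform T m T' m'))"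
      unfolding DD_def by (induction b) (simp_all add: Dop_pow_commute)
    then show ?thesis using Dop_pow_vanish[OF biadd_pform D2 1] by (simp add: Dop_pow_zero)
  next
    case 2
    then show ?thesis unfolding DD_def using Dop_pow_vanish[OF biadd_pform D3 2] by (simp add: Dop_pow_zero)
  next
    case 3
    then show ?thesis unfolding DD_pform using z[OF ab] by simp
  qed
qed

text \<open>In characteristic 2 the entries at (k, l) and (l, k) cancel.\<close>

lemma sum_square_symmetric:
  fixes F :: "nat \<Rightarrow> nat \<Rightarrow> bool"
  assumes "\<And>k l. k < n \<Longrightarrow> l < n \<Longrightarrow> F k l \<Longrightarrow> F l k" "\<And>k. k < n \<Longrightarrow> \<not> F k k"
  shows "(\<Sum>k<n. \<Sum>l<n. of_bool (F k l)) = (0::bit)"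
  using assms
proof (induction n)
  case (Suc n)
  have "(\<Sum>k<Suc n. \<Sum>l<Suc n. of_bool (F k l)) =
      (\<Sum>k<n. \<Sum>l<n. of_bool (F k l)) + (\<Sum>k<n. of_bool (F k n)) + (\<Sum>l<n. of_bool (F n l)) + (of_bool (F n n) :: bit)"
    by (simp add: sum.distrib add.assoc)
  also have "(\<Sum>k<n. \<Sum>l<n. of_bool (F k l)) = (0::bit)"
  proof (rule Suc.IH)
    show "F l k" if "k < n" "l < n" "F k l" for k l using Suc.prems(1)[of k l] that by simp
    show "\<not> F k k" if "k < n" for k using Suc.prems(2)[of k] that by simp
  qed
  also have "(\<Sum>k<n. of_bool (F k n)) = (\<Sum>l<n. of_bool (F n l) :: bit)"
  proof (intro sum.cong refl)
    fix k assume "k \<in> {..<n}"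
    then have "F k n \<longleftrightarrow> F n k" using Suc.prems(1)[of k n] Suc.prems(1)[of n k] by auto
    then show "(of_bool (F k n) :: bit) = of_bool (F n k)" by simp
  qed
  moreover have "F n n = False" using Suc.prems(2)[of n] by simp
  ultimately show ?case by (simp only: of_bool_eq(1) add_0_left add_0_right bit_add_self)
qed simp

lemma sum_square_single:
  fixes F :: "nat \<Rightarrow> nat \<Rightarrow> bool"
  assumes "k0 < n" "l0 < n'" "F k0 l0" "\<And>k l. k < n \<Longrightarrow> l < n' \<Longrightarrow> F k l \<Longrightarrow> k = k0 \<and> l = l0"
  shows "(\<Sum>k<n. \<Sum>l<n'. of_bool (F k l)) = (1::bit)"
proof -
  have "(\<Sum>k<n. \<Sum>l<n'. of_bool (F k l)) = (\<Sum>k<n. if k = k0 then 1 else (0::bit))"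
  proof (intro sum.cong refl)
    fix k assume k: "k \<in> {..<n}"
    have "(\<Sum>l<n'. of_bool (F k l)) = (\<Sum>l<n'. if l = l0 then of_bool (k = k0) else (0::bit))"
    proof (intro sum.cong refl)
      fix l assume "l \<in> {..<n'}"
      then have "F k l \<longleftrightarrow> k = k0 \<and> l = l0" using assms(3) assms(4)[of k l] k by auto
      then show "(of_bool (F k l) :: bit) = (if l = l0 then of_bool (k = k0) else 0)" by simp
    qed
    then show "(\<Sum>l<n'. of_bool (F k l)) = (if k = k0 then 1 else (0::bit))"
      using assms(2) by simp
  qed
  then show ?thesis using assms(1) by simp
qed

section \<open>Upper bounds\<close>

text \<open>All relevant powers are expressed by the unit h = 2^(t-3), which makes the estimates
  linear; t \<ge> 4 enters through h \<ge> 2.\<close>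

lemma two_powers:
  assumes "t \<ge> 4"
  shows "(2::nat) ^ t = 8 * 2 ^ (t - 3)" "(2::nat) ^ (t - 1) = 4 * 2 ^ (t - 3)" "(2::nat) ^ (t - 2) = 2 * 2 ^ (t - 3)"
    "(2::nat) ^ (t + 1) = 16 * 2 ^ (t - 3)" "(2::nat) \<le> 2 ^ (t - 3)"
proof -
  obtain r where r: "t = r + 4" using assms by (metis le_add_diff_inverse2)
  show "(2::nat) ^ t = 8 * 2 ^ (t - 3)" "(2::nat) ^ (t - 1) = 4 * 2 ^ (t - 3)" "(2::nat) ^ (t - 2) = 2 * 2 ^ (t - 3)"
    "(2::nat) ^ (t + 1) = 16 * 2 ^ (t - 3)"
    unfolding r by (simp_all add: eval_nat_numeral)
  show "(2::nat) \<le> 2 ^ (t - 3)" by (rule two_power_ge2) (use assms in linarith)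
qed

lemma two_power_le_cases: "k \<le> K \<Longrightarrow> (2::nat) ^ k = 2 ^ K \<or> 2 * 2 ^ k \<le> (2::nat) ^ K"
proof (cases "k = K")
  case False
  assume "k \<le> K"
  then have "k + 1 \<le> K" using False by simp
  then have "(2::nat) ^ (k + 1) \<le> 2 ^ K" by (rule power_increasing) simp
  then show ?thesis by simp
qed simp

lemma two_power_cases_t2:
  assumes "t \<ge> 4" "k < t - 1"
  shows "(2::nat) ^ k = 2 * 2 ^ (t - 3) \<or> (2::nat) ^ k = 2 ^ (t - 3) \<or> 2 * 2 ^ k \<le> (2::nat) ^ (t - 3)"
proof (cases "k = t - 2")
  case True
  then show ?thesis using two_powers[OF assms(1)] by simp
next
  case False
  then have "k \<le> t - 3" using assms by linarith
  then show ?thesis using two_power_le_cases by blast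
qed

lemma two_power_cases_t1:
  assumes "t \<ge> 4" "k < t"
  shows "(2::nat) ^ k = 4 * 2 ^ (t - 3) \<or> (2::nat) ^ k = 2 * 2 ^ (t - 3) \<or> (2::nat) ^ k = 2 ^ (t - 3)
    \<or> 2 * 2 ^ k \<le> (2::nat) ^ (t - 3)"
proof (cases "k = t - 1")
  case True
  then show ?thesis using two_powers[OF assms(1)] by simp
next
  case False
  then have "k < t - 1" using assms by linarith
  then show ?thesis using two_power_cases_t2[OF assms(1)] by blast
qed

lemma odd_binomial_residues:
  assumes "odd (n choose k)" "n = M * u + r" "k = M * v + s" "r < M" "s < M" "M = 2 ^ e"
  shows "s \<le> r"
proof -
  have "n mod M = r" "k mod M = s" using assms by simp_all
  then show ?thesis using odd_binomial_mod_le[OF assms(1), of e] assms(6) by simp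
qed

lemma odd_binomial_full_even: "even k \<Longrightarrow> k < 2 ^ Suc e \<Longrightarrow> odd ((2 ^ Suc e - 2) choose k)"
proof -
  assume "even k" "k < 2 ^ Suc e"
  then obtain j where j: "k = 2 * j" "j < 2 ^ e" by auto
  have "2 ^ Suc e - 2 = 2 * (2 ^ e - (1::nat))" by simp
  then show ?thesis
    using binomial_parity_double[of "2 ^ e - 1" j] odd_binomial_full[OF j(2)] j(1) by simp
qed

lemma two_power_sum_unique:
  assumes "(2::nat) ^ k + 2 ^ l = 2 ^ i + 2 ^ j" "i \<le> j"
  shows "k = i \<and> l = j \<or> k = j \<and> l = i"
proof -
  have *: "k = i \<and> l = j" if eq: "(2::nat) ^ k + 2 ^ l = 2 ^ i + 2 ^ j" and kl: "k \<le> l" for k l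
  proof -
    have p: "(0::nat) < 2 ^ k" "(0::nat) < 2 ^ i" "(2::nat) ^ k \<le> 2 ^ l" "(2::nat) ^ i \<le> 2 ^ j"
      using kl assms(2) by simp_all
    have "l = j"
    proof (rule ccontr)
      assume "l \<noteq> j"
      then consider "l + 1 \<le> j" | "j + 1 \<le> l" by linarith
      then show False
      proof cases
        case 1
        then have "(2::nat) ^ (l + 1) \<le> 2 ^ j" by (rule power_increasing) simp
        then show False using eq p by simp
      next
        case 2
        then have "(2::nat) ^ (j + 1) \<le> 2 ^ l" by (rule power_increasing) simp
        then show False using eq p by simp
      qed
    qed
    then show ?thesis using eq by simp
  qed
  show ?thesis
  proof (cases "k \<le> l")
    case True
    then show ?thesis using * assms(1) by blast
  next
    case False
    then show ?thesis using *[of l k] assms(1) by (simp add: add.commute)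
  qed
qed

text \<open>Inside the box a < 8h, b < 4h only (8h-2, 4h-1), (8h-1, 4h-2) and (8h-1, 4h-1) reach the
  sum 12h - 3. The first is excluded, and in the others the terms cancel under exchange of k and
  l.\<close>

lemma killed_tt:
  assumes t: "t \<ge> 4"
  shows "killed (12 * 2 ^ (t - 3) - 3) (pform t 0 t 0)"
proof (rule killed_pform[where X = t and Y = "t - 1"])
  define h :: nat where "h = 2 ^ (t - 3)"
  note P = two_powers[OF t, folded h_def]
  fix a b c e :: nat
  assume ab: "12 * 2 ^ (t - 3) - 3 \<le> a + b" "a < 2 ^ t" "b < 2 ^ (t - 1)"
  note ab = ab[unfolded P, folded h_def]
  show "(\<Sum>k<t - 1. \<Sum>l<t - 1. of_bool (tm t 0 t 0 a b c e k l)) = (0::bit)"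
  proof (rule sum_square_symmetric)
    fix k l assume k: "k < t - 1" and l: "l < t - 1" and tm: "tm t 0 t 0 a b c e k l"
    have eqs: "a + c + 3 * 2 ^ k + 3 * 2 ^ l + 2 = 16 * h" "b + e + 4 = 2 * 2 ^ k + 2 * 2 ^ l"
      and odds: "odd (a choose (8 * h - 1 - 3 * 2 ^ k))" "odd (b choose (2 * 2 ^ k - 2))"
      using tm unfolding tm_def P by simp_all
    have A: "(2::nat) ^ k = 2 * h \<or> 2 ^ k = h \<or> 2 * 2 ^ k \<le> h" "(2::nat) ^ l = 2 * h \<or> 2 ^ l = h \<or> 2 * 2 ^ l \<le> h"
      using two_power_cases_t2[OF t k] two_power_cases_t2[OF t l] unfolding h_def by simp_all
    \<comment> \<open>An even \<open>a\<close> admits only an even lower index, which forces k = 0;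
      then the equation for \<open>w3\<close> is too small for b = 4h - 1.\<close>
    have "a \<noteq> 8 * h - 2"
    proof
      assume a: "a = 8 * h - 2"
      then have b: "b = 4 * h - 1" using ab by linarith
      have "(8 * h - 1 - 3 * 2 ^ k) mod 2 ^ 1 \<le> a mod 2 ^ 1" by (rule odd_binomial_mod_le[OF odds(1)])
      then have "even (8 * h - 1 - 3 * 2 ^ k)" unfolding a using P(5) by (auto elim: oddE)
      moreover have le: "3 * 2 ^ k \<le> 8 * h - 1" using A(1) P(5) by - (elim disjE; linarith)
      have "8 * h - 1 = 2 * (4 * h - 1) + 1" using P(5) by linarith
      then have "odd (8 * h - 1)" by presburger
      moreover have "8 * h - 1 = (8 * h - 1 - 3 * 2 ^ k) + 3 * 2 ^ k" using le by linarith
      ultimately have "odd (3 * (2::nat) ^ k)" by (metis even_add)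
      then have "odd ((2::nat) ^ k)" by simp
      then have "k = 0" by simp
      then show False using eqs b A(2) P(5) by simp
    qed
    \<comment> \<open>Now the digits of \<open>a\<close> are all ones and those of \<open>b\<close>
      are too, except possibly the last; the lower index for \<open>w3\<close> is even, so the
      exchanged coefficients are odd as well.\<close>
    then have a: "a = 8 * h - 1" using ab by linarith
    have b: "b = 4 * h - 2 \<or> b = 4 * h - 1" using ab a by linarith
    have "odd (a choose (8 * h - 1 - 3 * 2 ^ l))"
      unfolding a P(1)[symmetric] by (rule odd_binomial_full) (use P(1,5) in linarith)
    moreover have "odd (b choose (2 * 2 ^ l - 2))"
    proof -
      have lt: "2 * 2 ^ l - 2 < 4 * h" using A(2) P(5) by - (elim disjE; linarith)
      have q: "(2::nat) ^ Suc (t - 2) = 4 * h" using P(3) by simp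
      have "odd ((4 * h - 2) choose (2 * 2 ^ l - 2))"
        using odd_binomial_full_even[of "2 * 2 ^ l - 2" "t - 2", unfolded q] lt by simp
      moreover have "odd ((4 * h - 1) choose (2 * 2 ^ l - 2))"
        using odd_binomial_full[of "2 * 2 ^ l - 2" "t - 1", unfolded P(2)] lt by simp
      ultimately show ?thesis using b by blast
    qed
    moreover have "0 + 2 \<le> 2 * (2::nat) ^ l" using one_le_power[of "2::nat" l] by linarith
    ultimately show "tm t 0 t 0 a b c e l k"
      unfolding tm_def P diff_zero using eqs by (intro conjI; (assumption | linarith))
  next
    fix k assume k: "k < t - 1"
    show "\<not> tm t 0 t 0 a b c e k k"
    proof
      assume tm: "tm t 0 t 0 a b c e k k"
      have eqs: "a + c + 3 * 2 ^ k + 3 * 2 ^ k + 2 = 16 * h" "b + e + 4 = 2 * 2 ^ k + 2 * 2 ^ k"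
        using tm unfolding tm_def P by simp_all
      have A: "(2::nat) ^ k = 2 * h \<or> 2 ^ k = h \<or> 2 * 2 ^ k \<le> h"
        using two_power_cases_t2[OF t k] unfolding h_def by simp_all
      show False using eqs A P(5) ab by - (elim disjE; linarith)
    qed
  qed
qed (use two_powers[OF t] in simp_all)

lemma killed_mixed_small:
  assumes t: "t \<ge> 4"
  shows "killed (12 * 2 ^ (t - 3) - 3) (pform t 0 (t + 1) (6 * 2 ^ (t - 3) - 1))"
    "killed (12 * 2 ^ (t - 3) - 2) (pform t 0 (t + 1) (6 * 2 ^ (t - 3) - 2))"
    "killed (12 * 2 ^ (t - 3) - 1) (pform t 0 (t + 1) (4 * 2 ^ (t - 3) - 1))"
proof -
  define h :: nat where "h = 2 ^ (t - 3)"
  note P = two_powers[OF t, folded h_def]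
  \<comment> \<open>For m \<ge> 4h - 1 only l = t - 1 survives in the second functional, with
    \<open>w2\<close> exponent 4h - 1. This permits the smaller bounds 2^t and 2^(t-1), after which
    comparison of degrees alone decides.\<close>
  have gen: "killed d (pform t 0 (t + 1) m)" if m: "m \<ge> 4 * h - 1"
    and F: "\<And>a b c e k l. d \<le> a + b \<Longrightarrow> a < 8 * h \<Longrightarrow> b < 4 * h \<Longrightarrow> k < t - 1 \<Longrightarrow> l < t \<Longrightarrow>
      a + c + 3 * 2 ^ k + 3 * 2 ^ l + 2 = 24 * h \<Longrightarrow> b + e + m + 4 = 2 * 2 ^ k + 2 * 2 ^ l \<Longrightarrow> m + 2 \<le> 2 * 2 ^ l \<Longrightarrow> False"
    for d m
  proof (rule killed_pform[where X = t and Y = "t - 1"])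
    fix k assume k: "k < t + 1 - 1" "m + 2 \<le> 2 * 2 ^ k"
    then have "k < t" by simp
    from two_power_cases_t1[OF t this, folded h_def]
    show "2 ^ (t + 1) - 1 - 3 * 2 ^ k < (2::nat) ^ t"
      using k m unfolding P by - (elim disjE; linarith)
  next
    fix a b c e :: nat
    assume ab: "d \<le> a + b" "a < 2 ^ t" "b < 2 ^ (t - 1)"
    have "\<not> tm t 0 (t + 1) m a b c e k l" if "k < t - 1" "l < t + 1 - 1" for k l
    proof
      assume tm: "tm t 0 (t + 1) m a b c e k l"
      show False
        using tm_snd[OF tm] tm ab that unfolding tm_def P
        by (intro F[of a b k l c e]) simp_all
    qed
    then show "(\<Sum>k<t - 1. \<Sum>l<t + 1 - 1. of_bool (tm t 0 (t + 1) m a b c e k l)) = (0::bit)"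
      by (intro sum.neutral ballI) simp
  qed (use m P in simp_all)
  have c: "(2::nat) ^ k = 2 * h \<or> 2 ^ k = h \<or> 2 * 2 ^ k \<le> h" if "k < t - 1" for k
    using two_power_cases_t2[OF t that] unfolding h_def by simp
  have c': "(2::nat) ^ k = 4 * h \<or> (2::nat) ^ k = 2 * h \<or> 2 ^ k = h \<or> 2 * 2 ^ k \<le> h" if "k < t" for k
    using two_power_cases_t1[OF t that] unfolding h_def by simp
  have "killed (12 * h - 3) (pform t 0 (t + 1) (6 * h - 1))"
  proof (rule gen)
    fix a b c e k l
    assume "12 * h - 3 \<le> a + b" "a < 8 * h" "b < 4 * h" and k: "k < t - 1" "l < t" and
      "a + c + 3 * 2 ^ k + 3 * 2 ^ l + 2 = 24 * h" "b + e + (6 * h - 1) + 4 = 2 * 2 ^ k + 2 * 2 ^ l"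
      "6 * h - 1 + 2 \<le> 2 * 2 ^ l"
    then show False using c[OF k(1)] c'[OF k(2)] P(5) by - (elim disjE; linarith)
  qed (use P(5) in linarith)
  moreover have "killed (12 * h - 2) (pform t 0 (t + 1) (6 * h - 2))"
  proof (rule gen)
    fix a b c e k l
    assume "12 * h - 2 \<le> a + b" "a < 8 * h" "b < 4 * h" and k: "k < t - 1" "l < t" and
      "a + c + 3 * 2 ^ k + 3 * 2 ^ l + 2 = 24 * h" "b + e + (6 * h - 2) + 4 = 2 * 2 ^ k + 2 * 2 ^ l"
      "6 * h - 2 + 2 \<le> 2 * 2 ^ l"
    then show False using c[OF k(1)] c'[OF k(2)] P(5) by - (elim disjE; linarith)
  qed (use P(5) in linarith)
  moreover have "killed (12 * h - 1) (pform t 0 (t + 1) (4 * h - 1))"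
    by (rule gen) (use P(5) in linarith)+
  ultimately show "killed (12 * 2 ^ (t - 3) - 3) (pform t 0 (t + 1) (6 * 2 ^ (t - 3) - 1))"
    "killed (12 * 2 ^ (t - 3) - 2) (pform t 0 (t + 1) (6 * 2 ^ (t - 3) - 2))"
    "killed (12 * 2 ^ (t - 3) - 1) (pform t 0 (t + 1) (4 * 2 ^ (t - 3) - 1))"
    unfolding h_def by simp_all
qed

lemma killed_top_small:
  assumes t: "t \<ge> 4"
  shows "killed (12 * 2 ^ (t - 3) - 3) (pform (t + 1) (6 * 2 ^ (t - 3) - 1) (t + 1) (6 * 2 ^ (t - 3) - 1))"
    "killed (12 * 2 ^ (t - 3) - 2) (pform (t + 1) (6 * 2 ^ (t - 3) - 2) (t + 1) (6 * 2 ^ (t - 3) - 2))"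
    "killed (12 * 2 ^ (t - 3) - 1) (pform (t + 1) (4 * 2 ^ (t - 3) - 1) (t + 1) (4 * 2 ^ (t - 3) - 1))"
proof -
  define h :: nat where "h = 2 ^ (t - 3)"
  note P = two_powers[OF t, folded h_def]
  have c': "(2::nat) ^ k = 4 * h \<or> (2::nat) ^ k = 2 * h \<or> 2 ^ k = h \<or> 2 * 2 ^ k \<le> h" if "k < t" for k
    using two_power_cases_t1[OF t that] unfolding h_def by simp
  \<comment> \<open>Both functionals are reduced to the monomial with k = l = t - 1, so a + c and b
    + e are determined and again no parity enters.\<close>
  have gen: "killed d (pform (t + 1) m (t + 1) m)" if m: "m \<ge> 4 * h - 1"
    and F: "\<And>a b c e. d \<le> a + b \<Longrightarrow> a < 8 * h \<Longrightarrow> b < 4 * h \<Longrightarrow>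
      a + c + 2 = 8 * h \<Longrightarrow> b + e + 2 * m + 4 = 16 * h \<Longrightarrow> False"
    for d m
  proof (rule killed_pform[where X = t and Y = "t - 1"])
    fix k assume k: "k < t + 1 - 1" "m + 2 \<le> 2 * 2 ^ k"
    then have "k < t" by simp
    from c'[OF this]
    show "2 ^ (t + 1) - 1 - 3 * 2 ^ k < (2::nat) ^ t" "2 ^ (t + 1) - 1 - 3 * 2 ^ k < (2::nat) ^ t"
      using k m unfolding P by - (elim disjE; linarith)+
  next
    fix a b c e :: nat
    assume ab: "d \<le> a + b" "a < 2 ^ t" "b < 2 ^ (t - 1)"
    have "\<not> tm (t + 1) m (t + 1) m a b c e k l" if "k < t + 1 - 1" "l < t + 1 - 1" for k l
    proof
      assume tm: "tm (t + 1) m (t + 1) m a b c e k l"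
      have kl: "k < t" "l < t" using that by simp_all
      have 1: "m + 2 \<le> 2 * 2 ^ k" using tm unfolding tm_def by simp
      have A: "2 ^ k = 4 * h" using c'[OF kl(1)] 1 m P(5) by - (elim disjE; linarith)
      have B: "2 ^ l = 4 * h" using c'[OF kl(2)] tm_snd[OF tm] m P(5) by - (elim disjE; linarith)
      have "a + c + 3 * 2 ^ k + 3 * 2 ^ l + 2 = 32 * h" "b + e + m + m + 4 = 2 * 2 ^ k + 2 * 2 ^ l"
        using tm unfolding tm_def P by simp_all
      then show False
        unfolding A B using ab unfolding P by (intro F[of a b c e]) simp_all
    qed
    then show "(\<Sum>k<t + 1 - 1. \<Sum>l<t + 1 - 1. of_bool (tm (t + 1) m (t + 1) m a b c e k l)) = (0::bit)"
      by (intro sum.neutral ballI) simp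
  qed (use m P in simp_all)
  have "killed (12 * h - 3) (pform (t + 1) (6 * h - 1) (t + 1) (6 * h - 1))"
    by (rule gen) (use P(5) in linarith)+
  moreover have "killed (12 * h - 2) (pform (t + 1) (6 * h - 2) (t + 1) (6 * h - 2))"
    by (rule gen) (use P(5) in linarith)+
  moreover have "killed (12 * h - 1) (pform (t + 1) (4 * h - 1) (t + 1) (4 * h - 1))"
    by (rule gen) (use P(5) in linarith)+
  ultimately show "killed (12 * 2 ^ (t - 3) - 3) (pform (t + 1) (6 * 2 ^ (t - 3) - 1) (t + 1) (6 * 2 ^ (t - 3) - 1))"
    "killed (12 * 2 ^ (t - 3) - 2) (pform (t + 1) (6 * 2 ^ (t - 3) - 2) (t + 1) (6 * 2 ^ (t - 3) - 2))"
    "killed (12 * 2 ^ (t - 3) - 1) (pform (t + 1) (4 * 2 ^ (t - 3) - 1) (t + 1) (4 * 2 ^ (t - 3) - 1))"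
    unfolding h_def by simp_all
qed

text \<open>For smaller \<open>m\<close> a second monomial with a \<open>w2\<close> exponent above
  2^t appears; the bounds are now 2^(t+1) = 16h and 2^t = 8h.\<close>

lemma killed_mixedI:
  assumes t: "t \<ge> 4" and h: "h = 2 ^ (t - 3)"
    and F: "\<And>a b c e k l. d \<le> a + b \<Longrightarrow> a < 16 * h \<Longrightarrow> b < 8 * h \<Longrightarrow> k < t - 1 \<Longrightarrow> l < t \<Longrightarrow>
      a + c + 3 * 2 ^ k + 3 * 2 ^ l + 2 = 24 * h \<Longrightarrow> b + e + m + 4 = 2 * 2 ^ k + 2 * 2 ^ l \<Longrightarrow> m + 2 \<le> 2 * 2 ^ l \<Longrightarrow>
      odd (a choose (8 * h - 1 - 3 * 2 ^ k)) \<Longrightarrow> odd (b choose (2 * 2 ^ k - 2)) \<Longrightarrow> False"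
  shows "killed d (pform t 0 (t + 1) m)"
proof -
  note P = two_powers[OF t, folded h]
  show ?thesis
  proof (rule killed_pform[where X = "t + 1" and Y = t])
    fix a b c e :: nat
    assume ab: "d \<le> a + b" "a < 2 ^ (t + 1)" "b < 2 ^ t"
    have "\<not> tm t 0 (t + 1) m a b c e k l" if kl: "k < t - 1" "l < t + 1 - 1" for k l
    proof
      assume tm: "tm t 0 (t + 1) m a b c e k l"
      show False
        using tm_snd[OF tm] tm ab kl unfolding tm_def P
        by (intro F[of a b k l c e]) simp_all
    qed
    then show "(\<Sum>k<t - 1. \<Sum>l<t + 1 - 1. of_bool (tm t 0 (t + 1) m a b c e k l)) = (0::bit)"
      by (intro sum.neutral ballI) simp
  next
    show "2 ^ t - 1 - 3 * 2 ^ k < (2::nat) ^ (t + 1)" "2 ^ (t + 1) - 1 - 3 * 2 ^ k < (2::nat) ^ (t + 1)" for k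
      unfolding P using P(5) by linarith+
  qed (use P in simp_all)
qed

lemma killed_topI:
  assumes t: "t \<ge> 4" and h: "h = 2 ^ (t - 3)"
    and F: "\<And>a b c e k l. d \<le> a + b \<Longrightarrow> a < 16 * h \<Longrightarrow> b < 8 * h \<Longrightarrow> k < t \<Longrightarrow> l < t \<Longrightarrow>
      a + c + 3 * 2 ^ k + 3 * 2 ^ l + 2 = 32 * h \<Longrightarrow> b + e + 2 * m + 4 = 2 * 2 ^ k + 2 * 2 ^ l \<Longrightarrow>
      m + 2 \<le> 2 * 2 ^ k \<Longrightarrow> m + 2 \<le> 2 * 2 ^ l \<Longrightarrow>
      odd (a choose (16 * h - 1 - 3 * 2 ^ k)) \<Longrightarrow> odd (b choose (2 * 2 ^ k - 2 - m)) \<Longrightarrow> False"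
  shows "killed d (pform (t + 1) m (t + 1) m)"
proof -
  note P = two_powers[OF t, folded h]
  show ?thesis
  proof (rule killed_pform[where X = "t + 1" and Y = t])
    fix a b c e :: nat
    assume ab: "d \<le> a + b" "a < 2 ^ (t + 1)" "b < 2 ^ t"
    have "\<not> tm (t + 1) m (t + 1) m a b c e k l" if kl: "k < t + 1 - 1" "l < t + 1 - 1" for k l
    proof
      assume tm: "tm (t + 1) m (t + 1) m a b c e k l"
      show False
        using tm_snd[OF tm] tm ab kl unfolding tm_def P
        by (intro F[of a b k l c e]) simp_all
    qed
    then show "(\<Sum>k<t + 1 - 1. \<Sum>l<t + 1 - 1. of_bool (tm (t + 1) m (t + 1) m a b c e k l)) = (0::bit)"
      by (intro sum.neutral ballI) simp
  next
    show "2 ^ (t + 1) - 1 - 3 * 2 ^ k < (2::nat) ^ (t + 1)" "2 ^ (t + 1) - 1 - 3 * 2 ^ k < (2::nat) ^ (t + 1)" for k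
      unfolding P using P(5) by linarith+
  qed (use P in simp_all)
qed

lemma residue_contradiction:
  assumes "odd (n choose k)" "n = M * u + r" "k = M * v + s" "r < s" "s < M" "M = 2 ^ e"
  shows False
  using odd_binomial_residues[OF assms(1,2,3) _ assms(5,6)] assms(4,5) by simp

text \<open>The equation for \<open>w3\<close> fixes 2^k + 2^l, hence the pair up to order. The
  condition \<open>swap\<close> rules out a second, different contribution, so nothing can
  cancel.\<close>

lemma DD_pform_single:
  assumes N: "a + c + 3 * 2 ^ k + 3 * 2 ^ l + 2 = 2 ^ T + 2 ^ T'" "b + e + m + m' + 4 = 2 * 2 ^ k + 2 * 2 ^ l"
    and k: "k < T - 1" "l < T' - 1"
    and o: "m + 2 \<le> 2 * 2 ^ k" "odd (a choose (2 ^ T - 1 - 3 * 2 ^ k))" "odd (b choose (2 * 2 ^ k - 2 - m))"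
    and swap: "k = l \<or> T - 1 \<le> l \<or> 2 * 2 ^ l < m + 2 \<or> b < 2 * 2 ^ l - 2 - m"
  shows "DD a b (pform T m T' m') 1 (w2 ^ c * w3 ^ e) \<noteq> 0"
proof -
  have "(\<Sum>k<T - 1. \<Sum>l<T' - 1. of_bool (tm T m T' m' a b c e k l)) = (1::bit)"
  proof (rule sum_square_single[OF k])
    show "tm T m T' m' a b c e k l" unfolding tm_def using N o by blast
    fix i j assume ij: "i < T - 1" "j < T' - 1" and tm: "tm T m T' m' a b c e i j"
    have "(2::nat) ^ i + 2 ^ j = 2 ^ k + 2 ^ l" using tm N unfolding tm_def by linarith
    then have *: "i = k \<and> j = l \<or> i = l \<and> j = k"
      using two_power_sum_unique[of i j k l] two_power_sum_unique[of i j l k]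
      by (cases "k \<le> l") (auto simp: add.commute)
    have "m + 2 \<le> 2 * 2 ^ i" "\<not> b < 2 * 2 ^ i - 2 - m"
      using tm unfolding tm_def by (auto intro: ccontr simp: binomial_eq_0)
    then show "i = k \<and> j = l" using * swap ij(1) by auto
  qed
  then show ?thesis by (simp add: DD_pform)
qed

context
  fixes t h :: nat
  assumes t: "t \<ge> 4" and h: "h = 2 ^ (t - 3)"
begin

lemmas powers = two_powers[OF t, folded h]

lemma two_h_eq: "2 * h = 2 ^ (t - 2)"
  using powers by simp

lemma cases_t2: "k < t - 1 \<Longrightarrow> (2::nat) ^ k = 2 * h \<or> 2 ^ k = h \<or> 2 * 2 ^ k \<le> h"
  using two_power_cases_t2[OF t] unfolding h by simp

lemma cases_t1: "k < t \<Longrightarrow> (2::nat) ^ k = 4 * h \<or> (2::nat) ^ k = 2 * h \<or> 2 ^ k = h \<or> 2 * 2 ^ k \<le> h"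
  using two_power_cases_t1[OF t] unfolding h by simp

text \<open>The lower index is -1 modulo 2h: its last digits are all ones, so an odd coefficient
  forces a to be -1 modulo 2h too.\<close>

lemma top_index: "2 ^ k = 2 * h \<or> 2 ^ k = 4 * h \<Longrightarrow> \<exists>v. 16 * h - 1 - 3 * 2 ^ k = 2 * h * v + (2 * h - 1)"
proof (elim disjE)
  assume "2 ^ k = 2 * h"
  then have "16 * h - 1 - 3 * 2 ^ k = 2 * h * 4 + (2 * h - 1)" using powers(5) by linarith
  then show ?thesis by blast
next
  assume "2 ^ k = 4 * h"
  then have "16 * h - 1 - 3 * 2 ^ k = 2 * h * 1 + (2 * h - 1)" using powers(5) by linarith
  then show ?thesis by blast
qed

lemma two_power_dvd_h: "2 * 2 ^ k \<le> 2 * h \<Longrightarrow> \<exists>u. 2 * h = 2 * 2 ^ k * u"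
proof -
  assume "2 * 2 ^ k \<le> 2 * h"
  then have "k \<le> t - 3" unfolding h by (simp add: power_increasing_iff)
  then have "h = 2 ^ k * 2 ^ (t - 3 - k)" unfolding h by (simp flip: power_add)
  then have "2 * h = 2 * 2 ^ k * 2 ^ (t - 3 - k)" by simp
  then show ?thesis by blast
qed

text \<open>Degrees alone suffice. The tightest pair is 2^l = 2h, 2^k = h/2, where b \<le> h - 2 is
  one short; that same pair realises the value in the lower bound.\<close>

lemma killed_mixed_4: "killed (17 * h - 2) (pform t 0 (t + 1) (4 * h - 2))"
proof (rule killed_mixedI[OF t h])
  fix a b c e k l
  assume 1: "17 * h - 2 \<le> a + b" "a < 16 * h" "b < 8 * h" and k: "k < t - 1" and l: "l < t" and
    2: "a + c + 3 * 2 ^ k + 3 * 2 ^ l + 2 = 24 * h" "b + e + (4 * h - 2) + 4 = 2 * 2 ^ k + 2 * 2 ^ l"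
      "4 * h - 2 + 2 \<le> 2 * 2 ^ l"
  then show False using cases_t2[OF k] cases_t1[OF l] powers(5) by - (elim disjE; linarith)
qed

text \<open>In the remaining cases the exponent \<open>a\<close> or \<open>b\<close> lies in an interval that contains no number
  dominating the lower index of its binomial coefficient bit by bit.\<close>

lemma killed_top_4: "killed (17 * h - 2) (pform (t + 1) (4 * h - 2) (t + 1) (4 * h - 2))"
proof (rule killed_topI[OF t h])
  fix a b c e k l
  assume 1: "17 * h - 2 \<le> a + b" "a < 16 * h" "b < 8 * h" and k: "k < t" and l: "l < t" and
    2: "a + c + 3 * 2 ^ k + 3 * 2 ^ l + 2 = 32 * h" "b + e + 2 * (4 * h - 2) + 4 = 2 * 2 ^ k + 2 * 2 ^ l"
      "4 * h - 2 + 2 \<le> 2 * 2 ^ k" "4 * h - 2 + 2 \<le> 2 * 2 ^ l" and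
    3: "odd (a choose (16 * h - 1 - 3 * 2 ^ k))"
  have N: "2 ^ k + 2 ^ l = 6 * h"
    using 1 2 cases_t1[OF k] cases_t1[OF l] powers(5) by - (elim disjE; linarith)
  then have A: "2 ^ k = 2 * h \<or> 2 ^ k = 4 * h"
    using 2 cases_t1[OF k] cases_t1[OF l] powers(5) by - (elim disjE; linarith)
  have a: "13 * h - 2 \<le> a" "a \<le> 14 * h - 2" using 1 2 N powers(5) by linarith+
  obtain v where v: "16 * h - 1 - 3 * 2 ^ k = 2 * h * v + (2 * h - 1)" using top_index[OF A] by blast
  show False
    by (rule residue_contradiction[OF 3, of "2 * h" 6 "a - 12 * h" v "2 * h - 1" "t - 2"])
      (use a powers(5) in linarith, rule v, use a powers(5) in linarith, use powers(5) in linarith, rule two_h_eq)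
qed

lemma killed_mixed_5: "killed (17 * h - 1) (pform t 0 (t + 1) (3 * h - 1))"
proof (rule killed_mixedI[OF t h])
  fix a b c e k l
  assume 1: "17 * h - 1 \<le> a + b" "a < 16 * h" "b < 8 * h" and k: "k < t - 1" and l: "l < t" and
    2: "a + c + 3 * 2 ^ k + 3 * 2 ^ l + 2 = 24 * h" "b + e + (3 * h - 1) + 4 = 2 * 2 ^ k + 2 * 2 ^ l"
      "3 * h - 1 + 2 \<le> 2 * 2 ^ l" and
    3: "odd (a choose (8 * h - 1 - 3 * 2 ^ k))" "odd (b choose (2 * 2 ^ k - 2))"
  have B: "2 ^ l = 2 * h"
    using 1 2 cases_t2[OF k] cases_t1[OF l] powers(5) by - (elim disjE; linarith)
  have "2 ^ k \<noteq> 2 * h" using 1 2 B powers(5) by linarith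
  then consider "2 ^ k = h" | "2 * 2 ^ k \<le> h" using cases_t2[OF k] by blast
  then show False
  proof cases
    case 1
    \<comment> \<open>The lower index 5h - 1 has residue h - 1 modulo h, which the residue of
      \<open>a\<close> does not reach.\<close>
    have a: "14 * h + 2 \<le> a" "a \<le> 15 * h - 2" using 2 B 1 \<open>17 * h - 1 \<le> a + b\<close> powers(5) by linarith+
    show False
      by (rule residue_contradiction[OF 3(1), of h 14 "a - 14 * h" 4 "h - 1" "t - 3"])
        (use a powers(5) 1 in linarith, use powers(5) 1 in linarith, use a powers(5) in linarith, use powers(5) in linarith, rule h)
  next
    case 2
    \<comment> \<open>Since 2 * 2^k divides h, the residue of \<open>b\<close> modulo 2 * 2^k is b -
      h, and this is below the lower index 2 * 2^k - 2.\<close>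
    have b: "h \<le> b" "b + 3 \<le> h + 2 * 2 ^ k"
      using 1 B \<open>a + c + 3 * 2 ^ k + 3 * 2 ^ l + 2 = 24 * h\<close> \<open>b + e + (3 * h - 1) + 4 = 2 * 2 ^ k + 2 * 2 ^ l\<close> powers(5)
      by linarith+
    have "k + 1 \<le> t - 3"
    proof -
      have "(2::nat) ^ (k + 1) \<le> 2 ^ (t - 3)" using 2 h by simp
      then show ?thesis by (simp only: power_increasing_iff one_less_numeral_iff semiring_norm)
    qed
    then have e: "t - 3 = (k + 1) + (t - 3 - (k + 1))" by linarith
    have "h = 2 ^ ((k + 1) + (t - 3 - (k + 1)))" unfolding h by (simp only: e[symmetric])
    then have "h = 2 ^ (k + 1) * 2 ^ (t - 3 - (k + 1))" by (simp only: power_add)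
    then have hu: "h = 2 * 2 ^ k * 2 ^ (t - 3 - (k + 1))" by simp
    show False
      by (rule residue_contradiction[OF 3(2), of "2 * 2 ^ k" "2 ^ (t - 3 - (k + 1))" "b - h" 0 "2 * 2 ^ k - 2" "k + 1"])
        (use b hu in \<open>simp_all\<close>)
  qed
qed

lemma killed_top_5: "killed (17 * h - 1) (pform (t + 1) (3 * h - 1) (t + 1) (3 * h - 1))"
proof (rule killed_topI[OF t h])
  fix a b c e k l
  assume 1: "17 * h - 1 \<le> a + b" "a < 16 * h" "b < 8 * h" and k: "k < t" and l: "l < t" and
    2: "a + c + 3 * 2 ^ k + 3 * 2 ^ l + 2 = 32 * h" "b + e + 2 * (3 * h - 1) + 4 = 2 * 2 ^ k + 2 * 2 ^ l"
      "3 * h - 1 + 2 \<le> 2 * 2 ^ k" "3 * h - 1 + 2 \<le> 2 * 2 ^ l" and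
    3: "odd (a choose (16 * h - 1 - 3 * 2 ^ k))" "odd (b choose (2 * 2 ^ k - 2 - (3 * h - 1)))"
  have A: "2 ^ k = 2 * h \<or> 2 ^ k = 4 * h" using 2 cases_t1[OF k] powers(5) by - (elim disjE; linarith)
  have B: "2 ^ l = 2 * h \<or> 2 ^ l = 4 * h" using 2 cases_t1[OF l] powers(5) by - (elim disjE; linarith)
  \<comment> \<open>The index for \<open>w3\<close> is -1 modulo h, so b must be as well.\<close>
  have J: "\<exists>v. 2 * 2 ^ k - 2 - (3 * h - 1) = h * v + (h - 1)"
    using A
  proof
    assume "2 ^ k = 2 * h"
    then have "2 * 2 ^ k - 2 - (3 * h - 1) = h * 0 + (h - 1)" using powers(5) by linarith
    then show ?thesis by blast
  next
    assume "2 ^ k = 4 * h"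
    then have "2 * 2 ^ k - 2 - (3 * h - 1) = h * 4 + (h - 1)" using powers(5) by linarith
    then show ?thesis by blast
  qed
  then obtain w where w: "2 * 2 ^ k - 2 - (3 * h - 1) = h * w + (h - 1)" by blast
  obtain v where v: "16 * h - 1 - 3 * 2 ^ k = 2 * h * v + (2 * h - 1)" using top_index[OF A] by blast
  have "2 ^ k + 2 ^ l = 4 * h \<or> 2 ^ k + 2 ^ l = 6 * h \<or> 2 ^ k + 2 ^ l = 8 * h" using A B by auto
  then consider "2 ^ k + 2 ^ l = 4 * h" | "2 ^ k + 2 ^ l = 6 * h" using 1 2 powers(5) by - (elim disjE; linarith)
  then show False
  proof cases
    case N: 1
    have b: "h \<le> b" "b \<le> 2 * h - 2" using 1 2 N powers(5) by linarith+
    show False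
      by (rule residue_contradiction[OF 3(2), of h 1 "b - h" w "h - 1" "t - 3"])
        (use b powers(5) in linarith, rule w, use b powers(5) in linarith, use powers(5) in linarith, rule h)
  next
    case N: 2
    have ab: "11 * h + 1 \<le> a" "a \<le> 14 * h - 2" "b \<le> 6 * h - 2" using 1 2 N powers(5) by linarith+
    have "\<not> 12 * h \<le> a"
    proof
      assume a: "12 * h \<le> a"
      show False
        by (rule residue_contradiction[OF 3(1), of "2 * h" 6 "a - 12 * h" v "2 * h - 1" "t - 2"])
          (use a ab in linarith, rule v, use a ab powers(5) in linarith, use powers(5) in linarith, rule two_h_eq)
    qed
    moreover have "\<not> a \<le> 12 * h - 2"
    proof
      assume a: "a \<le> 12 * h - 2"
      show False
        by (rule residue_contradiction[OF 3(1), of "2 * h" 5 "a - 10 * h" v "2 * h - 1" "t - 2"])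
          (use a ab in linarith, rule v, use a ab powers(5) in linarith, use powers(5) in linarith, rule two_h_eq)
    qed
    \<comment> \<open>The only a in the interval that is -1 modulo 2h is 12h - 1. It pushes b
      between 5h and 6h - 2, where no number is -1 modulo h.\<close>
    ultimately have "5 * h \<le> b" using 1 powers(5) by linarith
    then show False
      by (intro residue_contradiction[OF 3(2), of h 5 "b - 5 * h" w "h - 1" "t - 3"])
        (use powers(5) in linarith, rule w, use ab powers(5) in linarith, use powers(5) in linarith, rule h)
  qed
qed

lemma killed_mixed_6: "killed (18 * h - 1) (pform t 0 (t + 1) (2 * h - 1))"
proof (rule killed_mixedI[OF t h])
  fix a b c e k l
  assume 1: "18 * h - 1 \<le> a + b" "a < 16 * h" "b < 8 * h" and k: "k < t - 1" and l: "l < t" and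
    2: "a + c + 3 * 2 ^ k + 3 * 2 ^ l + 2 = 24 * h" "b + e + (2 * h - 1) + 4 = 2 * 2 ^ k + 2 * 2 ^ l"
      "2 * h - 1 + 2 \<le> 2 * 2 ^ l" and
    3: "odd (b choose (2 * 2 ^ k - 2))"
  have B: "2 ^ l = 2 * h"
    using 1 2 cases_t2[OF k] cases_t1[OF l] powers(5) by - (elim disjE; linarith)
  have "2 ^ k \<noteq> 2 * h" using 1 2 B powers(5) by linarith
  then have "2 * 2 ^ k \<le> 2 * h" using cases_t2[OF k] by auto
  then obtain u where u: "2 * h = 2 * 2 ^ k * u" using two_power_dvd_h[of k] by auto
  have b: "2 * h \<le> b" "b + 3 \<le> 2 * h + 2 * 2 ^ k" using 1 2 B powers(5) by linarith+
  then have "b = 2 * 2 ^ k * u + (b - 2 * h)" unfolding u[symmetric] by simp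
  then show False
    by (rule residue_contradiction[OF 3, of "2 * 2 ^ k" u "b - 2 * h" 0 "2 * 2 ^ k - 2" "k + 1"])
      (use b in simp_all)
qed

text \<open>For m = 2h - 1 both lower indices are -1 modulo 2h. Either b lies between 2h and 4h - 2,
  or a < 12h pushes b between 6h and 8h - 2; neither interval contains a number that is -1 modulo
  2h.\<close>

lemma killed_top_6: "killed (18 * h - 1) (pform (t + 1) (2 * h - 1) (t + 1) (2 * h - 1))"
proof (rule killed_topI[OF t h])
  fix a b c e k l
  assume 1: "18 * h - 1 \<le> a + b" "a < 16 * h" "b < 8 * h" and k: "k < t" and l: "l < t" and
    2: "a + c + 3 * 2 ^ k + 3 * 2 ^ l + 2 = 32 * h" "b + e + 2 * (2 * h - 1) + 4 = 2 * 2 ^ k + 2 * 2 ^ l"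
      "2 * h - 1 + 2 \<le> 2 * 2 ^ k" "2 * h - 1 + 2 \<le> 2 * 2 ^ l" and
    3: "odd (a choose (16 * h - 1 - 3 * 2 ^ k))" "odd (b choose (2 * 2 ^ k - 2 - (2 * h - 1)))"
  have A: "2 ^ k = 2 * h \<or> 2 ^ k = 4 * h" using 2 cases_t1[OF k] powers(5) by - (elim disjE; linarith)
  have B: "2 ^ l = 2 * h \<or> 2 ^ l = 4 * h" using 2 cases_t1[OF l] powers(5) by - (elim disjE; linarith)
  have J: "\<exists>v. 2 * 2 ^ k - 2 - (2 * h - 1) = 2 * h * v + (2 * h - 1)"
    using A
  proof
    assume "2 ^ k = 2 * h"
    then have "2 * 2 ^ k - 2 - (2 * h - 1) = 2 * h * 0 + (2 * h - 1)" using powers(5) by linarith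
    then show ?thesis by blast
  next
    assume "2 ^ k = 4 * h"
    then have "2 * 2 ^ k - 2 - (2 * h - 1) = 2 * h * 2 + (2 * h - 1)" using powers(5) by linarith
    then show ?thesis by blast
  qed
  then obtain w where w: "2 * 2 ^ k - 2 - (2 * h - 1) = 2 * h * w + (2 * h - 1)" by blast
  obtain v where v: "16 * h - 1 - 3 * 2 ^ k = 2 * h * v + (2 * h - 1)" using top_index[OF A] by blast
  have "2 ^ k + 2 ^ l = 4 * h \<or> 2 ^ k + 2 ^ l = 6 * h \<or> 2 ^ k + 2 ^ l = 8 * h" using A B by auto
  then consider "2 ^ k + 2 ^ l = 4 * h" | "2 ^ k + 2 ^ l = 6 * h" using 1 2 powers(5) by - (elim disjE; linarith)
  then show False
  proof cases
    case N: 1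
    have b: "2 * h \<le> b" "b \<le> 4 * h - 2" using 1 2 N powers(5) by linarith+
    show False
      by (rule residue_contradiction[OF 3(2), of "2 * h" 1 "b - 2 * h" w "2 * h - 1" "t - 2"])
        (use b powers(5) in linarith, rule w, use b powers(5) in linarith, use powers(5) in linarith, rule two_h_eq)
  next
    case N: 2
    have ab: "10 * h + 1 \<le> a" "a \<le> 14 * h - 2" "b \<le> 8 * h - 2" using 1 2 N powers(5) by linarith+
    have "\<not> 12 * h \<le> a"
    proof
      assume a: "12 * h \<le> a"
      show False
        by (rule residue_contradiction[OF 3(1), of "2 * h" 6 "a - 12 * h" v "2 * h - 1" "t - 2"])
          (use a ab in linarith, rule v, use a ab powers(5) in linarith, use powers(5) in linarith, rule two_h_eq)
    qed
    then have "6 * h \<le> b" using 1 powers(5) by linarith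
    then show False
      by (intro residue_contradiction[OF 3(2), of "2 * h" 3 "b - 6 * h" w "2 * h - 1" "t - 2"])
        (use powers(5) in linarith, rule w, use ab powers(5) in linarith, use powers(5) in linarith, rule two_h_eq)
  qed
qed

text \<open>Adding the two exponent equations bounds a + b by 24h minus 2^k + 2^l + 2^s and a
  constant; since 2^l \<ge> 2^s, this is already too small.\<close>

lemma killed_mixed_7:
  assumes s: "s \<le> t - 3"
  shows "killed (24 * h - 2 * 2 ^ s - 1) (pform t 0 (t + 1) (2 ^ s - 1))"
proof (rule killed_mixedI[OF t h])
  fix a b c e k l
  assume 1: "24 * h - 2 * 2 ^ s - 1 \<le> a + b" "a < 16 * h" "b < 8 * h" and
    2: "a + c + 3 * 2 ^ k + 3 * 2 ^ l + 2 = 24 * h" "b + e + (2 ^ s - 1) + 4 = 2 * 2 ^ k + 2 * 2 ^ l"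
      "2 ^ s - 1 + 2 \<le> 2 * (2::nat) ^ l"
  have "(2::nat) ^ s < 2 ^ (l + 1)" using 2(3) by simp
  then have "s < l + 1" by (rule power_less_imp_less_exp[rotated]) simp
  then have "(2::nat) ^ s \<le> 2 ^ l" by (intro power_increasing) auto
  moreover have "(2::nat) ^ s \<le> h" unfolding h by (rule power_increasing[OF s]) simp
  ultimately show False using 1 2(1,2) powers(5) by linarith
qed

text \<open>Both numbers have all binary digits equal to one, up to their lengths, except for the
  digit at position \<open>s\<close>.\<close>

lemma odd_binomial_gap:
  assumes "s \<le> l" "l < T"
  shows "odd ((2 ^ T - 1 - 2 ^ s) choose (2 * 2 ^ l - 1 - 2 ^ s))"
proof -
  define M :: nat where "M = 2 ^ (s + 1)"
  have M: "M = 2 * 2 ^ s" by (simp add: M_def)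
  have split: "2 ^ (s + 1 + r) - 1 - 2 ^ s = M * (2 ^ r - 1) + (2 ^ s - 1 :: nat)" for r
  proof -
    have "(1::nat) \<le> 2 ^ r" "(1::nat) \<le> 2 ^ s" by simp_all
    obtain x where x: "2 ^ r = Suc x" by (cases "2 ^ r :: nat") auto
    have "(2::nat) ^ (s + 1 + r) = M * 2 ^ r" by (simp add: M_def power_add)
    then show ?thesis using \<open>1 \<le> 2 ^ s\<close> unfolding x M by simp
  qed
  obtain p where p: "T = s + 1 + p" using assms by (metis Suc_eq_plus1 Suc_leI le_less_trans less_eqE)
  obtain r where r: "l = s + r" using assms by (metis less_eqE)
  have l: "2 * 2 ^ l = (2::nat) ^ (s + 1 + r)" by (simp add: r power_add)
  have "(2::nat) ^ r - 1 < 2 ^ p"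
  proof -
    have "(2::nat) ^ r \<le> 2 ^ p" using assms p r by (intro power_increasing) auto
    moreover have "(0::nat) < 2 ^ r" by simp
    ultimately show ?thesis by linarith
  qed
  then have "odd ((2 ^ p - 1) choose (2 ^ r - 1 :: nat))" by (rule odd_binomial_full)
  moreover have "odd ((M * x + R) choose (M * y + R))" if "R < M" "odd (x choose y)" for x y R
    using that by (subst odd_binomial_div_mod[of _ _ "s + 1"], fold M_def) simp
  moreover have "(2::nat) ^ s - 1 < M" unfolding M using one_le_power[of "2::nat" s] by linarith
  ultimately have "odd ((M * (2 ^ p - 1) + (2 ^ s - 1)) choose (M * (2 ^ r - 1) + (2 ^ s - 1)))"
    by blast
  then show ?thesis unfolding split[symmetric] l p .
qed

text \<open>The binomials force a = 16h - 1 and b = 8h - 1 or b = 8h - 1 - Q with Q = 2^s. These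
  have so many binary ones that exchanging k and l keeps both coefficients odd; the terms do not
  vanish but cancel in pairs.\<close>

lemma killed_top_7:
  assumes s: "1 \<le> s" "s \<le> t - 3"
  shows "killed (24 * h - 2 * 2 ^ s - 1) (pform (t + 1) (2 ^ s - 1) (t + 1) (2 ^ s - 1))"
proof (rule killed_pform[where X = "t + 1" and Y = t])
  define Q :: nat where "Q = 2 ^ s"
  have Q: "2 \<le> Q" unfolding Q_def by (rule two_power_ge2[OF s(1)])
  have Qh: "Q \<le> h" unfolding h Q_def by (rule power_increasing[OF s(2)]) simp
  obtain q where q: "h = Q * q"
  proof -
    have "h = 2 ^ s * 2 ^ (t - 3 - s)" unfolding h using s(2) by (simp flip: power_add)
    then show thesis using that unfolding Q_def by blast
  qed
  fix a b c e :: nat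
  assume "24 * h - 2 * 2 ^ s - 1 \<le> a + b" "a < 2 ^ (t + 1)" "b < 2 ^ t"
  note ab = this[folded Q_def, unfolded powers]
  let ?tm = "tm (t + 1) (2 ^ s - 1) (t + 1) (2 ^ s - 1) a b c e"
  have main: "a = 16 * h - 1 \<and> (b = 8 * h - 1 \<or> b = 8 * h - 1 - Q) \<and> s \<le> l \<and> k \<noteq> l"
    if k: "k < t" and l: "l < t" and tm: "?tm k l" for k l
  proof -
    define A :: nat where "A = 2 ^ k"
    define B :: nat where "B = 2 ^ l"
    have eq: "b + e + (Q - 1) + (Q - 1) + 4 = 2 * A + 2 * B"
      using tm unfolding tm_def Q_def A_def B_def by blast
    have tm': "a + c + 3 * A + 3 * B + 2 = 2 ^ (t + 1) + 2 ^ (t + 1)" "Q - 1 + 2 \<le> 2 * A"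
      "odd (a choose (2 ^ (t + 1) - 1 - 3 * A))" "odd (b choose (2 * A - 2 - (Q - 1)))"
      using tm unfolding tm_def Q_def A_def B_def by blast+
    have 2: "a + c + 3 * A + 3 * B + 2 = 32 * h" "b + e + 2 * (Q - 1) + 4 = 2 * A + 2 * B"
      "Q + 1 \<le> 2 * A" "Q + 1 \<le> 2 * B"
      using tm'(1,2) tm_snd[OF tm, folded Q_def B_def] Q eq unfolding powers by linarith+
    have odds: "odd (a choose (16 * h - 1 - 3 * A))" "odd (b choose (2 * A - 2 - (Q - 1)))"
      using tm'(3,4) unfolding powers by blast+
    have "(2::nat) ^ s < 2 ^ (k + 1)" using 2(3) unfolding Q_def A_def by simp
    then have "s < k + 1" by (rule power_less_imp_less_exp[rotated]) simp
    moreover have "(2::nat) ^ s < 2 ^ (l + 1)" using 2(4) unfolding Q_def B_def by simp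
    then have "s < l + 1" by (rule power_less_imp_less_exp[rotated]) simp
    ultimately have sk: "s \<le> k" "s \<le> l" by simp_all
    then have QAB: "Q \<le> A" "Q \<le> B" unfolding Q_def A_def B_def by (simp_all add: power_increasing)
    have A: "A = 4 * h \<or> A \<le> 2 * h" and B: "B = 4 * h \<or> B \<le> 2 * h"
      using cases_t1[OF k] cases_t1[OF l] unfolding A_def B_def by linarith+
    have "A + B \<le> 8 * h - 3" "4 * h + 1 \<le> A + B" using ab 2 Q Qh powers(5) by linarith+
    then have AB: "(A = 4 * h \<and> B \<le> 2 * h) \<or> (A \<le> 2 * h \<and> B = 4 * h)"
      using A B powers(5) by auto
    then have "k \<noteq> l" using powers(5) unfolding A_def B_def by auto
    have a_ge: "16 * h - 2 * Q \<le> a" and b_ge: "8 * h - 2 * Q \<le> b" using ab Qh powers(5) by linarith+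
    \<comment> \<open>Q divides 2A, so the index for \<open>w3\<close> is -1 modulo Q, and only two
      numbers from 8h - 2Q to 8h - 1 have that residue.\<close>
    have bQ: "b = 8 * h - 1 \<or> b = 8 * h - 1 - Q" if "2 * A = Q * u" for u
    proof (rule ccontr)
      assume n: "\<not> (b = 8 * h - 1 \<or> b = 8 * h - 1 - Q)"
      have "u \<ge> 2"
      proof (rule ccontr)
        assume "\<not> u \<ge> 2"
        then have "u \<le> 1" by simp
        then have "Q * u \<le> Q * 1" by (rule mult_le_mono2)
        then show False using that 2(3) by linarith
      qed
      then obtain x where x: "u = x + 2" by (metis le_add_diff_inverse2)
      have J: "2 * A - 2 - (Q - 1) = Q * x + (Q - 1)" unfolding that x using Q by (simp add: algebra_simps)
      obtain y where y: "8 * q = y + 2"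
      proof -
        have "q \<noteq> 0" using q powers(5) by (cases q) auto
        then have "2 \<le> 8 * q" by simp
        then show thesis using that by (metis le_add_diff_inverse2)
      qed
      have "8 * h = Q * (8 * q)" using q by simp
      then have h8: "8 * h = Q * y + 2 * Q" unfolding y by (simp add: algebra_simps)
      consider "8 * h - Q \<le> b" "b \<le> 8 * h - 2" | "b \<le> 8 * h - Q - 2"
        using n ab(3) Q Qh by linarith
      then show False
      proof cases
        case 1
        show False
          by (rule residue_contradiction[OF odds(2), of Q "y + 1" "b - (8 * h - Q)" x "Q - 1" s])
            (use 1 h8 Q J in \<open>simp_all add: Q_def\<close>)
      next
        case 2
        show False
          by (rule residue_contradiction[OF odds(2), of Q y "b - (8 * h - 2 * Q)" x "Q - 1" s])
            (use 2 b_ge h8 Q J in \<open>simp_all add: Q_def\<close>)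
      qed
    qed
    have "\<exists>u. 2 * A = Q * u"
    proof -
      have "2 * A = 2 ^ s * (2 * 2 ^ (k - s))" unfolding A_def using sk by (simp flip: power_add)
      then show ?thesis unfolding Q_def by blast
    qed
    then have b: "b = 8 * h - 1 \<or> b = 8 * h - 1 - Q" using bQ by blast
    from AB have "a = 16 * h - 1"
    proof
      assume AB: "A = 4 * h \<and> B \<le> 2 * h"
      show ?thesis
      proof (rule ccontr)
        assume ne: "a \<noteq> 16 * h - 1"
        have ge: "14 * h \<le> a" using a_ge Qh by linarith
        have lt: "a < 16 * h - 1" using ne ab(2) by linarith
        have I: "16 * h - 1 - 3 * A = 4 * h * 0 + (4 * h - 1)" using AB powers(5) by linarith
        show False
          by (rule residue_contradiction[OF odds(1), of "4 * h" 3 "a - 12 * h" 0 "4 * h - 1" "t - 1"])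
            (use ge in linarith, rule I, use ge lt in linarith, use powers(5) in linarith, rule powers(2)[symmetric])
      qed
    next
      assume AB: "A \<le> 2 * h \<and> B = 4 * h"
      have "A dvd 2 * h"
      proof -
        have "k \<le> t - 2" using AB two_h_eq unfolding A_def by (simp add: power_increasing_iff)
        then show ?thesis unfolding A_def two_h_eq by (rule le_imp_power_dvd)
      qed
      then obtain z where z: "2 * h = A * z" by (rule dvdE)
      have "z \<noteq> 0" using z powers(5) by (cases z) auto
      then have "4 \<le> 8 * z" by simp
      then obtain y where y: "8 * z = y + 4" by (metis le_add_diff_inverse2)
      have h16: "16 * h = A * y + 4 * A"
      proof -
        have "16 * h = A * (8 * z)" using z by simp
        then show ?thesis unfolding y by (simp add: algebra_simps)
      qed
      have A1: "1 \<le> A" unfolding A_def by simp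
      have I: "16 * h - 1 - 3 * A = A * y + (A - 1)" using h16 A1 by linarith
      show ?thesis
      proof (rule ccontr)
        assume ne: "a \<noteq> 16 * h - 1"
        \<comment> \<open>The lower index is -1 modulo A, and a \<ge> 16h - 2A leaves 16h - A - 1 as
          the only competitor of 16h - 1.\<close>
        consider "16 * h - A \<le> a" | "a = 16 * h - A - 1" | "a \<le> 16 * h - A - 2" by linarith
        then show False
        proof cases
          case 1
          show False
          proof (rule residue_contradiction[OF odds(1), of A "y + 3" "a - (16 * h - A)" y "A - 1" k])
            show "a = A * (y + 3) + (a - (16 * h - A))" using 1 h16 by (simp add: algebra_simps)
          qed (use I 1 ne ab A1 A_def in \<open>linarith | simp\<close>)+
        next
          case 2
          \<comment> \<open>The competitor forces A = Q. The equation for \<open>w3\<close> then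
            excludes b = 8h - 1, and with b = 8h - 1 - Q the sum a + b misses the bound by
            one.\<close>
          have "A < 2 * Q" using 2 a_ge A1 AB powers(5) by linarith
          then have "A = Q"
          proof -
            have "(2::nat) ^ k < 2 ^ (s + 1)" using \<open>A < 2 * Q\<close> unfolding A_def Q_def by simp
            then have "k < s + 1" by (rule power_less_imp_less_exp[rotated]) simp
            then show ?thesis using sk unfolding A_def Q_def by simp
          qed
          then show False using b 2 AB ab \<open>b + e + 2 * (Q - 1) + 4 = 2 * A + 2 * B\<close> Q Qh powers(5)
            by - (elim disjE; linarith)
        next
          case 3
          show False
          proof (rule residue_contradiction[OF odds(1), of A "y + 2" "a - (16 * h - 2 * A)" y "A - 1" k])
            show "a = A * (y + 2) + (a - (16 * h - 2 * A))" using a_ge QAB h16 by (simp add: algebra_simps)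
          qed (use I 3 a_ge QAB A1 A_def Q in \<open>linarith | simp\<close>)+
        qed
      qed
    qed
    then show ?thesis using b \<open>k \<noteq> l\<close> sk by blast
  qed
  show "(\<Sum>k<t + 1 - 1. \<Sum>l<t + 1 - 1. of_bool (?tm k l)) = (0::bit)"
  proof (rule sum_square_symmetric)
    fix k l assume kl: "k < t + 1 - 1" "l < t + 1 - 1" and tm: "?tm k l"
    have k: "k < t" and l: "l < t" using kl by simp_all
    note m = main[OF k l tm]
    have c: "2 ^ l \<le> 4 * h" using cases_t1[OF l] by linarith
    have 1: "odd (a choose (2 ^ (t + 1) - 1 - 3 * 2 ^ l))"
    proof -
      have "a = 2 ^ (t + 1) - 1" using m powers by simp
      then show ?thesis by (simp only:) (rule odd_binomial_full, use powers(4,5) in linarith)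
    qed
    have J: "2 * 2 ^ l - 2 - (2 ^ s - 1) = 2 * 2 ^ l - 1 - (2::nat) ^ s"
      using one_le_power[of "2::nat" s] by linarith
    have 2: "odd (b choose (2 * 2 ^ l - 2 - (2 ^ s - 1)))"
      using m
    proof (elim conjE disjE)
      assume "b = 8 * h - 1"
      then have "b = 2 ^ t - 1" using powers by simp
      then show ?thesis by (simp only:) (rule odd_binomial_full, use c powers(1,5) in linarith)
    next
      assume b: "b = 8 * h - 1 - Q" and "s \<le> l"
      then have "odd ((2 ^ t - 1 - 2 ^ s) choose (2 * 2 ^ l - 1 - 2 ^ s))"
        using l by (intro odd_binomial_gap)
      then show ?thesis unfolding J b Q_def powers .
    qed
    have "s \<le> l" using m by blast
    then have "(2::nat) ^ s \<le> 2 ^ l" by (rule power_increasing) simp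
    then have "2 ^ s - 1 + 2 \<le> 2 * (2::nat) ^ l"
      using Q unfolding Q_def by linarith
    then show "?tm l k"
      using tm 1 2 unfolding tm_def by (simp only: ac_simps simp_thms)
  next
    fix k assume "k < t + 1 - 1"
    then show "\<not> ?tm k k" using main[of k k] by auto
  qed
next
  show "2 ^ (t + 1) - 1 - 3 * 2 ^ k < (2::nat) ^ (t + 1)" "2 ^ (t + 1) - 1 - 3 * 2 ^ k < (2::nat) ^ (t + 1)" for k
    unfolding powers using powers(5) by linarith+
qed (use powers in simp_all)

section \<open>Nonvanishing pairings for the lower bounds\<close>

lemma odd_full_a: "k \<le> 16 * h - 1 \<Longrightarrow> odd ((16 * h - 1) choose k)"
  using odd_binomial_full[of k "t + 1"] powers(4,5) by simp

lemma odd_full_8: "k \<le> 8 * h - 1 \<Longrightarrow> odd ((8 * h - 1) choose k)"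
  using odd_binomial_full[of k t] powers(1,5) by simp

lemma h_eq_double: "h = 2 * 2 ^ (t - 4)"
proof -
  have e: "t - 3 = Suc (t - 4)" using t by simp
  show ?thesis unfolding h e by simp
qed

text \<open>The digits of a = 2^t - 1 are all ones, so its coefficient is odd. For k = 0 the
  \<open>w3\<close> index is 0, and b = 4h - 3 is one below the index 4h - 2 of the exchanged pair;
  \<open>c\<close> and \<open>e\<close> fill up the degrees.\<close>

lemma lower_1: "DD (8 * h - 1) (4 * h - 3) (pform t 0 t 0) 1 (w2 ^ (2 * h - 4) * w3 ^ 1) \<noteq> 0"
proof (rule DD_pform_single[where k = 0 and l = "t - 2"])
  show "0 < t - 1" "t - 2 < t - 1" using t by linarith+
  show "odd ((8 * h - 1) choose (2 ^ t - 1 - 3 * 2 ^ 0))" by (rule odd_full_8) (use powers(1) in simp)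
  have "4 * h - 3 < 2 * 2 ^ (t - 2) - 2 - 0" unfolding powers using powers(5) by linarith
  then show "0 = t - 2 \<or> t - 1 \<le> t - 2 \<or> 2 * 2 ^ (t - 2) < 0 + (2::nat) \<or> 4 * h - 3 < 2 * 2 ^ (t - 2) - 2 - 0"
    by blast
qed (use powers in simp_all)

text \<open>No exchanged pair exists, since l = t - 1 is out of range for the first functional. With
  e = 0 the \<open>w3\<close> equation reads b + m = 10h - 4, so lowering m by one raises b by
  one.\<close>

lemma lower_2: "DD (8 * h - 1) (4 * h - 2) (pform t 0 (t + 1) (6 * h - 2)) 1 (w2 ^ (h - 1) * w3 ^ 0) \<noteq> 0"
proof (rule DD_pform_single[where k = "t - 3" and l = "t - 1"])
  show "t - 3 < t - 1" "t - 1 < t + 1 - 1" using t by linarith+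
  show "odd ((8 * h - 1) choose (2 ^ t - 1 - 3 * 2 ^ (t - 3)))" by (rule odd_full_8) (use powers(1) h in simp)
  show "8 * h - 1 + (h - 1) + 3 * 2 ^ (t - 3) + 3 * 2 ^ (t - 1) + 2 = 2 ^ t + 2 ^ (t + 1)"
    unfolding powers h[symmetric] using powers(5) by linarith
  have q: "(2::nat) ^ Suc (t - 2) = 4 * h" using powers(3) by simp
  show "odd ((4 * h - 2) choose (2 * 2 ^ (t - 3) - 2 - 0))"
    using odd_binomial_full_even[of "2 * h - 2" "t - 2", unfolded q] powers(5) unfolding h[symmetric] by simp
qed (use powers h in simp_all)

text \<open>One further step in b + m = 10h - 4 reaches b = 4h - 1, the largest exponent below the
  Frobenius bound 2^(t-1).\<close>

lemma lower_3: "DD (8 * h - 1) (4 * h - 1) (pform t 0 (t + 1) (6 * h - 3)) 1 (w2 ^ (h - 1) * w3 ^ 0) \<noteq> 0"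
proof (rule DD_pform_single[where k = "t - 3" and l = "t - 1"])
  show "t - 3 < t - 1" "t - 1 < t + 1 - 1" using t by linarith+
  show "odd ((8 * h - 1) choose (2 ^ t - 1 - 3 * 2 ^ (t - 3)))" by (rule odd_full_8) (use powers(1) h in simp)
  show "8 * h - 1 + (h - 1) + 3 * 2 ^ (t - 3) + 3 * 2 ^ (t - 1) + 2 = 2 ^ t + 2 ^ (t + 1)"
    unfolding powers h[symmetric] using powers(5) by linarith
  show "odd ((4 * h - 1) choose (2 * 2 ^ (t - 3) - 2 - 0))"
    using odd_binomial_full[of "2 * h - 2" "t - 1", unfolded powers(2)] powers(5) unfolding h[symmetric] by simp
qed (use powers h in simp_all)

text \<open>At m = 4h - 2 the monomial k = t - 2 has just entered, with \<open>w3\<close> index 0.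
  Its partner has 2 * 2^l = h, which gives b = h - 2.\<close>

lemma lower_4: "DD (16 * h - 1) (h - 2) (pform (t + 1) (4 * h - 2) t 0) 1 (w2 ^ (2 ^ (t - 4) - 1) * w3 ^ 0) \<noteq> 0"
proof (rule DD_pform_single[where k = "t - 2" and l = "t - 4"])
  show "t - 2 < t + 1 - 1" "t - 4 < t - 1" using t by linarith+
  show "odd ((16 * h - 1) choose (2 ^ (t + 1) - 1 - 3 * 2 ^ (t - 2)))" by (rule odd_full_a) (use powers in simp)
  show "16 * h - 1 + (2 ^ (t - 4) - 1) + 3 * 2 ^ (t - 2) + 3 * 2 ^ (t - 4) + 2 = 2 ^ (t + 1) + 2 ^ t"
    unfolding powers h_eq_double using one_le_power[of "2::nat" "t - 4"] by linarith
  show "h - 2 + 0 + (4 * h - 2) + 0 + 4 = 2 * 2 ^ (t - 2) + 2 * 2 ^ (t - 4)"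
    unfolding powers h_eq_double using one_le_power[of "2::nat" "t - 4"] by linarith
  show "4 * h - 2 + 2 \<le> 2 * 2 ^ (t - 2)" "odd ((h - 2) choose (2 * 2 ^ (t - 2) - 2 - (4 * h - 2)))"
    using powers by simp_all
  have "2 * 2 ^ (t - 4) < 4 * h - 2 + 2" using powers(5) unfolding h_eq_double by simp
  then show "t - 2 = t - 4 \<or> t + 1 - 1 \<le> t - 4 \<or> 2 * 2 ^ (t - 4) < 4 * h - 2 + 2 \<or> h - 2 < 2 * 2 ^ (t - 4) - 2 - (4 * h - 2)"
    by blast
qed

text \<open>With the next smaller \<open>m\<close>, b grows to h - 1 and the \<open>w3\<close> index
  to 1; the coefficient h - 1 is odd because h is even.\<close>

lemma lower_5: "DD (16 * h - 1) (h - 1) (pform (t + 1) (4 * h - 3) t 0) 1 (w2 ^ (2 ^ (t - 4) - 1) * w3 ^ 0) \<noteq> 0"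
proof (rule DD_pform_single[where k = "t - 2" and l = "t - 4"])
  show "t - 2 < t + 1 - 1" "t - 4 < t - 1" using t by linarith+
  show "odd ((16 * h - 1) choose (2 ^ (t + 1) - 1 - 3 * 2 ^ (t - 2)))" by (rule odd_full_a) (use powers in simp)
  show "16 * h - 1 + (2 ^ (t - 4) - 1) + 3 * 2 ^ (t - 2) + 3 * 2 ^ (t - 4) + 2 = 2 ^ (t + 1) + 2 ^ t"
    unfolding powers h_eq_double using one_le_power[of "2::nat" "t - 4"] by linarith
  show "h - 1 + 0 + (4 * h - 3) + 0 + 4 = 2 * 2 ^ (t - 2) + 2 * 2 ^ (t - 4)"
    unfolding powers h_eq_double using one_le_power[of "2::nat" "t - 4"] by linarith
  show "4 * h - 3 + 2 \<le> 2 * 2 ^ (t - 2)" using powers by simp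
  have "2 * 2 ^ (t - 2) - 2 - (4 * h - 3) = 1" using powers by simp
  moreover have "odd ((h - 1) choose 1)" using powers(5) unfolding h_eq_double by simp
  ultimately show "odd ((h - 1) choose (2 * 2 ^ (t - 2) - 2 - (4 * h - 3)))" by simp
  have "2 * 2 ^ (t - 4) < 4 * h - 3 + 2" using powers(5) unfolding h_eq_double by simp
  then show "t - 2 = t - 4 \<or> t + 1 - 1 \<le> t - 4 \<or> 2 * 2 ^ (t - 4) < 4 * h - 3 + 2 \<or> h - 1 < 2 * 2 ^ (t - 4) - 2 - (4 * h - 3)"
    by blast
qed

text \<open>A diagonal pair has no partner to cancel with. The \<open>w3\<close> index is h,
  dominated by 2h - 1, whose digits are all ones.\<close>

lemma lower_6: "DD (16 * h - 1) (2 * h - 1) (pform (t + 1) (3 * h - 2) (t + 1) (3 * h - 2)) 1 (w2 ^ (4 * h - 1) * w3 ^ 1) \<noteq> 0"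
proof (rule DD_pform_single[where k = "t - 2" and l = "t - 2"])
  show "t - 2 < t + 1 - 1" "t - 2 < t + 1 - 1" using t by linarith+
  show "odd ((16 * h - 1) choose (2 ^ (t + 1) - 1 - 3 * 2 ^ (t - 2)))" by (rule odd_full_a) (use powers in simp)
  have "2 * 2 ^ (t - 2) - 2 - (3 * h - 2) = h" using powers by simp
  moreover have "odd ((2 * h - 1) choose h)"
    using odd_binomial_full[of h "t - 2", unfolded powers(3)] powers(5) by simp
  ultimately show "odd ((2 * h - 1) choose (2 * 2 ^ (t - 2) - 2 - (3 * h - 2)))" by simp
qed (use powers in simp_all)

text \<open>For k = s the shift exhausts the exponent of \<open>w3\<close>, so the index is 0. The
  exchanged pair has index 8h - 2Q, one above b, and does not contribute.\<close>

lemma lower_7: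
  assumes s: "1 \<le> s" "s \<le> t - 3"
  shows "DD (16 * h - 1) (8 * h - 2 * 2 ^ s - 1) (pform (t + 1) (2 * 2 ^ s - 2) (t + 1) (2 * 2 ^ s - 2)) 1
    (w2 ^ (4 * h - 1 - 3 * 2 ^ s) * w3 ^ 1) \<noteq> 0"
proof -
  define Q :: nat where "Q = 2 ^ s"
  have Q: "2 \<le> Q" unfolding Q_def by (rule two_power_ge2[OF s(1)])
  have Qh: "Q \<le> h" unfolding h Q_def by (rule power_increasing[OF s(2)]) simp
  have "DD (16 * h - 1) (8 * h - 2 * Q - 1) (pform (t + 1) (2 * Q - 2) (t + 1) (2 * Q - 2)) 1
    (w2 ^ (4 * h - 1 - 3 * Q) * w3 ^ 1) \<noteq> 0"
  proof (rule DD_pform_single[where k = s and l = "t - 1"])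
    show "s < t + 1 - 1" "t - 1 < t + 1 - 1" using t s by linarith+
    show "odd ((16 * h - 1) choose (2 ^ (t + 1) - 1 - 3 * 2 ^ s))" by (rule odd_full_a) (use powers in simp)
    show "odd ((8 * h - 2 * Q - 1) choose (2 * 2 ^ s - 2 - (2 * Q - 2)))" by (simp add: Q_def)
    show "16 * h - 1 + (4 * h - 1 - 3 * Q) + 3 * 2 ^ s + 3 * 2 ^ (t - 1) + 2 = 2 ^ (t + 1) + 2 ^ (t + 1)"
      "8 * h - 2 * Q - 1 + 1 + (2 * Q - 2) + (2 * Q - 2) + 4 = 2 * 2 ^ s + 2 * 2 ^ (t - 1)"
      "2 * Q - 2 + 2 \<le> 2 * 2 ^ s"
      using Q Qh powers(5) unfolding powers Q_def[symmetric] by linarith+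
    have "8 * h - 2 * Q - 1 < 2 * 2 ^ (t - 1) - 2 - (2 * Q - 2)"
      using Q Qh powers(5) unfolding powers by linarith
    then show "s = t - 1 \<or> t + 1 - 1 \<le> t - 1 \<or> 2 * 2 ^ (t - 1) < 2 * Q - 2 + 2 \<or> 8 * h - 2 * Q - 1 < 2 * 2 ^ (t - 1) - 2 - (2 * Q - 2)"
      by blast
  qed
  then show ?thesis unfolding Q_def .
qed

end

section \<open>Values of the cup-length\<close>

text \<open>All multiples of the two functionals are included, so the common kernel is an
  ideal.\<close>

definition Lfam :: "nat \<Rightarrow> nat \<Rightarrow> (bit poly poly \<Rightarrow> bit) set" where
  "Lfam t m = range (\<lambda>c p. phm t 0 (c * p)) \<union> range (\<lambda>c p. phm (t + 1) m (c * p))"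

lemma Lfam_ker:
  assumes "t \<ge> 2" "2 ^ t - 1 \<le> n" "n + m = 2 ^ (t + 1) - 1"
  shows "p \<in> Igr n \<longleftrightarrow> (\<forall>l\<in>Lfam t m. l p = 0)"
  unfolding Igr_iff_phi[OF assms] Lfam_def phm_def by (auto simp: mult.assoc)

lemma Lfam_add: "l \<in> Lfam t m \<Longrightarrow> l (p + q) = l p + l q"
  unfolding Lfam_def by (auto simp: distrib_left phm_add)

locale presented_Lfam = presented A pr "Lfam t m"
  for A :: "'a graded_ring" (structure) and pr t m
begin

text \<open>For \<open>m1 \<le> m\<close> the functional with shift \<open>m\<close> is a multiple
  of the one with shift \<open>m1\<close>, hence killed at the same level.\<close>

lemma zcl_upper:
  assumes k: "killed (Suc d) (pform t 0 t 0)" "killed (Suc d) (pform t 0 (t + 1) m1)"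
      "killed (Suc d) (pform (t + 1) m1 (t + 1) m1)" and m: "m1 \<le> m"
  shows "zcl A \<le> enat d"
proof (rule zcl_le)
  have L: "\<exists>T \<mu> c. ((T = t \<and> \<mu> = 0) \<or> (T = t + 1 \<and> \<mu> = m1)) \<and> l = (\<lambda>p. phm T \<mu> (c * p))" if l: "l \<in> Lfam t m" for l
  proof -
    have "phm (t + 1) m (c * p) = phm (t + 1) m1 (w3 ^ (m - m1) * c * p)" for c p
      using phm_shift[of "t + 1" m1 "m - m1" "c * p"] m by (simp add: mult.assoc)
    then have 1: "(\<lambda>p. phm (t + 1) m (c * p)) = (\<lambda>p. phm (t + 1) m1 (w3 ^ (m - m1) * c * p))" for c
      by blast
    from l obtain c where "l = (\<lambda>p. phm t 0 (c * p)) \<or> l = (\<lambda>p. phm (t + 1) m (c * p))"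
      unfolding Lfam_def by blast
    then show ?thesis unfolding 1 by blast
  qed
  have k': "killed (Suc d) (pform (t + 1) m1 t 0)"
  proof -
    have "pform (t + 1) m1 t 0 = (\<lambda>p q. pform t 0 (t + 1) m1 q p)"
      by (simp add: pform_def mult.commute)
    then show ?thesis using killed_flip[OF k(2)] by simp
  qed
  fix l l' assume ll: "l \<in> Lfam t m" "l' \<in> Lfam t m"
  obtain T \<mu> c where T: "(T = t \<and> \<mu> = 0) \<or> (T = t + 1 \<and> \<mu> = m1)" and l: "l = (\<lambda>p. phm T \<mu> (c * p))"
    using L[OF ll(1)] by blast
  obtain T' \<mu>' c' where T': "(T' = t \<and> \<mu>' = 0) \<or> (T' = t + 1 \<and> \<mu>' = m1)" and l': "l' = (\<lambda>p. phm T' \<mu>' (c' * p))"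
    using L[OF ll(2)] by blast
  have "killed (Suc d) (pform T \<mu> T' \<mu>')" using T T' k k' by auto
  then have "killed (Suc d) (pre c c' (pform T \<mu> T' \<mu>'))" by (rule killed_pre)
  then show "killed (Suc d) (\<lambda>p q. l p * l' q)" unfolding l l' pre_def pform_def .
qed

text \<open>A functional with a larger shift still vanishes on the kernel of \<open>pr\<close>, so
  witnesses found at the left end of a range of \<open>n\<close> serve the whole range.\<close>

lemma zcl_lower:
  assumes T: "(T = t \<and> \<mu> = 0) \<or> (T = t + 1 \<and> m \<le> \<mu>)" "(T' = t \<and> \<mu>' = 0) \<or> (T' = t + 1 \<and> m \<le> \<mu>')"
    and nz: "DD a b (pform T \<mu> T' \<mu>') p q \<noteq> 0"
  shows "enat (a + b) \<le> zcl A"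
proof (rule zcl_ge[OF _ nz])
  have "phm T \<mu> p = 0" if T: "(T = t \<and> \<mu> = 0) \<or> (T = t + 1 \<and> m \<le> \<mu>)" and p: "pr p = \<zero>" for T \<mu> p
  proof -
    have L: "(\<lambda>p. phm t 0 (1 * p)) \<in> Lfam t m" "(\<lambda>p. phm (t + 1) m (w3 ^ (\<mu> - m) * p)) \<in> Lfam t m"
      unfolding Lfam_def by blast+
    have "\<forall>l\<in>Lfam t m. l p = 0" using p unfolding L_ker .
    then have "phm t 0 (1 * p) = 0" "phm (t + 1) m (w3 ^ (\<mu> - m) * p) = 0"
      using bspec[OF _ L(1)] bspec[OF _ L(2)] by simp_all
    then show ?thesis using T phm_shift[of "t + 1" m "\<mu> - m" p] by auto
  qed
  then show "pform T \<mu> T' \<mu>' \<in> bforms"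
    unfolding bforms_def using biadd_pform T by (auto simp: pform_def)
qed

lemma zcl_values:
  assumes t: "t \<ge> 4" and n: "2 ^ t - 1 \<le> n" "n + m = 2 ^ (t + 1) - 1"
  shows "2 ^ t - 1 \<le> n \<and> n \<le> 2 ^ t + 2 ^ (t - 2) \<Longrightarrow> zcl A = enat (2 ^ t + 2 ^ (t - 1) - 4)"
    and "n = 2 ^ t + 2 ^ (t - 2) + 1 \<Longrightarrow> zcl A = enat (2 ^ t + 2 ^ (t - 1) - 3)"
    and "2 ^ t + 2 ^ (t - 2) + 2 \<le> n \<and> n \<le> 2 ^ t + 2 ^ (t - 1) \<Longrightarrow> zcl A = enat (2 ^ t + 2 ^ (t - 1) - 2)"
    and "n = 2 ^ t + 2 ^ (t - 1) + 1 \<Longrightarrow> zcl A = enat (2 ^ (t + 1) + 2 ^ (t - 3) - 3)"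
    and "2 ^ t + 2 ^ (t - 1) + 2 \<le> n \<and> n \<le> 13 * 2 ^ (t - 3) \<Longrightarrow> zcl A = enat (2 ^ (t + 1) + 2 ^ (t - 3) - 2)"
    and "13 * 2 ^ (t - 3) + 1 \<le> n \<and> n \<le> 2 ^ t + 2 ^ (t - 1) + 2 ^ (t - 2) \<Longrightarrow>
      zcl A = enat (2 ^ (t + 1) + 2 ^ (t - 2) - 2)"
    and "1 \<le> s \<and> s \<le> t - 3 \<and> 2 ^ (t + 1) - 2 ^ (s + 1) + 1 \<le> n \<and> n \<le> 2 ^ (t + 1) - 2 ^ s \<Longrightarrow>
      zcl A = enat (3 * 2 ^ t - 2 ^ (s + 1) - 2)"
proof -
  define h :: nat where h: "h = 2 ^ (t - 3)"
  note P = two_powers[OF t, folded h]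
  note nm = n[unfolded P]
  \<comment> \<open>The pairing of two functionals for \<open>t\<close> is killed from 12h - 3 on,
    which is at most d + 1 in every case and equal to it in the first range.\<close>
  have val: "zcl A = enat d"
    if d: "12 * h - 3 \<le> Suc d"
      and up: "killed (Suc d) (pform t 0 (t + 1) m1)" "killed (Suc d) (pform (t + 1) m1 (t + 1) m1)" "m1 \<le> m"
      and lo: "DD a b (pform T \<mu> T' \<mu>') p q \<noteq> 0" "(T = t \<and> \<mu> = 0) \<or> (T = t + 1 \<and> m \<le> \<mu>)"
        "(T' = t \<and> \<mu>' = 0) \<or> (T' = t + 1 \<and> m \<le> \<mu>')" "a + b = d"
    for d m1 a b T \<mu> T' \<mu>' p q
  proof (rule antisym)
    have "killed (Suc d) (pform t 0 t 0)"
      by (rule killed_mono[OF killed_tt[OF t, folded h] d])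
    then show "zcl A \<le> enat d" using up by (rule zcl_upper)
    show "enat d \<le> zcl A" using zcl_lower[OF lo(2,3,1)] lo(4) by simp
  qed
  note mixed_small = killed_mixed_small[OF t, folded h]
  note top_small = killed_top_small[OF t, folded h]
  show "zcl A = enat (2 ^ t + 2 ^ (t - 1) - 4)" if *: "2 ^ t - 1 \<le> n \<and> n \<le> 2 ^ t + 2 ^ (t - 2)"
  proof -
    have e: "2 ^ t + 2 ^ (t - 1) - 4 = 12 * h - 4" "Suc (12 * h - 4) = 12 * h - 3"
      unfolding P using P(5) by linarith+
    have "6 * h - 1 \<le> m" using nm * unfolding P by linarith
    moreover have "8 * h - 1 + (4 * h - 3) = 12 * h - 4" using P(5) by linarith
    ultimately show ?thesis
      unfolding e(1) using mixed_small(1) top_small(1) lower_1[OF t h]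
      by (intro val[of "12 * h - 4" "6 * h - 1"]) (auto simp: e(2))
  qed
  show "zcl A = enat (2 ^ t + 2 ^ (t - 1) - 3)" if *: "n = 2 ^ t + 2 ^ (t - 2) + 1"
  proof -
    have e: "2 ^ t + 2 ^ (t - 1) - 3 = 12 * h - 3" "Suc (12 * h - 3) = 12 * h - 2"
      unfolding P using P(5) by linarith+
    have "6 * h - 2 = m" using nm * unfolding P by linarith
    moreover have "8 * h - 1 + (4 * h - 2) = 12 * h - 3" using P(5) by linarith
    ultimately show ?thesis
      unfolding e(1) using mixed_small(2) top_small(2) lower_2[OF t h]
      by (intro val[of "12 * h - 3" "6 * h - 2"]) (auto simp: e(2))
  qed
  show "zcl A = enat (2 ^ t + 2 ^ (t - 1) - 2)"
    if *: "2 ^ t + 2 ^ (t - 2) + 2 \<le> n \<and> n \<le> 2 ^ t + 2 ^ (t - 1)"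
  proof -
    have e: "2 ^ t + 2 ^ (t - 1) - 2 = 12 * h - 2" "Suc (12 * h - 2) = 12 * h - 1"
      unfolding P using P(5) by linarith+
    have "4 * h - 1 \<le> m" "m \<le> 6 * h - 3" using nm * unfolding P by linarith+
    moreover have "8 * h - 1 + (4 * h - 1) = 12 * h - 2" using P(5) by linarith
    ultimately show ?thesis
      unfolding e(1) using mixed_small(3) top_small(3) lower_3[OF t h]
      by (intro val[of "12 * h - 2" "4 * h - 1"]) (auto simp: e(2))
  qed
  show "zcl A = enat (2 ^ (t + 1) + 2 ^ (t - 3) - 3)" if *: "n = 2 ^ t + 2 ^ (t - 1) + 1"
  proof -
    have e: "2 ^ (t + 1) + 2 ^ (t - 3) - 3 = 17 * h - 3" "Suc (17 * h - 3) = 17 * h - 2" "12 * h - 3 \<le> 17 * h - 2"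
      unfolding P h[symmetric] using P(5) by linarith+
    have "4 * h - 2 = m" using nm * unfolding P by linarith
    moreover have "16 * h - 1 + (h - 2) = 17 * h - 3" using P(5) by linarith
    ultimately show ?thesis
      unfolding e(1) using killed_mixed_4[OF t h] killed_top_4[OF t h] lower_4[OF t h]
      by (intro val[of "17 * h - 3" "4 * h - 2"]) (auto simp: e(2,3))
  qed
  show "zcl A = enat (2 ^ (t + 1) + 2 ^ (t - 3) - 2)"
    if *: "2 ^ t + 2 ^ (t - 1) + 2 \<le> n \<and> n \<le> 13 * 2 ^ (t - 3)"
  proof -
    have e: "2 ^ (t + 1) + 2 ^ (t - 3) - 2 = 17 * h - 2" "Suc (17 * h - 2) = 17 * h - 1" "12 * h - 3 \<le> 17 * h - 1"
      unfolding P h[symmetric] using P(5) by linarith+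
    have "3 * h - 1 \<le> m" "m \<le> 4 * h - 3" using nm * unfolding P h[symmetric] by linarith+
    moreover have "16 * h - 1 + (h - 1) = 17 * h - 2" using P(5) by linarith
    ultimately show ?thesis
      unfolding e(1) using killed_mixed_5[OF t h] killed_top_5[OF t h] lower_5[OF t h]
      by (intro val[of "17 * h - 2" "3 * h - 1"]) (auto simp: e(2,3))
  qed
  show "zcl A = enat (2 ^ (t + 1) + 2 ^ (t - 2) - 2)"
    if *: "13 * 2 ^ (t - 3) + 1 \<le> n \<and> n \<le> 2 ^ t + 2 ^ (t - 1) + 2 ^ (t - 2)"
  proof -
    have e: "2 ^ (t + 1) + 2 ^ (t - 2) - 2 = 18 * h - 2" "Suc (18 * h - 2) = 18 * h - 1" "12 * h - 3 \<le> 18 * h - 1"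
      unfolding P using P(5) by linarith+
    have "2 * h - 1 \<le> m" "m \<le> 3 * h - 2" using nm * unfolding P h[symmetric] by linarith+
    moreover have "16 * h - 1 + (2 * h - 1) = 18 * h - 2" using P(5) by linarith
    ultimately show ?thesis
      unfolding e(1) using killed_mixed_6[OF t h] killed_top_6[OF t h] lower_6[OF t h]
      by (intro val[of "18 * h - 2" "2 * h - 1"]) (auto simp: e(2,3))
  qed
  show "zcl A = enat (3 * 2 ^ t - 2 ^ (s + 1) - 2)"
    if *: "1 \<le> s \<and> s \<le> t - 3 \<and> 2 ^ (t + 1) - 2 ^ (s + 1) + 1 \<le> n \<and> n \<le> 2 ^ (t + 1) - 2 ^ s"
  proof -
    define Q :: nat where "Q = 2 ^ s"
    have s: "1 \<le> s" "s \<le> t - 3" using * by simp_all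
    have Q: "2 \<le> Q" unfolding Q_def by (rule two_power_ge2[OF s(1)])
    have Qh: "Q \<le> h" unfolding h Q_def by (rule power_increasing[OF s(2)]) simp
    have Q1: "(2::nat) ^ (s + 1) = 2 * Q" by (simp add: Q_def)
    have e: "3 * 2 ^ t - 2 ^ (s + 1) - 2 = 24 * h - 2 * Q - 2" "Suc (24 * h - 2 * Q - 2) = 24 * h - 2 * Q - 1"
      "12 * h - 3 \<le> 24 * h - 2 * Q - 1"
      unfolding P Q1 using P(5) Qh by linarith+
    have "Q - 1 \<le> m" "m \<le> 2 * Q - 2"
      using nm * Q Qh unfolding P Q1 Q_def[symmetric] by linarith+
    moreover have "16 * h - 1 + (8 * h - 2 * Q - 1) = 24 * h - 2 * Q - 2" using P(5) Q Qh by linarith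
    ultimately show ?thesis
      unfolding e(1) using killed_mixed_7[OF t h s(2), folded Q_def, folded e(2)] killed_top_7[OF t h s, folded Q_def, folded e(2)]
        lower_7[OF t h s, folded Q_def]
      by (intro val[of "24 * h - 2 * Q - 2" "Q - 1"]) (auto simp only: e(2,3))
  qed
qed

end

section \<open>The quotient of the polynomial ring as an instance of the locale\<close>

lemma w_polynomials_simps:
  "carrier w_polynomials = UNIV" "monoid.mult w_polynomials = (*)" "\<one>\<^bsub>w_polynomials\<^esub> = 1"
  "\<zero>\<^bsub>w_polynomials\<^esub> = 0" "add w_polynomials = (+)" "grade w_polynomials k = bhom k"
  by (simp_all add: w_polynomials_def bhom_def cf_def)

lemma cring_w_polynomials: "cring w_polynomials"
proof (rule cringI)
  show "abelian_group w_polynomials"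
  proof (rule abelian_groupI)
    fix x assume "x \<in> carrier w_polynomials"
    show "\<exists>y\<in>carrier w_polynomials. y \<oplus>\<^bsub>w_polynomials\<^esub> x = \<zero>\<^bsub>w_polynomials\<^esub>"
      by (intro bexI[of _ x]) (simp_all add: w_polynomials_simps)
  qed (simp_all only: w_polynomials_simps UNIV_I add_ac add_0_right)
  show "comm_monoid w_polynomials"
    by (rule comm_monoidI) (simp_all add: w_polynomials_simps mult.assoc mult.commute)
qed (simp add: w_polynomials_simps distrib_right)

lemma Igr_zero: "0 \<in> Igr n"
  by (rule IgrI[of _ 0 _ 0 0]) simp

lemma genideal_w_polynomials:
  "Idl\<^bsub>w_polynomials\<^esub> {g_poly (n - 2), g_poly (n - 1), g_poly n} = Igr n"
proof
  interpret cring w_polynomials by (rule cring_w_polynomials)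
  let ?S = "{g_poly (n - 2), g_poly (n - 1), g_poly n}"
  have "inv\<^bsub>add_monoid w_polynomials\<^esub> f = f" for f
    using minus_equality[of f f] by (simp add: w_polynomials_simps a_inv_def)
  then have "subgroup (Igr n) (add_monoid w_polynomials)"
    by (intro subgroup.intro) (auto simp: w_polynomials_simps Igr_add Igr_zero)
  moreover have "f * c \<in> Igr n" if "f \<in> Igr n" for f c
    using Igr_mult[OF that, of c] by (simp add: mult.commute)
  ultimately have "ideal (Igr n) w_polynomials"
    by (intro idealI ring_axioms) (auto simp: w_polynomials_simps Igr_mult)
  then show "Idl\<^bsub>w_polynomials\<^esub> ?S \<subseteq> Igr n"
    by (rule genideal_minimal) (simp add: Igr_generators[simplified] Igr_generators)
  interpret I: ideal "Idl\<^bsub>w_polynomials\<^esub> ?S" w_polynomials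
    by (rule genideal_ideal) (simp add: w_polynomials_simps)
  have gen: "?S \<subseteq> Idl\<^bsub>w_polynomials\<^esub> ?S"
    by (rule genideal_self) (simp add: w_polynomials_simps)
  have mult: "c * f \<in> Idl\<^bsub>w_polynomials\<^esub> ?S" if "f \<in> Idl\<^bsub>w_polynomials\<^esub> ?S" for c f
    using I.I_l_closed[OF that, of c] by (simp add: w_polynomials_simps)
  have add: "f + g \<in> Idl\<^bsub>w_polynomials\<^esub> ?S" if "f \<in> Idl\<^bsub>w_polynomials\<^esub> ?S" "g \<in> Idl\<^bsub>w_polynomials\<^esub> ?S" for f g
    using I.a_closed[OF that] by (simp add: w_polynomials_simps)
  show "Igr n \<subseteq> Idl\<^bsub>w_polynomials\<^esub> ?S"
  proof
    fix f assume "f \<in> Igr n"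
    then obtain P Q R where "f = P * g_poly (n - 2) + Q * g_poly (n - 1) + R * g_poly n"
      unfolding Igr_def by blast
    moreover have "g_poly (n - 2) \<in> Idl\<^bsub>w_polynomials\<^esub> ?S" "g_poly (n - 1) \<in> Idl\<^bsub>w_polynomials\<^esub> ?S"
      "g_poly n \<in> Idl\<^bsub>w_polynomials\<^esub> ?S" using gen by blast+
    ultimately show "f \<in> Idl\<^bsub>w_polynomials\<^esub> ?S" by (simp only: add mult)
  qed
qed

lemma ideal_Igr: "ideal (Igr n) w_polynomials"
  using ring.genideal_ideal[OF cring.axioms(1)[OF cring_w_polynomials],
      of "{g_poly (n - 2), g_poly (n - 1), g_poly n}"]
  unfolding genideal_w_polynomials by (simp add: w_polynomials_simps)

lemma presented_algebra_Lfam: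
  assumes n: "t \<ge> 2" "2 ^ t - 1 \<le> n" "n + m = 2 ^ (t + 1) - 1"
  shows "presented_Lfam (presented_algebra n) (\<lambda>p. Igr n +>\<^bsub>w_polynomials\<^esub> p) t m"
proof -
  interpret I: ideal "Igr n" w_polynomials by (rule ideal_Igr)
  have A: "presented_algebra n = graded_quot w_polynomials (Igr n)"
    unfolding presented_algebra_def genideal_w_polynomials ..
  note S = graded_quot_simps w_polynomials_simps
  show ?thesis
    unfolding A
  proof (intro presented_Lfam.intro presented.intro)
    show "carrier (graded_quot w_polynomials (Igr n)) = range (\<lambda>p. Igr n +>\<^bsub>w_polynomials\<^esub> p)"
      unfolding S A_RCOSETS_def' by auto
    show "Igr n +>\<^bsub>w_polynomials\<^esub> (p + q) =
        (Igr n +>\<^bsub>w_polynomials\<^esub> p) \<oplus>\<^bsub>graded_quot w_polynomials (Igr n)\<^esub> (Igr n +>\<^bsub>w_polynomials\<^esub> q)" for p q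
      using I.a_rcos_sum[of p q] unfolding S by simp
    show "Igr n +>\<^bsub>w_polynomials\<^esub> (p * q) =
        (Igr n +>\<^bsub>w_polynomials\<^esub> p) \<otimes>\<^bsub>graded_quot w_polynomials (Igr n)\<^esub> (Igr n +>\<^bsub>w_polynomials\<^esub> q)" for p q
      using I.rcoset_mult_add[of p q] unfolding S by simp
    show "Igr n +>\<^bsub>w_polynomials\<^esub> 1 = \<one>\<^bsub>graded_quot w_polynomials (Igr n)\<^esub>" unfolding S ..
    show "Igr n +>\<^bsub>w_polynomials\<^esub> 0 = \<zero>\<^bsub>graded_quot w_polynomials (Igr n)\<^esub>"
      unfolding S by (rule I.a_rcos_const[OF Igr_zero])
    show "grade (graded_quot w_polynomials (Igr n)) k = (\<lambda>p. Igr n +>\<^bsub>w_polynomials\<^esub> p) ` bhom k" for k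
      unfolding S ..
    show "l (p + q) = l p + l q" if "l \<in> Lfam t m" for l p q using Lfam_add[OF that] .
    show "Igr n +>\<^bsub>w_polynomials\<^esub> p = \<zero>\<^bsub>graded_quot w_polynomials (Igr n)\<^esub> \<longleftrightarrow> (\<forall>l\<in>Lfam t m. l p = 0)" for p
      unfolding S Lfam_ker[OF n, symmetric]
      using I.rcos_const_imp_mem[of p] I.a_rcos_const[of p] by (auto simp: w_polynomials_simps)
  qed
qed

section \<open>The characteristic subalgebra of the oriented Grassmannian\<close>

lemma openin_quotient_topology:
  "openin (quotient_topology X q) U \<longleftrightarrow> U \<subseteq> q ` topspace X \<and> openin X {x \<in> topspace X. q x \<in> U}"
proof -
  have "istopology (\<lambda>U. U \<subseteq> q ` topspace X \<and> openin X {x \<in> topspace X. q x \<in> U})"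
    unfolding istopology_def
  proof (intro conjI allI impI)
    fix S T assume S: "S \<subseteq> q ` topspace X \<and> openin X {x \<in> topspace X. q x \<in> S}"
      and T: "T \<subseteq> q ` topspace X \<and> openin X {x \<in> topspace X. q x \<in> T}"
    show "S \<inter> T \<subseteq> q ` topspace X" using S by blast
    have "{x \<in> topspace X. q x \<in> S \<inter> T} = {x \<in> topspace X. q x \<in> S} \<inter> {x \<in> topspace X. q x \<in> T}"
      by blast
    then show "openin X {x \<in> topspace X. q x \<in> S \<inter> T}" using S T by auto
  next
    fix \<K> assume K: "\<forall>S\<in>\<K>. S \<subseteq> q ` topspace X \<and> openin X {x \<in> topspace X. q x \<in> S}"
    show "\<Union>\<K> \<subseteq> q ` topspace X" using K by blast
    have "{x \<in> topspace X. q x \<in> \<Union>\<K>} = \<Union>((\<lambda>S. {x \<in> topspace X. q x \<in> S}) ` \<K>)" by blast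
    then show "openin X {x \<in> topspace X. q x \<in> \<Union>\<K>}" using K by auto
  qed
  then show ?thesis unfolding quotient_topology_def by simp
qed

lemma topspace_quotient_topology: "topspace (quotient_topology X q) = q ` topspace X"
proof
  show "topspace (quotient_topology X q) \<subseteq> q ` topspace X"
    unfolding topspace_def openin_quotient_topology by blast
  have "{x \<in> topspace X. q x \<in> q ` topspace X} = topspace X" by blast
  then have "openin (quotient_topology X q) (q ` topspace X)"
    unfolding openin_quotient_topology by simp
  then show "q ` topspace X \<subseteq> topspace (quotient_topology X q)" by (rule openin_subset)
qed

lemma continuous_map_quotient_topology:
  assumes "\<And>x. f (q x) = r x"
  shows "continuous_map (quotient_topology X q) (quotient_topology X r) f"
  unfolding continuous_map_def topspace_quotient_topology
proof (intro conjI allI impI)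
  show "f \<in> q ` topspace X \<rightarrow> r ` topspace X" using assms by auto
  fix U assume "openin (quotient_topology X r) U"
  then have U: "openin X {x \<in> topspace X. r x \<in> U}" unfolding openin_quotient_topology by simp
  have "{x \<in> topspace X. q x \<in> {y \<in> q ` topspace X. f y \<in> U}} = {x \<in> topspace X. r x \<in> U}"
    using assms by auto
  then show "openin (quotient_topology X q) {y \<in> q ` topspace X. f y \<in> U}"
    unfolding openin_quotient_topology using U by auto
qed

lemma continuous_map_forget_orientation:
  "continuous_map (oriented_grassmannian :: ((real^'n::finite) set \<times> (real^'n^3) set) topology) grassmannian fst"
  unfolding oriented_grassmannian_def grassmannian_def
  by (rule continuous_map_quotient_topology) simp

section \<open>Pullback of cochains\<close>

lemma singular_face_simplex_map_commute:
  assumes "1 \<le> p" "k \<le> p"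
  shows "singular_face p k (simplex_map p f \<sigma>) = simplex_map (p - 1) f (singular_face p k \<sigma>)"
  using assms unfolding singular_face_def simplex_map_def
  by (auto simp: fun_eq_iff simplical_face_in_standard_simplex)

lemma cochain_pullback_cochains: "c \<in> cochains Y \<Longrightarrow> cochain_pullback X f c \<in> cochains X"
proof -
  assume "c \<in> cochains Y"
  then have "finite {p. \<exists>\<sigma>. c p \<sigma> \<noteq> 0}" by (simp add: cochains_def)
  then have "finite {p. \<exists>\<sigma>. cochain_pullback X f c p \<sigma> \<noteq> 0}"
    by (rule rev_finite_subset) (auto simp: cochain_pullback_def split: if_splits)
  then show ?thesis by (auto simp: cochains_def cochain_pullback_def)
qed

lemma cochain_pullback_coboundary:
  assumes f: "continuous_map X Y f"
  shows "cochain_pullback X f (coboundary Y c) = coboundary X (cochain_pullback X f c)"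
proof (intro ext)
  fix p \<sigma>
  show "cochain_pullback X f (coboundary Y c) p \<sigma> = coboundary X (cochain_pullback X f c) p \<sigma>"
  proof (cases "p > 0 \<and> singular_simplex p X \<sigma>")
    case True
    then have Y: "singular_simplex p Y (simplex_map p f \<sigma>)"
      using singular_simplex_simplex_map f by blast
    have "(\<Sum>k\<le>p. c (p - 1) (singular_face p k (simplex_map p f \<sigma>))) =
        (\<Sum>k\<le>p. cochain_pullback X f c (p - 1) (singular_face p k \<sigma>))"
    proof (intro sum.cong refl)
      fix k assume "k \<in> {..p}"
      then show "c (p - 1) (singular_face p k (simplex_map p f \<sigma>)) =
          cochain_pullback X f c (p - 1) (singular_face p k \<sigma>)"
        using True singular_simplex_singular_face[of p X \<sigma> k]
        by (simp add: cochain_pullback_def singular_face_simplex_map_commute)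
    qed
    moreover have "cochain_pullback X f (coboundary Y c) p \<sigma> =
        (\<Sum>k\<le>p. c (p - 1) (singular_face p k (simplex_map p f \<sigma>)))"
      using True Y by (simp add: cochain_pullback_def coboundary_def)
    moreover have "coboundary X (cochain_pullback X f c) p \<sigma> =
        (\<Sum>k\<le>p. cochain_pullback X f c (p - 1) (singular_face p k \<sigma>))"
      using True by (simp add: coboundary_def)
    ultimately show ?thesis by simp
  next
    case False
    then show ?thesis by (auto simp: cochain_pullback_def coboundary_def)
  qed
qed

section \<open>Cosets of coboundaries\<close>

definition cochain_add :: "'a cochain \<Rightarrow> 'a cochain \<Rightarrow> 'a cochain" where
  "cochain_add c d = (\<lambda>p \<sigma>. c p \<sigma> + d p \<sigma>)"

lemma cochain_add_assoc: "cochain_add (cochain_add a b) c = cochain_add a (cochain_add b c)"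
  and cochain_add_cancel: "cochain_add (cochain_add u b) (cochain_add b v) = cochain_add u v"
  and cochain_add_cancel': "cochain_add (cochain_add u b) (cochain_add v b) = cochain_add u v"
  and cochain_add_zero: "cochain_add (\<lambda>p \<sigma>. 0) a = a"
  by (intro ext; simp add: cochain_add_def add_ac)+

lemma cochains_add: "c \<in> cochains X \<Longrightarrow> d \<in> cochains X \<Longrightarrow> cochain_add c d \<in> cochains X"
proof -
  assume cd: "c \<in> cochains X" "d \<in> cochains X"
  have nz: "c p \<sigma> \<noteq> 0 \<or> d p \<sigma> \<noteq> 0" if "cochain_add c d p \<sigma> \<noteq> 0" for p \<sigma>
    using that by (cases "c p \<sigma>") (auto simp: cochain_add_def)
  have "finite ({p. \<exists>\<sigma>. c p \<sigma> \<noteq> 0} \<union> {p. \<exists>\<sigma>. d p \<sigma> \<noteq> 0})"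
    using cd by (simp add: cochains_def)
  then have "finite {p. \<exists>\<sigma>. cochain_add c d p \<sigma> \<noteq> 0}"
    by (rule rev_finite_subset) (use nz in blast)
  moreover have "singular_simplex p X \<sigma>" if "cochain_add c d p \<sigma> \<noteq> 0" for p \<sigma>
    using cd nz[OF that] unfolding cochains_def by blast
  ultimately show ?thesis unfolding cochains_def by blast
qed

lemma coboundary_add: "coboundary X (cochain_add c d) = cochain_add (coboundary X c) (coboundary X d)"
  by (intro ext) (simp add: coboundary_def cochain_add_def sum.distrib)

lemma coboundaries_add:
  "b \<in> coboundaries X \<Longrightarrow> b' \<in> coboundaries X \<Longrightarrow> cochain_add b b' \<in> coboundaries X"
  unfolding coboundaries_def by (auto simp flip: coboundary_add intro: cochains_add)

lemma coboundaries_zero: "(\<lambda>p \<sigma>. 0) \<in> coboundaries X"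
proof -
  have "coboundary X (\<lambda>p \<sigma>. 0) = (\<lambda>p \<sigma>. 0)" by (intro ext) (simp add: coboundary_def)
  moreover have "(\<lambda>p \<sigma>. 0) \<in> cochains X" by (simp add: cochains_def)
  ultimately show ?thesis unfolding coboundaries_def by (metis imageI)
qed

lemma coset_cocycle_ring: "H +>\<^bsub>cocycle_ring X\<^esub> a = (\<lambda>b. cochain_add b a) ` H"
  unfolding a_r_coset_def' cocycle_ring_def cochain_add_def by auto

lemma coboundaries_coset_absorb:
  assumes b: "b \<in> coboundaries X"
  shows "coboundaries X +>\<^bsub>cocycle_ring X\<^esub> cochain_add b a = coboundaries X +>\<^bsub>cocycle_ring X\<^esub> a"
  unfolding coset_cocycle_ring
proof (intro equalityI image_subsetI)
  fix c assume c: "c \<in> coboundaries X"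
  show "cochain_add c (cochain_add b a) \<in> (\<lambda>b. cochain_add b a) ` coboundaries X"
    by (rule image_eqI[where x = "cochain_add c b"])
      (rule cochain_add_assoc[symmetric], rule coboundaries_add[OF c b])
  show "cochain_add c a \<in> (\<lambda>c. cochain_add c (cochain_add b a)) ` coboundaries X"
    by (rule image_eqI[where x = "cochain_add c b"])
      (rule cochain_add_cancel[symmetric], rule coboundaries_add[OF c b])
qed

lemma coset_add_self:
  "(coboundaries X +>\<^bsub>cocycle_ring X\<^esub> a) <+>\<^bsub>cocycle_ring X\<^esub> (coboundaries X +>\<^bsub>cocycle_ring X\<^esub> a) = coboundaries X"
proof -
  have add: "add (cocycle_ring X) = cochain_add"
    by (simp add: cocycle_ring_def cochain_add_def fun_eq_iff)
  have "(coboundaries X +>\<^bsub>cocycle_ring X\<^esub> a) <+>\<^bsub>cocycle_ring X\<^esub> (coboundaries X +>\<^bsub>cocycle_ring X\<^esub> a) =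
      (\<Union>b\<in>coboundaries X. \<Union>b'\<in>coboundaries X. {cochain_add b b'})"
    unfolding set_add_def' coset_cocycle_ring add by (simp add: cochain_add_cancel')
  also have "\<dots> = coboundaries X"
  proof
    show "(\<Union>b\<in>coboundaries X. \<Union>b'\<in>coboundaries X. {cochain_add b b'}) \<subseteq> coboundaries X"
      using coboundaries_add by blast
    show "coboundaries X \<subseteq> (\<Union>b\<in>coboundaries X. \<Union>b'\<in>coboundaries X. {cochain_add b b'})"
    proof
      fix x assume "x \<in> coboundaries X"
      then have "x \<in> (\<Union>b'\<in>coboundaries X. {cochain_add (\<lambda>p \<sigma>. 0) b'})" by (simp add: cochain_add_zero)
      then show "x \<in> (\<Union>b\<in>coboundaries X. \<Union>b'\<in>coboundaries X. {cochain_add b b'})"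
        by (rule UN_I[OF coboundaries_zero])
    qed
  qed
  finally show ?thesis .
qed

text \<open>The map is a union over all representatives. Along a continuous map coboundaries pull
  back to coboundaries, so all representatives contribute the same coset.\<close>

lemma cohomology_map_coset:
  assumes f: "continuous_map X Y f" and Z: "Z \<in> carrier (cohomology Y)"
  obtains a where "cohomology_map X f Z = coboundaries X +>\<^bsub>cocycle_ring X\<^esub> a"
proof -
  obtain z where z: "Z = (\<lambda>b. cochain_add b z) ` coboundaries Y"
    using Z unfolding cohomology_def graded_quot_simps A_RCOSETS_def' coset_cocycle_ring by blast
  define a where "a = cochain_pullback X f z"
  have "coboundaries X +>\<^bsub>cocycle_ring X\<^esub> cochain_pullback X f y = coboundaries X +>\<^bsub>cocycle_ring X\<^esub> a"
    if y: "y \<in> Z" for y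
  proof -
    obtain b where b: "b \<in> coboundaries Y" "y = cochain_add b z" using y unfolding z by blast
    obtain c where c: "c \<in> cochains Y" "b = coboundary Y c" using b(1) unfolding coboundaries_def by blast
    have "cochain_pullback X f b = coboundary X (cochain_pullback X f c)"
      unfolding c(2) by (rule cochain_pullback_coboundary[OF f])
    then have "cochain_pullback X f b \<in> coboundaries X"
      unfolding coboundaries_def using cochain_pullback_cochains[OF c(1), of X f] by simp
    moreover have "cochain_pullback X f y = cochain_add (cochain_pullback X f b) a"
      unfolding b(2) a_def by (intro ext) (simp add: cochain_pullback_def cochain_add_def)
    ultimately show ?thesis by (simp only: coboundaries_coset_absorb)
  qed
  moreover have "Z \<noteq> {}" unfolding z using coboundaries_zero[of Y] by blast
  ultimately have "cohomology_map X f Z = coboundaries X +>\<^bsub>cocycle_ring X\<^esub> a"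
    unfolding cohomology_map_def by auto
  then show thesis by (rule that)
qed

text \<open>Elements of the image are cosets of coboundaries, and adding a coset to itself gives the
  coboundaries because cochains have coefficients in characteristic 2.\<close>

lemma W_algebra_add_self:
  assumes "w \<in> carrier (W_algebra TYPE('n::finite))"
  shows "w \<oplus>\<^bsub>W_algebra TYPE('n)\<^esub> w = \<zero>\<^bsub>W_algebra TYPE('n)\<^esub>"
proof -
  let ?X = "oriented_grassmannian :: ((real^'n) set \<times> (real^'n^3) set) topology"
  have "w \<in> cohomology_map ?X fst ` carrier (cohomology (grassmannian :: (real^'n) set topology))"
    using assms by (simp add: W_algebra_def Let_def)
  then obtain Z where Z: "Z \<in> carrier (cohomology (grassmannian :: (real^'n) set topology))"
    and w: "w = cohomology_map ?X fst Z" by blast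
  obtain a where "cohomology_map ?X fst Z = coboundaries ?X +>\<^bsub>cocycle_ring ?X\<^esub> a"
    by (rule cohomology_map_coset[OF continuous_map_forget_orientation Z])
  then show ?thesis
    unfolding w by (simp add: W_algebra_def Let_def cohomology_def graded_quot_simps coset_add_self)
qed

text \<open>\<open>ring_iso\<close> speaks of sums, products and one, but not of zero. That
  \<open>h\<close> preserves zero follows from 0 = 0 + 0 in \<open>A\<close> and w + w = 0 in
  \<open>B\<close>; this is the reason for the hypothesis on \<open>B\<close>.\<close>

lemma presented_Lfam_transfer:
  assumes A: "presented_Lfam A pr t m" and h: "h \<in> ring_iso A B" "\<And>k. h ` grade A k = grade B k"
    and B: "\<And>w. w \<in> carrier B \<Longrightarrow> w \<oplus>\<^bsub>B\<^esub> w = \<zero>\<^bsub>B\<^esub>"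
  shows "presented_Lfam B (\<lambda>p. h (pr p)) t m"
proof -
  interpret A: presented_Lfam A pr t m by (rule A)
  have hom: "h (a \<oplus>\<^bsub>A\<^esub> b) = h a \<oplus>\<^bsub>B\<^esub> h b" "h (a \<otimes>\<^bsub>A\<^esub> b) = h a \<otimes>\<^bsub>B\<^esub> h b"
    if "a \<in> carrier A" "b \<in> carrier A" for a b
    using h(1) that by (auto simp: ring_iso_def ring_hom_def)
  have one: "h \<one>\<^bsub>A\<^esub> = \<one>\<^bsub>B\<^esub>" using h(1) by (auto simp: ring_iso_def ring_hom_def)
  have bij: "bij_betw h (carrier A) (carrier B)" using h(1) by (simp add: ring_iso_def)
  have "h (\<zero>\<^bsub>A\<^esub> \<oplus>\<^bsub>A\<^esub> \<zero>\<^bsub>A\<^esub>) = \<zero>\<^bsub>B\<^esub>"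
    unfolding hom(1)[OF A.zero_closed A.zero_closed]
    by (rule B) (use bij_betwE[OF bij] A.zero_closed in blast)
  moreover have "\<zero>\<^bsub>A\<^esub> \<oplus>\<^bsub>A\<^esub> \<zero>\<^bsub>A\<^esub> = \<zero>\<^bsub>A\<^esub>" by (simp flip: A.pr_zero A.pr_add)
  ultimately have zero: "h \<zero>\<^bsub>A\<^esub> = \<zero>\<^bsub>B\<^esub>" by simp
  show ?thesis
  proof (intro presented_Lfam.intro presented.intro)
    show "carrier B = range (\<lambda>p. h (pr p))"
      using bij_betw_imp_surj_on[OF bij] A.carrier_eq by auto
    show "grade B k = (\<lambda>p. h (pr p)) ` bhom k" for k
      using h(2)[of k] A.grade_eq[of k] by auto
    show "h (pr p) = \<zero>\<^bsub>B\<^esub> \<longleftrightarrow> (\<forall>l\<in>Lfam t m. l p = 0)" for p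
    proof -
      have "h (pr p) = h \<zero>\<^bsub>A\<^esub> \<longleftrightarrow> pr p = \<zero>\<^bsub>A\<^esub>"
        by (rule inj_on_eq_iff[OF bij_betw_imp_inj_on[OF bij] A.pr_closed A.zero_closed])
      then show ?thesis unfolding A.L_ker zero .
    qed
    show "l (p + q) = l p + l q" if "l \<in> Lfam t m" for l p q using Lfam_add[OF that] .
  qed (simp_all add: A.pr_add A.pr_mult A.pr_one A.pr_zero hom one zero)
qed

theorem theorem3p2:
  fixes t n :: nat
  assumes "t \<ge> 4" and "2^t - 1 \<le> n" and "n < 2^(t+1) - 1"
    and "CARD('n::finite) = n"
  shows
    "(graded_iso (presented_algebra n) (W_algebra TYPE('n)) \<longrightarrow>
      (2^t - 1 \<le> n \<and> n \<le> 2^t + 2^(t-2) \<longrightarrow>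
         zcl (W_algebra TYPE('n)) = enat (2^t + 2^(t-1) - 4)) \<and>
      (n = 2^t + 2^(t-2) + 1 \<longrightarrow>
         zcl (W_algebra TYPE('n)) = enat (2^t + 2^(t-1) - 3)) \<and>
      (2^t + 2^(t-2) + 2 \<le> n \<and> n \<le> 2^t + 2^(t-1) \<longrightarrow>
         zcl (W_algebra TYPE('n)) = enat (2^t + 2^(t-1) - 2)) \<and>
      (n = 2^t + 2^(t-1) + 1 \<longrightarrow>
         zcl (W_algebra TYPE('n)) = enat (2^(t+1) + 2^(t-3) - 3)) \<and>
      (2^t + 2^(t-1) + 2 \<le> n \<and> n \<le> 13 * 2^(t-3) \<longrightarrow>
         zcl (W_algebra TYPE('n)) = enat (2^(t+1) + 2^(t-3) - 2)) \<and>
      (13 * 2^(t-3) + 1 \<le> n \<and> n \<le> 2^t + 2^(t-1) + 2^(t-2) \<longrightarrow>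
         zcl (W_algebra TYPE('n)) = enat (2^(t+1) + 2^(t-2) - 2)) \<and>
      (\<forall>s. 1 \<le> s \<and> s \<le> t - 3 \<and> 2^(t+1) - 2^(s+1) + 1 \<le> n \<and> n \<le> 2^(t+1) - 2^s \<longrightarrow>
         zcl (W_algebra TYPE('n)) = enat (3 * 2^t - 2^(s+1) - 2))) \<and>
      (2^t - 1 \<le> n \<and> n \<le> 2^t + 2^(t-2) \<longrightarrow>
         zcl (presented_algebra n) = enat (2^t + 2^(t-1) - 4)) \<and>
      (n = 2^t + 2^(t-2) + 1 \<longrightarrow>
         zcl (presented_algebra n) = enat (2^t + 2^(t-1) - 3)) \<and>
      (2^t + 2^(t-2) + 2 \<le> n \<and> n \<le> 2^t + 2^(t-1) \<longrightarrow>
         zcl (presented_algebra n) = enat (2^t + 2^(t-1) - 2)) \<and>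
      (n = 2^t + 2^(t-1) + 1 \<longrightarrow>
         zcl (presented_algebra n) = enat (2^(t+1) + 2^(t-3) - 3)) \<and>
      (2^t + 2^(t-1) + 2 \<le> n \<and> n \<le> 13 * 2^(t-3) \<longrightarrow>
         zcl (presented_algebra n) = enat (2^(t+1) + 2^(t-3) - 2)) \<and>
      (13 * 2^(t-3) + 1 \<le> n \<and> n \<le> 2^t + 2^(t-1) + 2^(t-2) \<longrightarrow>
         zcl (presented_algebra n) = enat (2^(t+1) + 2^(t-2) - 2)) \<and>
      (\<forall>s. 1 \<le> s \<and> s \<le> t - 3 \<and> 2^(t+1) - 2^(s+1) + 1 \<le> n \<and> n \<le> 2^(t+1) - 2^s \<longrightarrow>
         zcl (presented_algebra n) = enat (3 * 2^t - 2^(s+1) - 2))"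
proof -
  define m where "m = 2 ^ (t + 1) - 1 - n"
  have nm: "n + m = 2 ^ (t + 1) - 1" using assms(3) unfolding m_def by linarith
  have A: "presented_Lfam (presented_algebra n) (\<lambda>p. Igr n +>\<^bsub>w_polynomials\<^esub> p) t m"
    using assms(1,2) nm by (intro presented_algebra_Lfam) auto
  note vA = presented_Lfam.zcl_values[OF A assms(1,2) nm]
  \<comment> \<open>The surjection is chosen before an isomorphism is assumed, so that all values
    for the topological algebra become facts with the isomorphism as a premise.\<close>
  define pr where "pr = (SOME pr. presented_Lfam (W_algebra TYPE('n)) pr t m)"
  have W: "presented_Lfam (W_algebra TYPE('n)) pr t m"
    if iso: "graded_iso (presented_algebra n) (W_algebra TYPE('n))"
  proof -
    obtain h where "h \<in> ring_iso (presented_algebra n) (W_algebra TYPE('n))"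
      "\<And>k. h ` grade (presented_algebra n) k = grade (W_algebra TYPE('n)) k"
      using iso unfolding graded_iso_def by blast
    then have "presented_Lfam (W_algebra TYPE('n)) (\<lambda>p. h (Igr n +>\<^bsub>w_polynomials\<^esub> p)) t m"
      by (rule presented_Lfam_transfer[OF A _ _ W_algebra_add_self])
    then show ?thesis unfolding pr_def by (rule someI[where P = "\<lambda>pr. presented_Lfam (W_algebra TYPE('n)) pr t m"])
  qed
  note vW = presented_Lfam.zcl_values[OF W assms(1,2) nm]
  show ?thesis
    by (intro conjI impI allI; ((rule vA; assumption) | (rule vW; assumption)))
qed

end
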